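(* Suppose Assumptions (A3) and (A4) hold and $\delta\in(0,a_0)$, where $a_0=\frac{1-e^{-\omega}}{2\sigma}$. Then: (1) for every $\varepsilon>0$ there exist $N_0(\varepsilon),n_0(\varepsilon)\in\mathbb{N}$ such that $E\,\mathcal{W}_1(\mu_n^N,\mu_n)<\varepsilon$ whenever $n\ge n_0(\varepsilon)$ and $N\ge N_0(\varepsilon)$; (2) if in addition $E\,\mathcal{W}_1(\mu_0^N,\mu_0)\to0$ as $N\to\infty$, then $\sup_{n\ge1}E\,\mathcal{W}_1(\mu_n^N,\mu_n)\to0$ as $N\to\infty$.
   Context: Setting. Fix integers $d,m\ge1$, a real $d\times d$ matrix $A$ with operator norm $\|A\|$, $\delta>0$, a Borel probability measure $\theta$ on $\mathbb{R}^m$, and a measurable $f:\mathbb{R}^d\times\mathcal{P}_1(\mathbb{R}^d)\times\mathbb{R}^m\to\mathbb{R}^d$. $\mathcal{P}_1(\mathbb{R}^d)$: Borel probability measures on $\mathbb{R}^d$ with finite first moment, with the Wasserstein-1 distance $\mathcal{W}_1(\mu,\nu)=\inf E|X-Y|$ over couplings. Particle system: for each $N\ge1$, $\{X_0^{i,N}\}_{i=1}^N$ are exchangeable, each with law $\mu_0\in\mathcal{P}_1(\mathbb{R}^d)$; $\{\epsilon_n^i\}_{i,n\ge1}$ i.i.d. with law $\theta$, independent of the initial conditions; $X_{n+1}^{i,N}=AX_n^{i,N}+\delta f(X_n^{i,N},\mu_n^N,\epsilon_{n+1}^i)$, $\mu_n^N=\frac1N\sum_{i=1}^N\delta_{X_n^{i,N}}$.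 Nonlinear evolution: $\Psi(\mu)$ is the law of $AX+\delta f(X,\mu,\epsilon)$ with $(X,\epsilon)\sim\mu\otimes\theta$, and $\mu_{n+1}=\Psi(\mu_n)$. $D(z):=\sup\frac{|f(x_1,\mu_1,z)-f(x_2,\mu_2,z)|}{|x_1-x_2|+\mathcal{W}_1(\mu_1,\mu_2)}$ (supremum over $(x_1,\mu_1)\neq(x_2,\mu_2)$), $D_1(z):=|f(0,\delta_0,z)|$, $\sigma:=\int D\,d\theta$. Assumption (A3): $\|A\|\le e^{-\omega}$ for some $\omega>0$. Assumption (A4): for some $\alpha>0$, $E|X_0^{i,N}|^{1+\alpha}=\int|x|^{1+\alpha}\mu_0(dx)<\infty$, $\sigma_1(\alpha):=\int D(z)^{1+\alpha}\theta(dz)<\infty$ and $c_1(\alpha):=\int D_1(z)^{1+\alpha}\theta(dz)<\infty$. *)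

theory Defs
  imports "HOL-Probability.Probability"
begin

definition P1 :: "('a::euclidean_space) measure set" where
  "P1 = {\<mu>. prob_space \<mu> \<and> sets \<mu> = sets borel \<and> (\<integral>\<^sup>+ x. ennreal (norm x) \<partial>\<mu>) < \<infinity>}"

definition couplings :: "('a::euclidean_space) measure \<Rightarrow> 'a measure \<Rightarrow> ('a \<times> 'a) measure set" where
  "couplings \<mu> \<nu> = {\<pi>. prob_space \<pi> \<and> sets \<pi> = sets (borel \<Otimes>\<^sub>M borel)
      \<and> distr \<pi> borel fst = \<mu> \<and> distr \<pi> borel snd = \<nu>}"

definition W1 :: "('a::euclidean_space) measure \<Rightarrow> 'a measure \<Rightarrow> real" where
  "W1 \<mu> \<nu> = enn2real (INF \<pi>\<in>couplings \<mu> \<nu>. \<integral>\<^sup>+ p. ennreal (dist (fst p) (snd p)) \<partial>\<pi>)"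

definition empirical :: "nat \<Rightarrow> (nat \<Rightarrow> 'a::euclidean_space) \<Rightarrow> 'a measure" where
  "empirical N x = distr (uniform_count_measure {1..N}) borel x"

definition Dconst :: "(real^'d \<Rightarrow> (real^'d) measure \<Rightarrow> 'b \<Rightarrow> real^'d) \<Rightarrow> 'b \<Rightarrow> ennreal" where
  "Dconst f z = (SUP pq \<in> {((x1,\<mu>1),(x2,\<mu>2)). \<mu>1 \<in> P1 \<and> \<mu>2 \<in> P1 \<and> (x1,\<mu>1) \<noteq> (x2,\<mu>2)}.
      (case pq of ((x1,\<mu>1),(x2,\<mu>2)) \<Rightarrow>
        ennreal (norm (f x1 \<mu>1 z - f x2 \<mu>2 z) / (norm (x1 - x2) + W1 \<mu>1 \<mu>2))))"

definition D1const :: "(real^'d \<Rightarrow> (real^'d) measure \<Rightarrow> 'b \<Rightarrow> real^'d) \<Rightarrow> 'b \<Rightarrow> real" where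
  "D1const f z = norm (f 0 (return borel 0) z)"

definition epow :: "ennreal \<Rightarrow> real \<Rightarrow> ennreal" where
  "epow t p = (if t = \<infinity> then \<infinity> else ennreal (enn2real t powr p))"

fun particles :: "real^'d^'d \<Rightarrow> real \<Rightarrow> (real^'d \<Rightarrow> (real^'d) measure \<Rightarrow> 'b \<Rightarrow> real^'d)
    \<Rightarrow> (nat \<Rightarrow> nat \<Rightarrow> 'w \<Rightarrow> real^'d) \<Rightarrow> (nat \<Rightarrow> nat \<Rightarrow> 'w \<Rightarrow> 'b)
    \<Rightarrow> nat \<Rightarrow> nat \<Rightarrow> nat \<Rightarrow> 'w \<Rightarrow> real^'d" where
  "particles A \<delta> f X0 eps N 0 = X0 N"
| "particles A \<delta> f X0 eps N (Suc n) = (\<lambda>i \<omega>.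
     A *v particles A \<delta> f X0 eps N n i \<omega>
     + \<delta> *\<^sub>R f (particles A \<delta> f X0 eps N n i \<omega>)
                 (empirical N (\<lambda>j. particles A \<delta> f X0 eps N n j \<omega>))
                 (eps i (Suc n) \<omega>))"

definition emp_meas :: "real^'d^'d \<Rightarrow> real \<Rightarrow> (real^'d \<Rightarrow> (real^'d) measure \<Rightarrow> 'b \<Rightarrow> real^'d)
    \<Rightarrow> (nat \<Rightarrow> nat \<Rightarrow> 'w \<Rightarrow> real^'d) \<Rightarrow> (nat \<Rightarrow> nat \<Rightarrow> 'w \<Rightarrow> 'b)
    \<Rightarrow> nat \<Rightarrow> nat \<Rightarrow> 'w \<Rightarrow> (real^'d) measure" where
  "emp_meas A \<delta> f X0 eps N n \<omega> = empirical N (\<lambda>j. particles A \<delta> f X0 eps N n j \<omega>)"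

definition Psi :: "real^'d^'d \<Rightarrow> real \<Rightarrow> (real^'d \<Rightarrow> (real^'d) measure \<Rightarrow> 'b::euclidean_space \<Rightarrow> real^'d)
    \<Rightarrow> 'b measure \<Rightarrow> (real^'d) measure \<Rightarrow> (real^'d) measure" where
  "Psi A \<delta> f \<theta> \<mu> = distr (\<mu> \<Otimes>\<^sub>M \<theta>) borel (\<lambda>(x,z). A *v x + \<delta> *\<^sub>R f x \<mu> z)"

definition nonlin :: "real^'d^'d \<Rightarrow> real \<Rightarrow> (real^'d \<Rightarrow> (real^'d) measure \<Rightarrow> 'b::euclidean_space \<Rightarrow> real^'d)
    \<Rightarrow> 'b measure \<Rightarrow> (real^'d) measure \<Rightarrow> nat \<Rightarrow> (real^'d) measure" where
  "nonlin A \<delta> f \<theta> \<mu>0 n = (Psi A \<delta> f \<theta> ^^ n) \<mu>0"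

end

theory Submission
  imports Defs
begin

text \<open>The nonlinear map \<open>\<Psi>\<close> contracts the Wasserstein distance with factor
  \<open>\<gamma> = exp (- \<omega>) + 2 * \<delta> * \<sigma> < 1\<close>, so the triangle inequality through
  \<open>\<Psi> (\<mu>\<^sup>N\<^sub>n)\<close> bounds the distance of \<open>\<mu>\<^sup>N\<^sub>n\<close> and \<open>\<mu>\<^sub>n\<close> by a geometric sum of the
  one-step errors between \<open>\<mu>\<^sup>N\<^sub>k\<^sub>+\<^sub>1\<close> and \<open>\<Psi> (\<mu>\<^sup>N\<^sub>k)\<close>, plus \<open>\<gamma> ^ n\<close> times the initial distance.
  Given the particles at time \<open>k\<close>, those at time \<open>k + 1\<close> are independent and their laws average to
  \<open>\<Psi> (\<mu>\<^sup>N\<^sub>k)\<close>. Comparing masses on a finite partition of a ball of radius \<open>R\<close> into small cells,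
  where each mass fluctuates by at most \<open>1 / sqrt N\<close> in mean, bounds the one-step error by the mesh,
  the tails beyond \<open>R\<close> and a multiple of \<open>1 / sqrt N\<close>. The tails are controlled by a moment of
  order slightly above one, which stays bounded in \<open>n\<close> and \<open>N\<close> since \<open>\<gamma> < 1\<close>.\<close>

section \<open>Couplings from partitions\<close>

text \<open>Measurability shapes the argument. The distance between the empirical measure and its
  limit is never shown to be a measurable function of the sample point, so before integrals are
  split it is bounded pointwise by measurable quantities: \<open>err\<close> for one step, then the
  function \<open>S\<close> of \<open>wass_iterate\<close>. Both are built from finitely many cell
  masses and tail integrals. Couplings are built without disintegration. A density on a product
  space that depends only on cell labels serves twice: it glues two couplings approximately along a
  fine partition, which gives the triangle inequality, and it realises the maximal coupling of cell
  masses. The exponent of the moment has to be close to one. At the full order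
  \<open>1 + \<alpha>\<close> one step may multiply the moment by a factor of the type of the
  \<open>1 + \<alpha>\<close>-th moment of \<open>c + 2 * \<delta> * D\<close>, and the bound on
  \<open>\<delta>\<close> does not keep that factor below 1, because it only concerns the mean of
  \<open>D\<close>.\<close>

lemma nn_integral_finite_range:
  fixes u :: "'a \<Rightarrow> nat" and F :: "nat \<Rightarrow> ennreal"
  assumes [measurable]: "u \<in> measurable P (count_space UNIV)" and "\<And>x. u x \<le> K"
  shows "(\<integral>\<^sup>+x. F (u x) \<partial>P) = (\<Sum>i\<le>K. F i * emeasure P (u -` {i} \<inter> space P))"
proof -
  have [measurable]: "u -` {i} \<inter> space P \<in> sets P" for i
    by (rule measurable_sets[OF assms(1)]) simp
  have "(\<integral>\<^sup>+x. F (u x) \<partial>P) = (\<integral>\<^sup>+x. (\<Sum>i\<le>K. F i * indicator (u -` {i} \<inter> space P) x) \<partial>P)"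
    using assms(2) by (intro nn_integral_cong) (auto simp: indicator_def if_distrib sum.delta cong: if_cong)
  also have "\<dots> = (\<Sum>i\<le>K. \<integral>\<^sup>+x. F i * indicator (u -` {i} \<inter> space P) x \<partial>P)"
    by (rule nn_integral_sum) measurable
  also have "\<dots> = (\<Sum>i\<le>K. F i * emeasure P (u -` {i} \<inter> space P))"
    by (intro sum.cong refl nn_integral_cmult_indicator) simp
  finally show ?thesis .
qed

text \<open>There are countably many fibres, so the null ones have a null union. This is why
  \<open>fibre_density_coupling\<close> can ask for its marginal conditions at labels of positive
  mass only.\<close>

lemma AE_nonnull_fibre:
  fixes u :: "'a \<Rightarrow> nat"
  assumes [measurable]: "u \<in> measurable P (count_space UNIV)"
  shows "AE x in P. emeasure P (u -` {u x} \<inter> space P) \<noteq> 0"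
proof -
  have "AE x in P. \<forall>k. emeasure P (u -` {k} \<inter> space P) = 0 \<longrightarrow> x \<notin> u -` {k} \<inter> space P"
    unfolding AE_all_countable
  proof
    fix k
    show "AE x in P. emeasure P (u -` {k} \<inter> space P) = 0 \<longrightarrow> x \<notin> u -` {k} \<inter> space P"
    proof (cases "emeasure P (u -` {k} \<inter> space P) = 0")
      case True
      then have "u -` {k} \<inter> space P \<in> null_sets P" by (intro null_setsI) simp_all
      from AE_not_in[OF this] show ?thesis by eventually_elim simp
    qed simp
  qed
  with AE_space show ?thesis by eventually_elim auto
qed

text \<open>The product of two countable discrete spaces is discrete, so any function of the two
  labels is measurable.\<close>

lemma measurable_fibre_kernel:
  fixes u :: "'a \<Rightarrow> nat" and v :: "'b \<Rightarrow> nat" and H :: "nat \<Rightarrow> nat \<Rightarrow> ennreal"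
  assumes [measurable]: "u \<in> measurable P (count_space UNIV)" "v \<in> measurable Q (count_space UNIV)"
  shows "(\<lambda>w. H (u (fst w)) (v (snd w))) \<in> borel_measurable (P \<Otimes>\<^sub>M Q)"
proof -
  have "(\<lambda>w. (u (fst w), v (snd w))) \<in> measurable (P \<Otimes>\<^sub>M Q) (count_space UNIV \<Otimes>\<^sub>M count_space UNIV)"
    by measurable
  then have "(\<lambda>w. (u (fst w), v (snd w))) \<in> measurable (P \<Otimes>\<^sub>M Q) (count_space UNIV)"
    by (simp add: pair_measure_countable)
  from measurable_compose[OF this, of "case_prod H" borel] show ?thesis by simp
qed

lemma sets_fibre_neq:
  fixes u :: "'a \<Rightarrow> nat" and v :: "'b \<Rightarrow> nat"
  assumes "u \<in> measurable P (count_space UNIV)" "v \<in> measurable Q (count_space UNIV)"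
  shows "{w \<in> space (P \<Otimes>\<^sub>M Q). u (fst w) \<noteq> v (snd w)} \<in> sets (P \<Otimes>\<^sub>M Q)"
proof -
  have "(\<lambda>w. of_bool (u (fst w) \<noteq> v (snd w)) :: ennreal) \<in> borel_measurable (P \<Otimes>\<^sub>M Q)"
    by (rule measurable_fibre_kernel[OF assms, of "\<lambda>i j. of_bool (i \<noteq> j)"])
  then have "{w \<in> space (P \<Otimes>\<^sub>M Q). of_bool (u (fst w) \<noteq> v (snd w)) \<noteq> (0::ennreal)} \<in> sets (P \<Otimes>\<^sub>M Q)"
    by measurable
  then show ?thesis by simp
qed

text \<open>Reweighting a product measure by a function of the two labels leaves the distribution
  inside each cell alone. The marginals therefore survive as soon as the reweighting averages to 1
  over the other coordinate, label by label, which is what \<open>H1\<close> and \<open>H2\<close>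
  say.\<close>

lemma fibre_density_coupling:
  fixes u :: "'a \<Rightarrow> nat" and v :: "'b \<Rightarrow> nat" and H :: "nat \<Rightarrow> nat \<Rightarrow> ennreal"
  assumes P: "prob_space P" and Q: "prob_space Q"
    and u[measurable]: "u \<in> measurable P (count_space UNIV)"
    and v[measurable]: "v \<in> measurable Q (count_space UNIV)"
    and H1: "\<And>i. emeasure P (u -` {i} \<inter> space P) \<noteq> 0 \<Longrightarrow> (\<integral>\<^sup>+y. H i (v y) \<partial>Q) = 1"
    and H2: "\<And>j. emeasure Q (v -` {j} \<inter> space Q) \<noteq> 0 \<Longrightarrow> (\<integral>\<^sup>+x. H (u x) j \<partial>P) = 1"
  defines "J \<equiv> density (P \<Otimes>\<^sub>M Q) (\<lambda>w. H (u (fst w)) (v (snd w)))"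
  shows "prob_space J" "distr J P fst = P" "distr J Q snd = Q"
proof -
  interpret P: prob_space P by fact
  interpret Q: prob_space Q by fact
  interpret PQ: pair_prob_space P Q ..
  have [measurable]: "(\<lambda>w. H (u (fst w)) (v (snd w))) \<in> borel_measurable (P \<Otimes>\<^sub>M Q)"
    by (rule measurable_fibre_kernel[OF u v])
  show d1: "distr J P fst = P"
  proof (rule measure_eqI)
    fix A assume "A \<in> sets (distr J P fst)"
    then have A[measurable]: "A \<in> sets P" by simp
    have "emeasure (distr J P fst) A = emeasure J (fst -` A \<inter> space J)"
      by (subst emeasure_distr) (auto simp: J_def)
    also have "\<dots> = (\<integral>\<^sup>+w. H (u (fst w)) (v (snd w)) * indicator A (fst w) \<partial>(P \<Otimes>\<^sub>M Q))"
      unfolding J_def by (subst emeasure_density)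
        (auto simp: space_pair_measure indicator_def intro!: nn_integral_cong)
    also have "\<dots> = (\<integral>\<^sup>+x. \<integral>\<^sup>+y. H (u x) (v y) * indicator A x \<partial>Q \<partial>P)"
      by (subst Q.nn_integral_fst[symmetric]) simp_all
    also have "\<dots> = (\<integral>\<^sup>+x. (\<integral>\<^sup>+y. H (u x) (v y) \<partial>Q) * indicator A x \<partial>P)"
      by (intro nn_integral_cong nn_integral_multc) simp
    also have "\<dots> = (\<integral>\<^sup>+x. indicator A x \<partial>P)"
      using AE_nonnull_fibre[OF u] by (intro nn_integral_cong_AE) (auto simp: H1)
    finally show "emeasure (distr J P fst) A = emeasure P A" by simp
  qed simp
  show "distr J Q snd = Q"
  proof (rule measure_eqI)
    fix A assume "A \<in> sets (distr J Q snd)"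
    then have A[measurable]: "A \<in> sets Q" by simp
    have "emeasure (distr J Q snd) A = emeasure J (snd -` A \<inter> space J)"
      by (subst emeasure_distr) (auto simp: J_def)
    also have "\<dots> = (\<integral>\<^sup>+w. H (u (fst w)) (v (snd w)) * indicator A (snd w) \<partial>(P \<Otimes>\<^sub>M Q))"
      unfolding J_def by (subst emeasure_density)
        (auto simp: space_pair_measure indicator_def intro!: nn_integral_cong)
    also have "\<dots> = (\<integral>\<^sup>+y. \<integral>\<^sup>+x. H (u x) (v y) * indicator A y \<partial>P \<partial>Q)"
      by (subst PQ.nn_integral_snd[symmetric]) (simp_all add: case_prod_beta')
    also have "\<dots> = (\<integral>\<^sup>+y. (\<integral>\<^sup>+x. H (u x) (v y) \<partial>P) * indicator A y \<partial>Q)"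
      by (intro nn_integral_cong nn_integral_multc) simp
    also have "\<dots> = (\<integral>\<^sup>+y. indicator A y \<partial>Q)"
      using AE_nonnull_fibre[OF v] by (intro nn_integral_cong_AE) (auto simp: H2)
    finally show "emeasure (distr J Q snd) A = emeasure Q A" by simp
  qed simp
  show "prob_space J"
  proof (rule prob_spaceI)
    have "emeasure J (space J) = emeasure (distr J P fst) (space P)"
      by (subst emeasure_distr) (auto simp: J_def space_pair_measure intro!: arg_cong2[where f=emeasure])
    then show "emeasure J (space J) = 1" using d1 P.emeasure_space_1 by simp
  qed
qed

text \<open>The two points are made conditionally independent given a common label. In the triangle
  inequality this stands in for disintegration along the shared marginal.\<close>

lemma coupling_over_statistic:
  fixes u :: "'a \<Rightarrow> nat" and v :: "'b \<Rightarrow> nat"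
  assumes P: "prob_space P" and Q: "prob_space Q"
    and u[measurable]: "u \<in> measurable P (count_space UNIV)"
    and v[measurable]: "v \<in> measurable Q (count_space UNIV)"
    and eq: "\<And>k. emeasure P (u -` {k} \<inter> space P) = emeasure Q (v -` {k} \<inter> space Q)"
  obtains J where "prob_space J" "sets J = sets (P \<Otimes>\<^sub>M Q)" "distr J P fst = P" "distr J Q snd = Q"
    "AE w in J. u (fst w) = v (snd w)"
proof -
  interpret P: prob_space P by fact
  interpret Q: prob_space Q by fact
  define p where "p k = emeasure P (u -` {k} \<inter> space P)" for k
  \<comment> \<open>Conditional independence given label \<open>i\<close> has density
    \<open>1 / p i\<close> on the diagonal cell. At a null cell this value is infinite, which is
    harmless because the marginal conditions concern cells of positive mass.\<close>
  define H where "H i j = (if i = j then inverse (p i) else 0)" for i j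
  define J where "J = density (P \<Otimes>\<^sub>M Q) (\<lambda>w. H (u (fst w)) (v (snd w)))"
  have 1: "inverse (p i) * p i = 1" if "p i \<noteq> 0" for i
  proof -
    have "p i \<noteq> \<top>" unfolding p_def by simp
    with that show ?thesis by (metis ennreal_mult_divide_eq divide_ennreal_def mult.commute mult.left_neutral)
  qed
  have h1: "(\<integral>\<^sup>+y. H i (v y) \<partial>Q) = 1" if "emeasure P (u -` {i} \<inter> space P) \<noteq> 0" for i
  proof -
    have "(\<integral>\<^sup>+y. H i (v y) \<partial>Q) = (\<integral>\<^sup>+y. inverse (p i) * indicator (v -` {i} \<inter> space Q) y \<partial>Q)"
      by (intro nn_integral_cong) (auto simp: H_def)
    also have "\<dots> = inverse (p i) * p i"
      by (subst nn_integral_cmult_indicator) (simp_all add: p_def eq)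
    finally show ?thesis using 1[of i] that by (simp add: p_def)
  qed
  have h2: "(\<integral>\<^sup>+x. H (u x) i \<partial>P) = 1" if "emeasure Q (v -` {i} \<inter> space Q) \<noteq> 0" for i
  proof -
    have "(\<integral>\<^sup>+x. H (u x) i \<partial>P) = (\<integral>\<^sup>+y. inverse (p i) * indicator (u -` {i} \<inter> space P) y \<partial>P)"
      by (intro nn_integral_cong) (auto simp: H_def)
    also have "\<dots> = inverse (p i) * p i"
      by (subst nn_integral_cmult_indicator) (simp_all add: p_def)
    finally show ?thesis using 1[of i] that by (simp add: p_def eq)
  qed
  have m: "(\<lambda>w. H (u (fst w)) (v (snd w))) \<in> borel_measurable (P \<Otimes>\<^sub>M Q)"
    by (rule measurable_fibre_kernel[OF u v])
  note c = fibre_density_coupling[where H = H, OF P Q u v h1 h2, folded J_def]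
  show ?thesis
  proof (rule that[of J])
    show "prob_space J" "distr J P fst = P" "distr J Q snd = Q" using c by blast+
    show "sets J = sets (P \<Otimes>\<^sub>M Q)" by (simp add: J_def)
    show "AE w in J. u (fst w) = v (snd w)"
      unfolding J_def by (subst AE_density[OF m]) (auto simp: H_def)
  qed
qed

section \<open>The Wasserstein distance\<close>

text \<open>The infimum before \<open>enn2real\<close> is applied. With values in
  \<open>ennreal\<close> the triangle inequality holds for arbitrary measures, whereas
  \<open>W1\<close> turns an infinite distance, such as that of an empty set of couplings, into
  0.\<close>

definition wass :: "('a::euclidean_space) measure \<Rightarrow> 'a measure \<Rightarrow> ennreal" where
  "wass \<mu> \<nu> = (INF \<pi>\<in>couplings \<mu> \<nu>. \<integral>\<^sup>+ p. ennreal (dist (fst p) (snd p)) \<partial>\<pi>)"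

lemma W1_eq_wass: "W1 \<mu> \<nu> = enn2real (wass \<mu> \<nu>)"
  by (simp add: W1_def wass_def)

lemma wass_le:
  "\<pi> \<in> couplings \<mu> \<nu> \<Longrightarrow> wass \<mu> \<nu> \<le> (\<integral>\<^sup>+ p. ennreal (dist (fst p) (snd p)) \<partial>\<pi>)"
  unfolding wass_def by (rule INF_lower)

lemma wass_less:
  assumes "wass \<mu> \<nu> < c"
  obtains \<pi> where "\<pi> \<in> couplings \<mu> \<nu>" "(\<integral>\<^sup>+ p. ennreal (dist (fst p) (snd p)) \<partial>\<pi>) < c"
  using assms unfolding wass_def INF_less_iff by blast

text \<open>A point is labelled by the first member of a countable dense sequence within
  \<open>\<eta>/2\<close> of it, and two points with the same label are compared through that
  member.\<close>

lemma countable_fine_partition: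
  fixes \<eta> :: real
  assumes "\<eta> > 0"
  obtains q :: "'a::euclidean_space \<Rightarrow> nat" where "q \<in> measurable borel (count_space UNIV)"
    "\<And>x y. q x = q y \<Longrightarrow> dist x y \<le> \<eta>"
proof -
  obtain D :: "'a set" where D: "countable D" "\<And>X. open X \<Longrightarrow> X \<noteq> {} \<Longrightarrow> \<exists>d\<in>D. d \<in> X"
    using countable_dense_setE by blast
  define P where "P k x \<longleftrightarrow> dist x (from_nat_into D k) < \<eta>/2" for k x
  have ex: "\<exists>k. P k x" for x
  proof -
    obtain d where "d \<in> D" "d \<in> ball x (\<eta>/2)" using D(2)[of "ball x (\<eta>/2)"] assms by auto
    then show ?thesis using from_nat_into_surj[OF D(1)] unfolding P_def by (metis mem_ball)
  qed
  have l: "P (LEAST k. P k x) x" for x using LeastI_ex[OF ex] .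
  show ?thesis
  proof (rule that[of "\<lambda>x. LEAST k. P k x"])
    show "(\<lambda>x. LEAST k. P k x) \<in> measurable borel (count_space UNIV)"
      unfolding P_def by measurable
    fix x y assume eq: "(LEAST k. P k x) = (LEAST k. P k y)"
    show "dist x y \<le> \<eta>" 
      using l[of x, unfolded eq] l[of y] dist_triangle2[of x y "from_nat_into D (LEAST k. P k y)"]
      by (simp add: P_def)
  qed
qed

lemma ennreal_less_add:
  "a < \<top> \<Longrightarrow> 0 < e \<Longrightarrow> a < a + ennreal e"
  by (cases a) (auto simp flip: ennreal_plus simp: ennreal_less_iff)

text \<open>Near-optimal couplings are glued only up to the cell of their middle coordinates; the
  cell masses agree because both couplings have the marginal \<open>\<nu>\<close> there. The two
  middle points then differ by at most \<open>e/3\<close>, and the two near-optimality defects make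
  up the remaining \<open>2 * e/3\<close>.\<close>

lemma wass_triangle:
  fixes \<mu> \<nu> \<rho> :: "('a::euclidean_space) measure"
  shows "wass \<mu> \<rho> \<le> wass \<mu> \<nu> + wass \<nu> \<rho>"
proof (rule ennreal_le_epsilon)
  fix e :: real assume top: "wass \<mu> \<nu> + wass \<nu> \<rho> < \<top>" and e: "0 < e"
  have "wass \<mu> \<nu> < wass \<mu> \<nu> + ennreal (e/3)" "wass \<nu> \<rho> < wass \<nu> \<rho> + ennreal (e/3)"
    using top e by (auto intro!: ennreal_less_add)
  note less = this
  obtain \<pi>1 where \<pi>1: "\<pi>1 \<in> couplings \<mu> \<nu>"
      "(\<integral>\<^sup>+ p. ennreal (dist (fst p) (snd p)) \<partial>\<pi>1) < wass \<mu> \<nu> + ennreal (e/3)"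
    using wass_less[OF less(1)] by blast
  obtain \<pi>2 where \<pi>2: "\<pi>2 \<in> couplings \<nu> \<rho>"
      "(\<integral>\<^sup>+ p. ennreal (dist (fst p) (snd p)) \<partial>\<pi>2) < wass \<nu> \<rho> + ennreal (e/3)"
    using wass_less[OF less(2)] by blast
  obtain q :: "'a \<Rightarrow> nat" where q[measurable]: "q \<in> measurable borel (count_space UNIV)"
    and qd: "\<And>x y. q x = q y \<Longrightarrow> dist x y \<le> e/3"
    using countable_fine_partition[of "e/3"] e by auto
  have s1[measurable_cong]: "sets \<pi>1 = sets (borel \<Otimes>\<^sub>M borel)"
    and s2[measurable_cong]: "sets \<pi>2 = sets (borel \<Otimes>\<^sub>M borel)"
    and p1: "prob_space \<pi>1" and p2: "prob_space \<pi>2"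
    and d1: "distr \<pi>1 borel fst = \<mu>" "distr \<pi>1 borel snd = \<nu>"
    and d2: "distr \<pi>2 borel fst = \<nu>" "distr \<pi>2 borel snd = \<rho>"
    using \<pi>1 \<pi>2 by (auto simp: couplings_def)
  have [measurable]: "q -` {k} \<in> sets borel" for k
    using measurable_sets[OF q, of "{k}"] by simp
  have "emeasure \<pi>1 ((q \<circ> snd) -` {k} \<inter> space \<pi>1) = emeasure \<pi>2 ((q \<circ> fst) -` {k} \<inter> space \<pi>2)" for k
  proof -
    have "emeasure \<pi>1 ((q \<circ> snd) -` {k} \<inter> space \<pi>1) = emeasure (distr \<pi>1 borel snd) (q -` {k} \<inter> space borel)"
      by (subst emeasure_distr) (auto intro!: arg_cong2[where f=emeasure])
    also have "\<dots> = emeasure (distr \<pi>2 borel fst) (q -` {k} \<inter> space borel)" using d1 d2 by simp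
    also have "\<dots> = emeasure \<pi>2 ((q \<circ> fst) -` {k} \<inter> space \<pi>2)"
      by (subst emeasure_distr) (auto intro!: arg_cong2[where f=emeasure])
    finally show ?thesis .
  qed
  then obtain J where J: "prob_space J" and sJ[measurable_cong]: "sets J = sets (\<pi>1 \<Otimes>\<^sub>M \<pi>2)"
    and D: "distr J \<pi>1 fst = \<pi>1" "distr J \<pi>2 snd = \<pi>2"
    and ae: "AE w in J. (q \<circ> snd) (fst w) = (q \<circ> fst) (snd w)"
    by (rule coupling_over_statistic[OF p1 p2, of "q \<circ> snd" "q \<circ> fst", rotated 2]) auto
  define \<pi> where "\<pi> = distr J (borel \<Otimes>\<^sub>M borel) (\<lambda>w. (fst (fst w), snd (snd w)))"
  have "distr \<pi> borel fst = distr (distr J \<pi>1 fst) borel fst"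
    unfolding \<pi>_def by (subst (1 2) distr_distr) (auto simp: comp_def)
  moreover have "distr \<pi> borel snd = distr (distr J \<pi>2 snd) borel snd"
    unfolding \<pi>_def by (subst (1 2) distr_distr) (auto simp: comp_def)
  ultimately have "\<pi> \<in> couplings \<mu> \<rho>"
    unfolding couplings_def using d1 d2 D
    by (auto simp: \<pi>_def intro!: prob_space.prob_space_distr[OF J])
  then have "wass \<mu> \<rho> \<le> (\<integral>\<^sup>+ p. ennreal (dist (fst p) (snd p)) \<partial>\<pi>)" by (rule wass_le)
  also have "\<dots> = (\<integral>\<^sup>+ w. ennreal (dist (fst (fst w)) (snd (snd w))) \<partial>J)"
    unfolding \<pi>_def by (subst nn_integral_distr) auto
  also have "\<dots> \<le> (\<integral>\<^sup>+ w. (ennreal (dist (fst (fst w)) (snd (fst w))) + ennreal (dist (fst (snd w)) (snd (snd w)))) + ennreal (e/3) \<partial>J)"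
    using ae
  proof (intro nn_integral_mono_AE, eventually_elim)
    fix w :: "('a \<times> 'a) \<times> 'a \<times> 'a" assume "(q \<circ> snd) (fst w) = (q \<circ> fst) (snd w)"
    then have "dist (snd (fst w)) (fst (snd w)) \<le> e/3" using qd by simp
    then have "dist (fst (fst w)) (snd (snd w)) \<le> dist (fst (fst w)) (snd (fst w)) + dist (fst (snd w)) (snd (snd w)) + e/3"
      by (smt (verit) dist_triangle)
    then show "ennreal (dist (fst (fst w)) (snd (snd w))) \<le> (ennreal (dist (fst (fst w)) (snd (fst w))) + ennreal (dist (fst (snd w)) (snd (snd w)))) + ennreal (e/3)"
      using e by (simp flip: ennreal_plus)
  qed
  also have "\<dots> = (\<integral>\<^sup>+ w. ennreal (dist (fst (fst w)) (snd (fst w))) \<partial>J) + (\<integral>\<^sup>+ w. ennreal (dist (fst (snd w)) (snd (snd w))) \<partial>J) + ennreal (e/3)"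
    using prob_space.emeasure_space_1[OF J] by (simp add: nn_integral_add)
  also have "(\<integral>\<^sup>+ w. ennreal (dist (fst (fst w)) (snd (fst w))) \<partial>J) = (\<integral>\<^sup>+ p. ennreal (dist (fst p) (snd p)) \<partial>distr J \<pi>1 fst)"
    by (subst nn_integral_distr) auto
  also have "(\<integral>\<^sup>+ w. ennreal (dist (fst (snd w)) (snd (snd w))) \<partial>J) = (\<integral>\<^sup>+ p. ennreal (dist (fst p) (snd p)) \<partial>distr J \<pi>2 snd)"
    by (subst nn_integral_distr) auto
  also have "(\<integral>\<^sup>+ p. ennreal (dist (fst p) (snd p)) \<partial>distr J \<pi>1 fst) + (\<integral>\<^sup>+ p. ennreal (dist (fst p) (snd p)) \<partial>distr J \<pi>2 snd) + ennreal (e/3)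
     \<le> (wass \<mu> \<nu> + ennreal (e/3)) + (wass \<nu> \<rho> + ennreal (e/3)) + ennreal (e/3)"
    unfolding D using \<pi>1 \<pi>2 by (intro add_mono) auto
  also have "\<dots> = wass \<mu> \<nu> + wass \<nu> \<rho> + (ennreal (e/3) + ennreal (e/3) + ennreal (e/3))" by (simp add: ac_simps)
  also have "ennreal (e/3) + ennreal (e/3) + ennreal (e/3) = ennreal e" using e by (simp flip: ennreal_plus)
  finally show "wass \<mu> \<rho> \<le> wass \<mu> \<nu> + wass \<nu> \<rho> + ennreal e" .
qed

section \<open>Distance bounds from cell masses and tails\<close>

text \<open>A maximal coupling at the level of labels: the mass common to both label distributions
  stays within equal cells, and only the surplus is sent to different cells. The surplus is the sum
  of the positive parts of the differences of masses.\<close>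

lemma total_variation_coupling:
  fixes u :: "'a \<Rightarrow> nat" and v :: "'b \<Rightarrow> nat"
  assumes P: "prob_space P" and Q: "prob_space Q"
    and u[measurable]: "u \<in> measurable P (count_space UNIV)"
    and v[measurable]: "v \<in> measurable Q (count_space UNIV)"
    and uK: "\<And>x. u x \<le> K" and vK: "\<And>y. v y \<le> K"
  obtains J where "prob_space J" "sets J = sets (P \<Otimes>\<^sub>M Q)" "distr J P fst = P" "distr J Q snd = Q"
    "emeasure J {w \<in> space J. u (fst w) \<noteq> v (snd w)}
       \<le> ennreal (\<Sum>k\<le>K. \<bar>measure P (u -` {k} \<inter> space P) - measure Q (v -` {k} \<inter> space Q)\<bar>)"
proof -
  interpret P: prob_space P by fact
  interpret Q: prob_space Q by fact
  have [measurable]: "u -` {i} \<inter> space P \<in> sets P" "v -` {i} \<inter> space Q \<in> sets Q" for i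
    using measurable_sets[OF u, of "{i}"] measurable_sets[OF v, of "{i}"] by simp_all
  define a where "a k = measure P (u -` {k} \<inter> space P)" for k
  define b where "b k = measure Q (v -` {k} \<inter> space Q)" for k
  have a0: "a k \<ge> 0" and b0: "b k \<ge> 0" for k by (simp_all add: a_def b_def)
  \<comment> \<open>The surpluses of \<open>a\<close> over \<open>b\<close> and of \<open>b\<close>
    over \<open>a\<close>. Since both mass vectors sum to 1, the two surpluses have the same total
    \<open>t\<close>.\<close>
  define c where "c k = max 0 (a k - b k)" for k
  define d where "d k = max 0 (b k - a k)" for k
  have c0: "c k \<ge> 0" and d0: "d k \<ge> 0" for k by (simp_all add: c_def d_def)
  have intP: "(\<integral>\<^sup>+x. ennreal (F (u x)) \<partial>P) = ennreal (\<Sum>i\<le>K. F i * a i)" if "\<And>i. F i \<ge> 0" for F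
  proof -
    have "(\<integral>\<^sup>+x. ennreal (F (u x)) \<partial>P) = (\<Sum>i\<le>K. ennreal (F i) * emeasure P (u -` {i} \<inter> space P))"
      by (rule nn_integral_finite_range[OF u uK])
    also have "\<dots> = ennreal (\<Sum>i\<le>K. F i * a i)"
      using that by (subst sum_ennreal[symmetric]) (auto simp: a0 a_def ennreal_mult P.emeasure_eq_measure)
    finally show ?thesis .
  qed
  have intQ: "(\<integral>\<^sup>+x. ennreal (F (v x)) \<partial>Q) = ennreal (\<Sum>i\<le>K. F i * b i)" if "\<And>i. F i \<ge> 0" for F
  proof -
    have "(\<integral>\<^sup>+x. ennreal (F (v x)) \<partial>Q) = (\<Sum>i\<le>K. ennreal (F i) * emeasure Q (v -` {i} \<inter> space Q))"
      by (rule nn_integral_finite_range[OF v vK])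
    also have "\<dots> = ennreal (\<Sum>i\<le>K. F i * b i)"
      using that by (subst sum_ennreal[symmetric]) (auto simp: b0 b_def ennreal_mult Q.emeasure_eq_measure)
    finally show ?thesis .
  qed
  have suma: "(\<Sum>i\<le>K. a i) = 1"
    using intP[of "\<lambda>_. 1"] P.emeasure_space_1 by simp
  have sumb: "(\<Sum>i\<le>K. b i) = 1"
    using intQ[of "\<lambda>_. 1"] Q.emeasure_space_1 by simp
  have aK: "a i = 0" if "i > K" for i
  proof -
    have "u -` {i} \<inter> space P = {}" using uK that by (auto simp: leD)
    then show ?thesis by (simp add: a_def)
  qed
  have bK: "b i = 0" if "i > K" for i
  proof -
    have "v -` {i} \<inter> space Q = {}" using vK that by (auto simp: leD)
    then show ?thesis by (simp add: b_def)
  qed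
  define t where "t = (\<Sum>k\<le>K. c k)"
  have t0: "t \<ge> 0" by (simp add: t_def sum_nonneg c0)
  have td: "(\<Sum>k\<le>K. d k) = t"
  proof -
    have "(\<Sum>k\<le>K. c k) - (\<Sum>k\<le>K. d k) = (\<Sum>k\<le>K. a k) - (\<Sum>k\<le>K. b k)"
      unfolding sum_subtractf[symmetric] by (intro sum.cong) (auto simp: c_def d_def)
    then show ?thesis by (simp add: suma sumb t_def)
  qed
  have t_zero: "c i = 0" "d i = 0" if "t = 0" for i
  proof -
    have "c i = 0" if "i \<le> K" using \<open>t = 0\<close> that sum_nonneg_eq_0_iff[of "{..K}" c] by (simp add: t_def c0)
    moreover have "d i = 0" if "i \<le> K" using \<open>t = 0\<close> that sum_nonneg_eq_0_iff[of "{..K}" d] td by (simp add: d0)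
    moreover have "c i = 0 \<and> d i = 0" if "i > K" using aK bK that by (simp add: c_def d_def)
    ultimately show "c i = 0" "d i = 0" by (meson not_le)+
  qed
  \<comment> \<open>The first summand spreads the common mass \<open>min (a i) (b i)\<close> over
    the product of the two cells labelled \<open>i\<close>; the second is a product coupling of the
    surpluses, of total mass \<open>t\<close>. The convention \<open>x / 0 = 0\<close> lets one
    formula cover null cells and \<open>t = 0\<close>.\<close>
  define h where "h i j = (if i = j then min (a i) (b i) / (a i * b i) else 0) + c i * d j / (t * a i * b j)" for i j
  have h0: "h i j \<ge> 0" for i j using a0 b0 c0 d0 t0 by (simp add: h_def)
  \<comment> \<open>This holds even at cells of mass 0: a surplus never exceeds the mass it is part
    of.\<close>
  have db: "d j / b j * b j = d j" and ca: "c j / a j * a j = c j" for j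
    using a0[of j] b0[of j] by (auto simp: c_def d_def)
  have h1: "(\<integral>\<^sup>+y. ennreal (h i (v y)) \<partial>Q) = 1" if "emeasure P (u -` {i} \<inter> space P) \<noteq> 0" for i
  proof -
    have ai: "a i > 0" using that a0[of i] by (simp add: a_def P.emeasure_eq_measure less_le)
    then have iK: "i \<le> K" using aK[of i] by (cases "i \<le> K") auto
    have "(\<Sum>j\<le>K. h i j * b j) = (\<Sum>j\<le>K. (if i = j then min (a i) (b i) / (a i * b i) * b i else 0)) + (\<Sum>j\<le>K. c i / (t * a i) * d j)"
      unfolding sum.distrib[symmetric] 
    proof (intro sum.cong refl)
      fix j
      have "c i * d j / (t * a i * b j) * b j = c i / (t * a i) * (d j / b j * b j)" by simp
      then have "c i * d j / (t * a i * b j) * b j = c i / (t * a i) * d j" by (simp only: db)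
      then show "h i j * b j = (if i = j then min (a i) (b i) / (a i * b i) * b i else 0) + c i / (t * a i) * d j"
        by (simp add: h_def distrib_right)
    qed
    also have "\<dots> = min (a i) (b i) / (a i * b i) * b i + c i / (t * a i) * t"
      using iK unfolding sum_distrib_left[symmetric] td by simp
    also have "min (a i) (b i) / (a i * b i) * b i = min (a i) (b i) / a i"
      using ai b0[of i] by auto
    also have "c i / (t * a i) * t = c i / a i" using t_zero[of i] by auto
    also have "min (a i) (b i) / a i + c i / a i = 1"
      using ai by (auto simp: c_def min_def max_def field_simps)
    finally show ?thesis using intQ[of "h i"] h0 by simp
  qed
  have h2: "(\<integral>\<^sup>+x. ennreal (h (u x) i) \<partial>P) = 1" if "emeasure Q (v -` {i} \<inter> space Q) \<noteq> 0" for i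
  proof -
    have bi: "b i > 0" using that b0[of i] by (simp add: b_def Q.emeasure_eq_measure less_le)
    then have iK: "i \<le> K" using bK[of i] by (cases "i \<le> K") auto
    have "(\<Sum>j\<le>K. h j i * a j) = (\<Sum>j\<le>K. (if i = j then min (a i) (b i) / (a i * b i) * a i else 0)) + (\<Sum>j\<le>K. d i / (t * b i) * c j)"
      unfolding sum.distrib[symmetric] 
    proof (intro sum.cong refl)
      fix j
      have "c j * d i / (t * a j * b i) * a j = d i / (t * b i) * (c j / a j * a j)" by simp
      then have "c j * d i / (t * a j * b i) * a j = d i / (t * b i) * c j" by (simp only: ca)
      then show "h j i * a j = (if i = j then min (a i) (b i) / (a i * b i) * a i else 0) + d i / (t * b i) * c j"
        by (simp add: h_def distrib_right)
    qed
    also have "\<dots> = min (a i) (b i) / (a i * b i) * a i + d i / (t * b i) * t"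
      using iK unfolding sum_distrib_left[symmetric] t_def[symmetric] by simp
    also have "min (a i) (b i) / (a i * b i) * a i = min (a i) (b i) / b i"
      using bi a0[of i] by auto
    also have "d i / (t * b i) * t = d i / b i" using t_zero[of i] by auto
    also have "min (a i) (b i) / b i + d i / b i = 1"
      using bi by (auto simp: d_def min_def max_def field_simps)
    finally show ?thesis using intP[of "\<lambda>j. h j i"] h0 by simp
  qed
  define J where "J = density (P \<Otimes>\<^sub>M Q) (\<lambda>w. ennreal (h (u (fst w)) (v (snd w))))"
  note cpl = fibre_density_coupling[where H = "\<lambda>i j. ennreal (h i j)", OF P Q u v h1 h2, folded J_def]
  have m: "(\<lambda>w. ennreal (h (u (fst w)) (v (snd w)))) \<in> borel_measurable (P \<Otimes>\<^sub>M Q)"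
    by (rule measurable_fibre_kernel[OF u v, of "\<lambda>i j. ennreal (h i j)"])
  have "emeasure J {w \<in> space J. u (fst w) \<noteq> v (snd w)}
     = (\<integral>\<^sup>+w. ennreal (h (u (fst w)) (v (snd w))) * indicator {w \<in> space J. u (fst w) \<noteq> v (snd w)} w \<partial>(P \<Otimes>\<^sub>M Q))"
  proof -
    have "space J = space (P \<Otimes>\<^sub>M Q)" by (simp add: J_def)
    then have "{w \<in> space J. u (fst w) \<noteq> v (snd w)} \<in> sets (P \<Otimes>\<^sub>M Q)"
      using sets_fibre_neq[OF u v] by simp
    then show ?thesis using m unfolding J_def by (subst emeasure_density) auto
  qed
  \<comment> \<open>Off the diagonal only the surplus part of \<open>h\<close> is left, and it
    factorises; the indicator is then dropped to obtain a product of two integrals.\<close>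
  also have "\<dots> \<le> (\<integral>\<^sup>+w. ennreal (c (u (fst w)) / a (u (fst w))) * ennreal (d (v (snd w)) / b (v (snd w)) / t) \<partial>(P \<Otimes>\<^sub>M Q))"
  proof (intro nn_integral_mono)
    fix w
    have "h i j = c i / a i * (d j / b j / t)" if "i \<noteq> j" for i j using that by (simp add: h_def mult_ac)
    moreover have "ennreal (c i / a i * (d j / b j / t)) = ennreal (c i / a i) * ennreal (d j / b j / t)" for i j
      using a0[of i] b0[of j] c0[of i] d0[of j] t0 by (intro ennreal_mult) simp_all
    ultimately show "ennreal (h (u (fst w)) (v (snd w))) * indicator {w \<in> space J. u (fst w) \<noteq> v (snd w)} w
      \<le> ennreal (c (u (fst w)) / a (u (fst w))) * ennreal (d (v (snd w)) / b (v (snd w)) / t)"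
      by (cases "u (fst w) = v (snd w)") (simp_all add: indicator_def)
  qed
  also have "\<dots> = (\<integral>\<^sup>+x. \<integral>\<^sup>+y. ennreal (c (u x) / a (u x)) * ennreal (d (v y) / b (v y) / t) \<partial>Q \<partial>P)"
    by (subst Q.nn_integral_fst[symmetric]) simp_all
  also have "\<dots> = (\<integral>\<^sup>+x. ennreal (c (u x) / a (u x)) \<partial>P) * (\<integral>\<^sup>+y. ennreal (d (v y) / b (v y) / t) \<partial>Q)"
    by (simp add: nn_integral_cmult nn_integral_multc)
  also have "(\<integral>\<^sup>+x. ennreal (c (u x) / a (u x)) \<partial>P) = ennreal t"
    using intP[of "\<lambda>i. c i / a i"] a0 c0 unfolding t_def by (simp only: ca divide_nonneg_nonneg)
  also have "(\<integral>\<^sup>+y. ennreal (d (v y) / b (v y) / t) \<partial>Q) = ennreal (t / t)"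
  proof -
    have "(\<Sum>i\<le>K. d i / b i / t * b i) = (\<Sum>i\<le>K. d i / b i * b i) / t"
      unfolding sum_divide_distrib by (intro sum.cong refl) simp
    also have "\<dots> = t / t" by (simp only: db td)
    finally show ?thesis using intQ[of "\<lambda>i. d i / b i / t"] b0 d0 t0 by simp
  qed
  \<comment> \<open>For \<open>t = 0\<close> the quotient is 0 instead of 1, but the product is
    \<open>t\<close> in both cases.\<close>
  also have "ennreal t * ennreal (t / t) = ennreal t"
    using t0 by (cases "t = 0") simp_all
  also have "\<dots> \<le> ennreal (\<Sum>k\<le>K. \<bar>a k - b k\<bar>)"
    unfolding t_def by (intro ennreal_leI sum_mono) (auto simp: c_def)
  finally have "emeasure J {w \<in> space J. u (fst w) \<noteq> v (snd w)} \<le> ennreal (\<Sum>k\<le>K. \<bar>a k - b k\<bar>)" .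
  then show ?thesis
    using cpl by (intro that[of J]) (auto simp: J_def a_def b_def)
qed

definition tail :: "real \<Rightarrow> 'a::euclidean_space \<Rightarrow> real" where
  "tail R x = (if R < norm x then norm x else 0)"

lemma tail_nonneg [simp]: "0 \<le> tail R x"
  by (simp add: tail_def)

lemma measurable_tail [measurable]: "tail R \<in> borel_measurable borel"
  unfolding tail_def by measurable

lemma finite_fine_partition:
  fixes \<eta> R :: real
  assumes "\<eta> > 0"
  obtains q :: "'a::euclidean_space \<Rightarrow> nat" and K where "q \<in> measurable borel (count_space UNIV)"
    "\<And>x. q x \<le> K" "\<And>x y. q x = q y \<Longrightarrow> norm x \<le> R \<Longrightarrow> norm y \<le> R \<Longrightarrow> dist x y \<le> \<eta>"
proof -
  have "compact (cball (0::'a) R)" by simp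
  then obtain T where T: "finite T" "cball (0::'a) R \<subseteq> (\<Union>x\<in>T. ball x (\<eta>/2))"
    using assms unfolding compact_eq_totally_bounded by (meson half_gt_zero)
  \<comment> \<open>The index \<open>card T\<close> is a catch-all accepting every point, so the
    least index always exists. Points of the ball are already within \<open>\<eta>/2\<close> of a
    point of \<open>T\<close> and get a smaller index.\<close>
  define P where "P k x \<longleftrightarrow> k = card T \<or> dist x (from_nat_into T k) < \<eta>/2" for k x
  define q where "q x = (LEAST k. P k x)" for x
  have c: "P (card T) x" for x by (simp add: P_def)
  have l: "P (q x) x" for x unfolding q_def by (rule LeastI[of "\<lambda>k. P k x", OF c])
  have le: "q x \<le> k" if "P k x" for x k unfolding q_def by (rule Least_le[of "\<lambda>k. P k x", OF that])
  have lt: "q x < card T" if "norm x \<le> R" for x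
  proof -
    have "x \<in> (\<Union>x\<in>T. ball x (\<eta>/2))" using T(2) that by (auto simp: subset_iff)
    then obtain d where d: "d \<in> T" "dist x d < \<eta>/2" by (auto simp: dist_commute)
    obtain k where "k < card T" "from_nat_into T k = d"
      using bij_betw_imp_surj_on[OF bij_betw_from_nat_into_finite[OF T(1)]] d(1) by (metis imageE lessThan_iff)
    with d le[of k x] show ?thesis by (simp add: P_def)
  qed
  show ?thesis
  proof (rule that[of q "card T"])
    show "q \<in> measurable borel (count_space UNIV)"
      unfolding q_def P_def by measurable
    show "q x \<le> card T" for x using le[OF c] .
    fix x y :: 'a assume eq: "q x = q y" and n: "norm x \<le> R" "norm y \<le> R"
    have "dist x (from_nat_into T (q y)) < \<eta>/2" "dist y (from_nat_into T (q y)) < \<eta>/2"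
      using l[of x] l[of y] lt[OF n(1)] lt[OF n(2)] unfolding P_def eq by auto
    then show "dist x y \<le> \<eta>"
      using dist_triangle2[of x y "from_nat_into T (q y)"] by simp
  qed
qed

text \<open>Under the maximal coupling of labels, two points in the ball of radius \<open>R\<close>
  are \<open>\<eta>\<close>-close in a common cell and at most \<open>2 * R\<close> apart otherwise.
  If one of them leaves the ball, its norm exceeds that of a partner inside, so twice the tails
  bound the sum of the norms.\<close>

lemma wass_le_partition:
  fixes \<mu> \<nu> :: "('a::euclidean_space) measure" and q :: "'a \<Rightarrow> nat"
  assumes \<mu>: "prob_space \<mu>" "sets \<mu> = sets borel" and \<nu>: "prob_space \<nu>" "sets \<nu> = sets borel"
    and q[measurable]: "q \<in> measurable borel (count_space UNIV)" and qK: "\<And>x. q x \<le> K"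
    and qd: "\<And>x y. q x = q y \<Longrightarrow> norm x \<le> R \<Longrightarrow> norm y \<le> R \<Longrightarrow> dist x y \<le> \<eta>"
    and \<eta>: "0 \<le> \<eta>" and R: "0 \<le> R"
  shows "wass \<mu> \<nu> \<le> ennreal \<eta> + (2 * (\<integral>\<^sup>+x. ennreal (tail R x) \<partial>\<mu>) + 2 * (\<integral>\<^sup>+x. ennreal (tail R x) \<partial>\<nu>))
     + ennreal (2 * R) * ennreal (\<Sum>k\<le>K. \<bar>measure \<mu> (q -` {k}) - measure \<nu> (q -` {k})\<bar>)"
proof -
  have sp: "space \<mu> = UNIV" "space \<nu> = UNIV" using \<mu>(2) \<nu>(2) by (simp_all add: sets_eq_imp_space_eq)
  note [measurable_cong] = \<mu>(2) \<nu>(2)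
  obtain J where J: "prob_space J" and sJ[measurable_cong]: "sets J = sets (\<mu> \<Otimes>\<^sub>M \<nu>)"
    and d: "distr J \<mu> fst = \<mu>" "distr J \<nu> snd = \<nu>"
    and tv: "emeasure J {w \<in> space J. q (fst w) \<noteq> q (snd w)}
       \<le> ennreal (\<Sum>k\<le>K. \<bar>measure \<mu> (q -` {k}) - measure \<nu> (q -` {k})\<bar>)"
  proof -
    have "q \<in> measurable \<mu> (count_space UNIV)" "q \<in> measurable \<nu> (count_space UNIV)" by measurable
    from total_variation_coupling[OF \<mu>(1) \<nu>(1) this, of K] that qK show ?thesis unfolding sp Int_UNIV_right by blast
  qed
  have "sets J = sets (borel \<Otimes>\<^sub>M borel)" unfolding sJ by (intro sets_pair_measure_cong \<mu> \<nu>)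
  moreover have "distr J borel fst = distr J \<mu> fst" "distr J borel snd = distr J \<nu> snd"
    by (intro distr_cong; simp add: \<mu> \<nu>)+
  ultimately have "J \<in> couplings \<mu> \<nu>" using J d by (simp add: couplings_def)
  have [measurable]: "{w \<in> space J. q (fst w) \<noteq> q (snd w)} \<in> sets J"
    using sets_fibre_neq[of q \<mu> q \<nu>] sets_eq_imp_space_eq[OF sJ] sJ by simp
  have "wass \<mu> \<nu> \<le> (\<integral>\<^sup>+ p. ennreal (dist (fst p) (snd p)) \<partial>J)"
    using \<open>J \<in> couplings \<mu> \<nu>\<close> by (rule wass_le)
  also have "\<dots> \<le> (\<integral>\<^sup>+ p. (ennreal \<eta> + (2 * ennreal (tail R (fst p)) + 2 * ennreal (tail R (snd p)))) 
       + ennreal (2 * R) * indicator {w \<in> space J. q (fst w) \<noteq> q (snd w)} p \<partial>J)"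
  proof (intro nn_integral_mono)
    fix p assume p: "p \<in> space J"
    have n: "dist (fst p) (snd p) \<le> norm (fst p) + norm (snd p)" by (simp add: dist_norm norm_triangle_ineq4)
    have "dist (fst p) (snd p) \<le> \<eta> + (2 * tail R (fst p) + 2 * tail R (snd p)) + 2 * R * indicator {w \<in> space J. q (fst w) \<noteq> q (snd w)} p"
    proof (cases "norm (fst p) \<le> R \<and> norm (snd p) \<le> R")
      case True
      then show ?thesis using n p qd[of "fst p" "snd p"] \<eta> R
        by (cases "q (fst p) = q (snd p)") (auto simp: tail_def)
    next
      case False
      then have "norm (fst p) + norm (snd p) \<le> 2 * tail R (fst p) + 2 * tail R (snd p)"
        using R by (auto simp: tail_def)
      moreover have "0 \<le> 2 * R * indicator {w \<in> space J. q (fst w) \<noteq> q (snd w)} p" using R by simp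
      ultimately show ?thesis using n \<eta> by linarith
    qed
    then have "ennreal (dist (fst p) (snd p)) \<le> ennreal (\<eta> + (2 * tail R (fst p) + 2 * tail R (snd p)) + 2 * R * indicator {w \<in> space J. q (fst w) \<noteq> q (snd w)} p)"
      by (rule ennreal_leI)
    also have "\<dots> = (ennreal \<eta> + (2 * ennreal (tail R (fst p)) + 2 * ennreal (tail R (snd p)))) + ennreal (2 * R) * indicator {w \<in> space J. q (fst w) \<noteq> q (snd w)} p"
      using \<eta> R by (simp add: ennreal_plus ennreal_mult ennreal_indicator[symmetric] del: ennreal_indicator)
    finally show "ennreal (dist (fst p) (snd p)) \<le> \<dots>" .
  qed
  also have "\<dots> = ennreal \<eta> + (2 * (\<integral>\<^sup>+p. ennreal (tail R (fst p)) \<partial>J) + 2 * (\<integral>\<^sup>+p. ennreal (tail R (snd p)) \<partial>J))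
      + ennreal (2 * R) * emeasure J {w \<in> space J. q (fst w) \<noteq> q (snd w)}"
    using prob_space.emeasure_space_1[OF J]
    by (simp add: nn_integral_add nn_integral_cmult)
  also have "(\<integral>\<^sup>+p. ennreal (tail R (fst p)) \<partial>J) = (\<integral>\<^sup>+x. ennreal (tail R x) \<partial>distr J \<mu> fst)"
    by (subst nn_integral_distr) simp_all
  also have "(\<integral>\<^sup>+p. ennreal (tail R (snd p)) \<partial>J) = (\<integral>\<^sup>+x. ennreal (tail R x) \<partial>distr J \<nu> snd)"
    by (subst nn_integral_distr) simp_all
  finally show ?thesis unfolding d by (rule order_trans) (intro add_mono mult_left_mono tv order_refl zero_le)
qed

section \<open>Finiteness and definiteness of the distance on \<open>P1\<close>\<close>

lemma P1_iff: "\<mu> \<in> P1 \<longleftrightarrow> prob_space \<mu> \<and> sets \<mu> = sets borel \<and> (\<integral>\<^sup>+ x. ennreal (norm x) \<partial>\<mu>) < \<infinity>"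
  by (simp add: P1_def)

lemma couplings_prod:
  fixes \<mu> \<nu> :: "('a::euclidean_space) measure"
  assumes "prob_space \<mu>" "sets \<mu> = sets borel" "prob_space \<nu>" "sets \<nu> = sets borel"
  shows "\<mu> \<Otimes>\<^sub>M \<nu> \<in> couplings \<mu> \<nu>"
proof -
  interpret M: prob_space \<mu> by fact
  interpret N: prob_space \<nu> by fact
  interpret MN: pair_prob_space \<mu> \<nu> ..
  note [measurable_cong] = assms(2,4)
  have sp: "space \<mu> = UNIV" "space \<nu> = UNIV" using assms by (simp_all add: sets_eq_imp_space_eq)
  have "distr (\<mu> \<Otimes>\<^sub>M \<nu>) borel fst = \<mu>"
  proof (rule measure_eqI)
    fix A assume A: "A \<in> sets (distr (\<mu> \<Otimes>\<^sub>M \<nu>) borel fst)"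
    have "fst -` A \<inter> space (\<mu> \<Otimes>\<^sub>M \<nu>) = A \<times> space \<nu>" by (auto simp: space_pair_measure sp)
    then show "emeasure (distr (\<mu> \<Otimes>\<^sub>M \<nu>) borel fst) A = emeasure \<mu> A"
      using A assms N.emeasure_space_1 by (subst emeasure_distr) (auto simp: N.emeasure_pair_measure_Times)
  qed (simp add: assms)
  moreover have "distr (\<mu> \<Otimes>\<^sub>M \<nu>) borel snd = \<nu>"
  proof (rule measure_eqI)
    fix A assume A: "A \<in> sets (distr (\<mu> \<Otimes>\<^sub>M \<nu>) borel snd)"
    have "snd -` A \<inter> space (\<mu> \<Otimes>\<^sub>M \<nu>) = space \<mu> \<times> A" by (auto simp: space_pair_measure sp)
    then show "emeasure (distr (\<mu> \<Otimes>\<^sub>M \<nu>) borel snd) A = emeasure \<nu> A"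
      using A assms M.emeasure_space_1 by (subst emeasure_distr) (auto simp: N.emeasure_pair_measure_Times)
  qed (simp add: assms)
  moreover have "sets (\<mu> \<Otimes>\<^sub>M \<nu>) = sets (borel \<Otimes>\<^sub>M borel)" by (intro sets_pair_measure_cong assms)
  ultimately show ?thesis using MN.prob_space_axioms by (simp add: couplings_def)
qed

text \<open>The independent coupling is enough. This makes the distance finite on \<open>P1\<close>,
  so that \<open>W1\<close> and \<open>wass\<close> agree there, and later bounds the initial
  distance by moments.\<close>

lemma wass_le_moments:
  fixes \<mu> \<nu> :: "('a::euclidean_space) measure"
  assumes \<mu>: "prob_space \<mu>" "sets \<mu> = sets borel" and \<nu>: "prob_space \<nu>" "sets \<nu> = sets borel"
  shows "wass \<mu> \<nu> \<le> (\<integral>\<^sup>+ x. ennreal (norm x) \<partial>\<mu>) + (\<integral>\<^sup>+ x. ennreal (norm x) \<partial>\<nu>)"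
proof -
  interpret M: prob_space \<mu> by fact
  interpret N: prob_space \<nu> by fact
  note [measurable_cong] = assms(2,4)
  have "wass \<mu> \<nu> \<le> (\<integral>\<^sup>+ p. ennreal (dist (fst p) (snd p)) \<partial>(\<mu> \<Otimes>\<^sub>M \<nu>))"
    by (intro wass_le couplings_prod assms)
  also have "\<dots> \<le> (\<integral>\<^sup>+ p. ennreal (norm (fst p)) + ennreal (norm (snd p)) \<partial>(\<mu> \<Otimes>\<^sub>M \<nu>))"
    by (intro nn_integral_mono) (simp add: dist_norm norm_triangle_ineq4 flip: ennreal_plus)
  also have "\<dots> = (\<integral>\<^sup>+ x. \<integral>\<^sup>+ y. ennreal (norm x) + ennreal (norm y) \<partial>\<nu> \<partial>\<mu>)"
    by (subst N.nn_integral_fst[symmetric]) simp_all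
  also have "\<dots> = (\<integral>\<^sup>+ x. ennreal (norm x) \<partial>\<mu>) + (\<integral>\<^sup>+ x. ennreal (norm x) \<partial>\<nu>)"
    using M.emeasure_space_1 N.emeasure_space_1 by (simp add: nn_integral_add)
  finally show ?thesis .
qed

lemma ennreal_W1:
  assumes "\<mu> \<in> P1" "\<nu> \<in> P1"
  shows "ennreal (W1 \<mu> \<nu>) = wass \<mu> \<nu>"
proof -
  have "wass \<mu> \<nu> < \<top>"
    using wass_le_moments[of \<mu> \<nu>] assms by (auto simp: P1_iff intro: le_less_trans)
  then show ?thesis by (simp add: W1_eq_wass)
qed

lemma W1_nonneg [simp]: "0 \<le> W1 \<mu> \<nu>"
  by (simp add: W1_def)

lemma return_in_P1: "return borel x \<in> P1"
  by (auto simp: P1_iff nn_integral_return intro!: prob_space_return)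

text \<open>If a coupled pair starts in \<open>F\<close> and ends outside the closed neighbourhood
  \<open>G n\<close>, it moves by at least the radius. By Markov's inequality this has arbitrarily
  small mass, and the neighbourhoods then shrink to the closed set \<open>F\<close>.\<close>

lemma emeasure_le_of_wass_zero:
  fixes \<mu> \<nu> :: "('a::euclidean_space) measure"
  assumes \<mu>: "\<mu> \<in> P1" and \<nu>: "\<nu> \<in> P1" and 0: "wass \<mu> \<nu> = 0" and F: "closed F" "F \<noteq> {}"
  shows "emeasure \<mu> F \<le> emeasure \<nu> F"
proof -
  interpret N: prob_space \<nu> using \<nu> by (simp add: P1_iff)
  note [measurable_cong] = \<mu>[unfolded P1_iff, THEN conjunct2, THEN conjunct1] \<nu>[unfolded P1_iff, THEN conjunct2, THEN conjunct1]
  have s\<nu>: "sets \<nu> = sets borel" using \<nu> by (simp add: P1_iff)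
  define G where "G n = {x. infdist x F \<le> inverse (real (Suc n))}" for n
  have clG: "closed (G n)" for n 
    unfolding G_def by (intro closed_Collect_le continuous_intros)
  have [measurable]: "F \<in> sets borel" "G n \<in> sets borel" for n using F clG by (simp_all add: borel_closed)
  have step: "emeasure \<mu> F \<le> emeasure \<nu> (G n) + e" if epos: "e > 0" for n and e :: ennreal
  proof (cases "e = \<top>")
    case False
    define r where "r = inverse (real (Suc n))"
    have r: "r > 0" by (simp add: r_def)
    obtain e' where e': "e = ennreal e'" "e' > 0" using False epos by (cases e) auto
    \<comment> \<open>A cost below \<open>r * e'\<close> makes the Markov bound at distance
      \<open>r\<close> equal to \<open>e\<close>.\<close>
    have "wass \<mu> \<nu> < ennreal (r * e')" using 0 r e' by simp
    then obtain \<pi> where \<pi>: "\<pi> \<in> couplings \<mu> \<nu>" "(\<integral>\<^sup>+ p. ennreal (dist (fst p) (snd p)) \<partial>\<pi>) < ennreal (r * e')"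
      by (rule wass_less)
    have s\<pi>[measurable_cong]: "sets \<pi> = sets (borel \<Otimes>\<^sub>M borel)" and d: "distr \<pi> borel fst = \<mu>" "distr \<pi> borel snd = \<nu>"
      using \<pi>(1) by (auto simp: couplings_def)
    have sp: "space \<pi> = UNIV" using sets_eq_imp_space_eq[OF s\<pi>] by (simp add: space_pair_measure)
    have "emeasure \<mu> F = emeasure \<pi> {w \<in> space \<pi>. fst w \<in> F}"
      unfolding d(1)[symmetric] by (subst emeasure_distr) (auto intro!: arg_cong2[where f=emeasure])
    also have "\<dots> \<le> emeasure \<pi> ({w \<in> space \<pi>. snd w \<in> G n} \<union> {w \<in> space \<pi>. 1 \<le> ennreal (inverse r) * ennreal (dist (fst w) (snd w))})"
    proof (rule emeasure_mono)
      show "{w \<in> space \<pi>. fst w \<in> F} \<subseteq> {w \<in> space \<pi>. snd w \<in> G n} \<union> {w \<in> space \<pi>. 1 \<le> ennreal (inverse r) * ennreal (dist (fst w) (snd w))}"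
      proof
        fix w assume w: "w \<in> {w \<in> space \<pi>. fst w \<in> F}"
        show "w \<in> {w \<in> space \<pi>. snd w \<in> G n} \<union> {w \<in> space \<pi>. 1 \<le> ennreal (inverse r) * ennreal (dist (fst w) (snd w))}"
        proof (cases "snd w \<in> G n")
          case False
          then have "r < infdist (snd w) F" by (simp add: G_def r_def)
          also have "\<dots> \<le> dist (snd w) (fst w)" using w by (intro infdist_le) auto
          finally have "1 \<le> inverse r * dist (fst w) (snd w)" using r by (simp add: field_simps dist_commute)
          then show ?thesis using w r by (auto simp: ennreal_mult[symmetric])
        qed (use w in simp)
      qed
    qed measurable
    also have "\<dots> \<le> emeasure \<pi> {w \<in> space \<pi>. snd w \<in> G n} + emeasure \<pi> {w \<in> space \<pi>. 1 \<le> ennreal (inverse r) * ennreal (dist (fst w) (snd w))}"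
      by (intro emeasure_subadditive) measurable
    also have "emeasure \<pi> {w \<in> space \<pi>. 1 \<le> ennreal (inverse r) * ennreal (dist (fst w) (snd w))}
         \<le> ennreal (inverse r) * (\<integral>\<^sup>+ p. ennreal (dist (fst p) (snd p)) * indicator (space \<pi>) p \<partial>\<pi>)"
      using nn_integral_Markov_inequality[where u = "\<lambda>w. ennreal (dist (fst w) (snd w))" and M = \<pi> and A = "space \<pi>" and c = "ennreal (inverse r)"]
      by simp
    also have "\<dots> \<le> ennreal (inverse r) * ennreal (r * e')"
      using \<pi>(2) by (intro mult_left_mono) (simp_all add: sp)
    also have "\<dots> = e" using r e' by (simp add: ennreal_mult[symmetric] field_simps)
    also have "emeasure \<pi> {w \<in> space \<pi>. snd w \<in> G n} = emeasure \<nu> (G n)"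
      unfolding d(2)[symmetric] by (subst emeasure_distr) (auto intro!: arg_cong2[where f=emeasure])
    finally show ?thesis by (simp add: add_left_mono)
  qed simp
  have le: "emeasure \<mu> F \<le> emeasure \<nu> (G n)" for n
    by (rule ennreal_le_epsilon) (simp add: step)
  have "(\<lambda>n. emeasure \<nu> (G n)) \<longlonglongrightarrow> emeasure \<nu> (\<Inter>n. G n)"
  proof (rule Lim_emeasure_decseq)
    show "range G \<subseteq> sets \<nu>" unfolding s\<nu> using borel_closed[OF clG] by blast
    show "decseq G" unfolding decseq_def
    proof (intro allI impI subsetI)
      fix m n x assume "m \<le> n" and x: "x \<in> G n"
      then have "inverse (real (Suc n)) \<le> inverse (real (Suc m))" by (intro le_imp_inverse_le) simp_all
      with x show "x \<in> G m" unfolding G_def mem_Collect_eq by linarith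
    qed
  qed simp
  moreover have "(\<Inter>n. G n) = F"
  proof
    show "(\<Inter>n. G n) \<subseteq> F"
    proof
      fix x assume x: "x \<in> (\<Inter>n. G n)"
      have "infdist x F \<le> 0"
      proof (rule ccontr)
        assume "\<not> infdist x F \<le> 0"
        then obtain n where "inverse (real (Suc n)) < infdist x F"
          using reals_Archimedean[of "infdist x F"] by (meson not_le)
        moreover have "infdist x F \<le> inverse (real (Suc n))" using x unfolding G_def by blast
        ultimately show False by simp
      qed
      then show "x \<in> F" using in_closed_iff_infdist_zero[OF F, of x] infdist_nonneg[of x F] by linarith
    qed
    show "F \<subseteq> (\<Inter>n. G n)" by (auto simp: G_def)
  qed
  ultimately show ?thesis using le by (auto intro: LIMSEQ_le_const)
qed

lemma wass_commute: "wass \<mu> \<nu> = wass \<nu> \<mu>"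
proof -
  have le: "wass \<nu> \<mu> \<le> wass \<mu> \<nu>" for \<mu> \<nu> :: "'a measure"
    unfolding wass_def[of \<mu>]
  proof (rule INF_greatest)
    fix \<pi> assume \<pi>: "\<pi> \<in> couplings \<mu> \<nu>"
    then have [measurable_cong]: "sets \<pi> = sets (borel \<Otimes>\<^sub>M borel)" and p: "prob_space \<pi>"
      and d: "distr \<pi> borel fst = \<mu>" "distr \<pi> borel snd = \<nu>" by (auto simp: couplings_def)
    define \<rho> where "\<rho> = distr \<pi> (borel \<Otimes>\<^sub>M borel) (\<lambda>w. (snd w, fst w))"
    have "distr \<rho> borel fst = \<nu>" "distr \<rho> borel snd = \<mu>"
      unfolding \<rho>_def d[symmetric] by (subst distr_distr; simp add: comp_def)+
    moreover have "prob_space \<rho>" unfolding \<rho>_def by (intro prob_space.prob_space_distr p) measurable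
    ultimately have "\<rho> \<in> couplings \<nu> \<mu>" by (simp add: couplings_def \<rho>_def)
    then have "wass \<nu> \<mu> \<le> (\<integral>\<^sup>+ p. ennreal (dist (fst p) (snd p)) \<partial>\<rho>)" by (rule wass_le)
    also have "\<dots> = (\<integral>\<^sup>+ p. ennreal (dist (fst p) (snd p)) \<partial>\<pi>)"
      unfolding \<rho>_def by (subst nn_integral_distr) (simp_all add: dist_commute)
    finally show "wass \<nu> \<mu> \<le> \<dots>" .
  qed
  show ?thesis by (intro antisym le)
qed

text \<open>Closed sets are an intersection-stable generator of the Borel sets. Definiteness matters
  for \<open>Dconst\<close>: its quotient evaluates to 0 when the denominator vanishes, so distinct
  measures at distance 0 would leave the increment of \<open>f\<close> uncontrolled.\<close>

lemma wass_zero_imp_eq: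
  fixes \<mu> \<nu> :: "('a::euclidean_space) measure"
  assumes \<mu>: "\<mu> \<in> P1" and \<nu>: "\<nu> \<in> P1" and 0: "wass \<mu> \<nu> = 0"
  shows "\<mu> = \<nu>"
proof (rule measure_eqI_generator_eq[where E = "Collect closed" and A = "\<lambda>_. UNIV" and \<Omega> = UNIV])
  show "emeasure \<mu> X = emeasure \<nu> X" if "X \<in> Collect closed" for X
    using emeasure_le_of_wass_zero[OF \<mu> \<nu> 0, of X] emeasure_le_of_wass_zero[OF \<nu> \<mu>, of X] 0 that
    by (cases "X = {}") (auto simp: wass_commute intro: antisym)
  show "sets \<mu> = sigma_sets UNIV (Collect closed)" "sets \<nu> = sigma_sets UNIV (Collect closed)"
    using \<mu> \<nu> by (simp_all add: P1_iff borel_eq_closed)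
  show "emeasure \<mu> UNIV \<noteq> \<infinity>" for i :: nat
  proof -
    interpret prob_space \<mu> using \<mu> by (simp add: P1_iff)
    show ?thesis by simp
  qed
qed (auto simp: Int_stable_def)

section \<open>Lipschitz drift and moments\<close>

text \<open>Jensen's inequality for weights that need not sum to 1. Young's inequality is applied to
  each \<open>y i\<close> against the power \<open>p - 1\<close> of the weighted mean
  \<open>m\<close>; after summation the terms in \<open>m\<close> on both sides combine to
  \<open>W * m powr p\<close>.\<close>

lemma powr_weighted_sum_le:
  fixes w y :: "'i \<Rightarrow> real"
  assumes I: "finite I" and w: "\<And>i. i \<in> I \<Longrightarrow> 0 \<le> w i" and y: "\<And>i. i \<in> I \<Longrightarrow> 0 \<le> y i" and p: "1 < p"
  shows "(\<Sum>i\<in>I. w i * y i) powr p \<le> (\<Sum>i\<in>I. w i) powr (p - 1) * (\<Sum>i\<in>I. w i * y i powr p)"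
proof (cases "(\<Sum>i\<in>I. w i) = 0")
  case True
  then have "\<And>i. i \<in> I \<Longrightarrow> w i = 0" using I w by (simp add: sum_nonneg_eq_0_iff)
  then show ?thesis by simp
next
  case False
  define W where "W = (\<Sum>i\<in>I. w i)"
  define S where "S = (\<Sum>i\<in>I. w i * y i)"
  define m where "m = S / W"
  have W: "W > 0" using False w by (simp add: W_def sum_nonneg less_le)
  have S: "S \<ge> 0" using w y by (simp add: S_def sum_nonneg)
  have m: "m \<ge> 0" using W S by (simp add: m_def)
  define q where "q = p / (p - 1)"
  have q: "q > 1" "1 / p + 1 / q = 1" "(p - 1) * q = p" using p by (auto simp: q_def field_simps)
  have mm: "m * m powr (p - 1) = m powr p" using m p by (simp add: powr_mult_base)
  have "S * m powr (p - 1) = (\<Sum>i\<in>I. w i * (y i * m powr (p - 1)))"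
    by (simp add: S_def sum_distrib_right mult.assoc)
  also have "\<dots> \<le> (\<Sum>i\<in>I. w i * (y i powr p / p + m powr p / q))"
  proof (intro sum_mono mult_left_mono w)
    fix i assume "i \<in> I"
    have "y i * m powr (p - 1) \<le> y i powr p / p + (m powr (p - 1)) powr q / q"
      using p q y[OF \<open>i \<in> I\<close>] by (intro Youngs_inequality) auto
    then show "y i * m powr (p - 1) \<le> y i powr p / p + m powr p / q"
      using q by (simp add: powr_powr)
  qed
  also have "\<dots> = (\<Sum>i\<in>I. w i * y i powr p) / p + W * (m powr p / q)"
    by (simp add: distrib_left sum.distrib sum_divide_distrib W_def sum_distrib_right)
  finally have "W * m powr p \<le> (\<Sum>i\<in>I. w i * y i powr p) / p + W * (m powr p / q)"
    using W mm by (simp add: m_def field_simps)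
  moreover have "W * (m powr p / q) = W * m powr p - W * m powr p / p"
  proof -
    have "W * (m powr p / q) = W * m powr p * (1 / q)" by simp
    also have "1 / q = 1 - 1 / p" using q(2) by simp
    finally show ?thesis by (simp add: right_diff_distrib)
  qed
  ultimately have le: "W * m powr p \<le> (\<Sum>i\<in>I. w i * y i powr p)"
    using p by (simp add: field_simps)
  have "S powr p = W powr p * m powr p"
    using W m by (simp add: m_def powr_mult[symmetric])
  also have "\<dots> = W powr (p - 1) * (W * m powr p)"
    using W powr_mult_base[of W "p - 1"] by (simp add: mult_ac)
  also have "\<dots> \<le> W powr (p - 1) * (\<Sum>i\<in>I. w i * y i powr p)"
    by (intro mult_left_mono le) simp
  finally show ?thesis by (simp add: S_def W_def)
qed

lemma powr_weighted_sum3_le: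
  fixes a b d :: real
  assumes "0 \<le> u" "0 \<le> v" "0 \<le> w" "0 \<le> a" "0 \<le> b" "0 \<le> d" "1 < p"
  shows "(u * a + v * b + w * d) powr p \<le> (u + v + w) powr (p - 1) * (u * a powr p + v * b powr p + w * d powr p)"
proof -
  have *: "(\<Sum>i\<in>{0,1,2::nat}. F i) = F 0 + F 1 + F 2" for F :: "nat \<Rightarrow> real" by simp
  show ?thesis
    using powr_weighted_sum_le[of "{0,1,2::nat}" "\<lambda>i. if i = 0 then u else if i = 1 then v else w"
      "\<lambda>i. if i = 0 then a else if i = 1 then b else d" p] assms
    unfolding * by auto
qed

text \<open>Weighted arithmetic-geometric mean of \<open>t\<close> and 1 with weights
  \<open>s\<close> and \<open>1 - s\<close>.\<close>

lemma powr_le_one_plus: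
  fixes t s :: real
  assumes "0 \<le> t" "0 \<le> s" "s \<le> 1"
  shows "t powr s \<le> 1 + s * t"
proof (cases "t = 0")
  case False
  then have "t powr s * 1 powr (1 - s) \<le> s * t + (1 - s) * 1"
    using assms by (intro Youngs_inequality_0) auto
  with assms show ?thesis by simp
qed simp

text \<open>The upper bound on \<open>\<delta>\<close> is the condition of the theorem multiplied
  out. In this form it covers a vanishing integral of \<open>Dconst f\<close>, and it forces that
  integral to be finite.\<close>

locale mean_field =
  fixes A :: "real^'d^'d" and \<omega> \<delta> \<alpha> :: real
    and \<theta> :: "(real^'m) measure"
    and f :: "real^'d \<Rightarrow> (real^'d) measure \<Rightarrow> real^'m \<Rightarrow> real^'d"
  assumes theta: "prob_space \<theta>" "sets \<theta> = sets borel"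
    and f_meas: "(\<lambda>((x,\<mu>),z). f x \<mu> z) \<in> borel_measurable
                   ((borel \<Otimes>\<^sub>M restrict_space (subprob_algebra borel) P1) \<Otimes>\<^sub>M borel)"
    and A3: "\<omega> > 0" "onorm (\<lambda>x. A *v x) \<le> exp (- \<omega>)"
    and alpha: "\<alpha> > 0"
    and D_moment: "(\<integral>\<^sup>+ z. epow (Dconst f z) (1 + \<alpha>) \<partial>\<theta>) < \<infinity>"
    and D1_moment: "(\<integral>\<^sup>+ z. ennreal (D1const f z powr (1 + \<alpha>)) \<partial>\<theta>) < \<infinity>"
    and delta: "\<delta> > 0"
        "2 * (\<integral>\<^sup>+ z. Dconst f z \<partial>\<theta>) * ennreal \<delta> < ennreal (1 - exp (- \<omega>))"
begin

sublocale theta: prob_space \<theta> by (rule theta)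

lemmas sets_theta [measurable_cong] = theta(2)

lemma space_theta [simp]: "space \<theta> = UNIV"
  using sets_eq_imp_space_eq[OF theta(2)] by simp

definition "c = exp (- \<omega>)"
definition "\<sigma> = enn2real (\<integral>\<^sup>+ z. Dconst f z \<partial>\<theta>)"
text \<open>One term \<open>\<delta> * \<sigma>\<close> is due to the position argument of
  \<open>f\<close>, the other to its measure argument. The bound on \<open>\<delta>\<close>
  rearranges to \<open>\<gamma> < 1\<close>.\<close>

definition "\<gamma> = c + 2 * \<delta> * \<sigma>"
definition "\<sigma>1 = enn2real (\<integral>\<^sup>+ z. epow (Dconst f z) (1 + \<alpha>) \<partial>\<theta>)"
definition "c1 = enn2real (\<integral>\<^sup>+ z. ennreal (D1const f z powr (1 + \<alpha>)) \<partial>\<theta>)"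

lemma c_pos: "0 < c" and c_less_1: "c < 1"
  using A3 by (simp_all add: c_def)

lemma sigma_nonneg [simp]: "0 \<le> \<sigma>" "0 \<le> \<sigma>1" "0 \<le> c1"
  by (simp_all add: \<sigma>_def \<sigma>1_def c1_def)

lemma int_D: "(\<integral>\<^sup>+ z. Dconst f z \<partial>\<theta>) = ennreal \<sigma>"
proof -
  have "(\<integral>\<^sup>+ z. Dconst f z \<partial>\<theta>) \<noteq> \<top>"
    using delta by (auto simp: ennreal_mult_eq_top_iff ennreal_top_mult ennreal_mult_top)
  then show ?thesis unfolding \<sigma>_def by (simp add: less_top)
qed

lemma int_D1_powr: "(\<integral>\<^sup>+ z. ennreal (D1const f z powr (1 + \<alpha>)) \<partial>\<theta>) = ennreal c1"
  using D1_moment by (simp add: c1_def less_top)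

lemma gamma_bounds: "0 < \<gamma>" "\<gamma> < 1"
proof -
  show "0 < \<gamma>" using c_pos delta by (simp add: \<gamma>_def add_pos_nonneg)
  have "ennreal (2 * \<sigma> * \<delta>) < ennreal (1 - c)"
    using delta unfolding int_D c_def by (simp add: ennreal_mult)
  then show "\<gamma> < 1" using delta c_less_1 by (simp add: ennreal_less_iff \<gamma>_def mult_ac)
qed

lemma P1_space: "\<mu> \<in> P1 \<Longrightarrow> \<mu> \<in> space (restrict_space (subprob_algebra borel) P1)"
  by (auto simp: space_restrict_space P1_iff space_subprob_algebra prob_space_imp_subprob_space)

lemma f_meas_pair: "\<mu> \<in> P1 \<Longrightarrow> (\<lambda>(x, z). f x \<mu> z) \<in> borel_measurable (borel \<Otimes>\<^sub>M borel)"
proof -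
  assume "\<mu> \<in> P1"
  then have "(\<lambda>(x, z). ((x, \<mu>), z)) \<in> measurable (borel \<Otimes>\<^sub>M borel)
     ((borel \<Otimes>\<^sub>M restrict_space (subprob_algebra borel) P1) \<Otimes>\<^sub>M borel)"
    using P1_space by measurable
  from measurable_compose[OF this f_meas] show ?thesis
    by (simp add: case_prod_beta')
qed

lemma f_meas_section: "\<mu> \<in> P1 \<Longrightarrow> f x \<mu> \<in> borel_measurable borel"
  using measurable_compose[OF _ f_meas_pair, of "\<lambda>z. (x, z)" borel \<mu>] by simp

lemma D1_meas: "D1const f \<in> borel_measurable borel"
  unfolding D1const_def[abs_def] using f_meas_section[OF return_in_P1] by measurable

lemma norm_A: "norm (A *v x) \<le> c * norm x"
proof -
  have "norm (A *v x) \<le> onorm (\<lambda>x. A *v x) * norm x"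
    by (rule onorm[OF matrix_vector_mul_bounded_linear])
  also have "\<dots> \<le> c * norm x" using A3 by (intro mult_right_mono) (simp_all add: c_def)
  finally show ?thesis .
qed

text \<open>The function \<open>Dconst f\<close> need not be measurable, and its integral is then a lower integral.
  It is only ever used through the measurable slopes \<open>g\<close> below it.\<close>

lemma slope:
  assumes \<mu>: "\<mu> \<in> P1" and \<nu>: "\<nu> \<in> P1"
  obtains g :: "real^'m \<Rightarrow> real" where "g \<in> borel_measurable borel" "\<And>z. 0 \<le> g z"
    "\<And>z. norm (f x \<mu> z - f y \<nu> z) = g z * (norm (x - y) + W1 \<mu> \<nu>)"
    "(\<integral>\<^sup>+ z. ennreal (g z) \<partial>\<theta>) \<le> ennreal \<sigma>"
    "(\<integral>\<^sup>+ z. ennreal (g z powr (1 + \<alpha>)) \<partial>\<theta>) \<le> ennreal \<sigma>1"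
proof -
  define r where "r = norm (x - y) + W1 \<mu> \<nu>"
  define g where "g z = norm (f x \<mu> z - f y \<nu> z) / r" for z
  have r0: "r \<ge> 0" by (simp add: r_def)
  \<comment> \<open>Where the denominator vanishes, definiteness makes the two arguments coincide,
    so both sides of the identity for \<open>g\<close> are 0.\<close>
  have r: "r > 0 \<or> x = y \<and> \<mu> = \<nu>"
  proof (rule ccontr)
    assume *: "\<not> ?thesis"
    have "norm (x - y) \<ge> 0" "W1 \<mu> \<nu> \<ge> 0" by simp_all
    with * have "norm (x - y) = 0" "W1 \<mu> \<nu> = 0" unfolding r_def by linarith+
    with ennreal_W1[OF \<mu> \<nu>] wass_zero_imp_eq[OF \<mu> \<nu>] * show False by simp
  qed
  have gD: "ennreal (g z) \<le> Dconst f z" for z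
  proof (cases "x = y \<and> \<mu> = \<nu>")
    case True
    then show ?thesis by (simp add: g_def)
  next
    case False
    then show ?thesis unfolding Dconst_def g_def r_def
      by (intro SUP_upper2[of "((x,\<mu>),(y,\<nu>))"]) (auto simp: \<mu> \<nu>)
  qed
  show ?thesis
  proof (rule that[of g])
    show "g \<in> borel_measurable borel"
      unfolding g_def using f_meas_section[OF \<mu>] f_meas_section[OF \<nu>] by measurable
    show "0 \<le> g z" for z using r0 by (simp add: g_def)
    show "norm (f x \<mu> z - f y \<nu> z) = g z * (norm (x - y) + W1 \<mu> \<nu>)" for z
      using r unfolding r_def[symmetric] by (auto simp: g_def)
    show "(\<integral>\<^sup>+ z. ennreal (g z) \<partial>\<theta>) \<le> ennreal \<sigma>"
      unfolding int_D[symmetric] by (intro nn_integral_mono gD)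
    have "(\<integral>\<^sup>+ z. ennreal (g z powr (1 + \<alpha>)) \<partial>\<theta>) \<le> (\<integral>\<^sup>+ z. epow (Dconst f z) (1 + \<alpha>) \<partial>\<theta>)"
    proof (intro nn_integral_mono)
      fix z
      show "ennreal (g z powr (1 + \<alpha>)) \<le> epow (Dconst f z) (1 + \<alpha>)"
      proof (cases "Dconst f z = \<top>")
        case False
        then have "g z \<le> enn2real (Dconst f z)" using gD[of z] r0
          by (metis enn2real_ennreal enn2real_mono g_def divide_nonneg_nonneg norm_ge_zero less_top)
        then have "g z powr (1 + \<alpha>) \<le> enn2real (Dconst f z) powr (1 + \<alpha>)"
          using alpha r0 by (intro powr_mono2) (simp_all add: g_def)
        with False show ?thesis by (simp add: epow_def)
      qed (simp add: epow_def)
    qed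
    also have "\<dots> = ennreal \<sigma>1" using D_moment by (simp add: \<sigma>1_def less_top)
    finally show "(\<integral>\<^sup>+ z. ennreal (g z powr (1 + \<alpha>)) \<partial>\<theta>) \<le> ennreal \<sigma>1" .
  qed
qed

lemma f_lipschitz:
  assumes \<mu>: "\<mu> \<in> P1" and \<nu>: "\<nu> \<in> P1"
  shows "(\<integral>\<^sup>+ z. ennreal (norm (f x \<mu> z - f y \<nu> z)) \<partial>\<theta>) \<le> ennreal \<sigma> * ennreal (norm (x - y) + W1 \<mu> \<nu>)"
proof -
  obtain g :: "real^'m \<Rightarrow> real" where g: "g \<in> borel_measurable borel" "\<And>z. 0 \<le> g z"
    "\<And>z. norm (f x \<mu> z - f y \<nu> z) = g z * (norm (x - y) + W1 \<mu> \<nu>)"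
    "(\<integral>\<^sup>+ z. ennreal (g z) \<partial>\<theta>) \<le> ennreal \<sigma>"
    "(\<integral>\<^sup>+ z. ennreal (g z powr (1 + \<alpha>)) \<partial>\<theta>) \<le> ennreal \<sigma>1"
    by (rule slope[OF \<mu> \<nu>, of x y]) (rule that; assumption)
  note [measurable] = g(1)
  have "(\<integral>\<^sup>+ z. ennreal (norm (f x \<mu> z - f y \<nu> z)) \<partial>\<theta>) = (\<integral>\<^sup>+ z. ennreal (g z) \<partial>\<theta>) * ennreal (norm (x - y) + W1 \<mu> \<nu>)"
    by (simp add: g ennreal_mult nn_integral_multc)
  also have "\<dots> \<le> ennreal \<sigma> * ennreal (norm (x - y) + W1 \<mu> \<nu>)" by (intro mult_right_mono g) simp
  finally show ?thesis .
qed

text \<open>The constant comes from the pointwise bound of a nonnegative number by 1 plus its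
  \<open>1 + \<alpha>\<close>-th power.\<close>

lemma int_D1: "(\<integral>\<^sup>+ z. ennreal (D1const f z) \<partial>\<theta>) \<le> ennreal (1 + c1)"
proof -
  note [measurable] = D1_meas
  have "(\<integral>\<^sup>+ z. ennreal (D1const f z) \<partial>\<theta>) \<le> (\<integral>\<^sup>+ z. 1 + ennreal (D1const f z powr (1 + \<alpha>)) \<partial>\<theta>)"
  proof (intro nn_integral_mono)
    fix z
    have "D1const f z \<le> 1 + D1const f z powr (1 + \<alpha>)"
    proof (cases "D1const f z \<le> 1")
      case False
      then have "D1const f z powr 1 \<le> D1const f z powr (1 + \<alpha>)" using alpha by (intro powr_mono) auto
      then show ?thesis using False by simp
    qed (simp add: add_increasing2)
    then show "ennreal (D1const f z) \<le> 1 + ennreal (D1const f z powr (1 + \<alpha>))"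
      by (simp flip: ennreal_1 ennreal_plus)
  qed
  also have "\<dots> = 1 + ennreal c1"
    by (simp add: nn_integral_add int_D1_powr theta.emeasure_space_1[simplified])
  also have "\<dots> = ennreal (1 + c1)" by (simp add: ennreal_plus)
  finally show ?thesis .
qed

lemma W1_return_le:
  fixes \<mu> :: "(real^'d) measure"
  assumes \<mu>: "\<mu> \<in> P1" and m: "(\<integral>\<^sup>+ x. ennreal (norm x) \<partial>\<mu>) \<le> ennreal m" "0 \<le> m"
  shows "W1 \<mu> (return borel 0) \<le> m"
proof -
  have "ennreal (W1 \<mu> (return borel 0)) \<le> (\<integral>\<^sup>+ x. ennreal (norm x) \<partial>\<mu>) + (\<integral>\<^sup>+ x. ennreal (norm x) \<partial>return borel (0::real^'d))"
    unfolding ennreal_W1[OF \<mu> return_in_P1]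
    by (intro wass_le_moments) (use \<mu> return_in_P1[of 0] in \<open>auto simp: P1_iff\<close>)
  also have "\<dots> \<le> ennreal m" using m by (simp add: nn_integral_return)
  finally show ?thesis using m by simp
qed

text \<open>A bound for the \<open>1 + \<alpha>\<close>-th moment of the total weight
  \<open>c + 2 * \<delta> * g z + \<delta> * D1const f z\<close> occurring in
  \<open>upd_dominated\<close>, with \<open>3 powr \<alpha>\<close> as the price of splitting the
  power of a sum of three terms.\<close>

definition "Cw = 3 powr \<alpha> * (c powr (1 + \<alpha>) + (2 * \<delta>) powr (1 + \<alpha>) * \<sigma>1 + \<delta> powr (1 + \<alpha>) * c1)"

lemma Cw_nonneg: "0 \<le> Cw"
  by (simp add: Cw_def)

definition upd :: "(real^'d) measure \<Rightarrow> real^'d \<Rightarrow> real^'m \<Rightarrow> real^'d" where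
  "upd \<mu> x z = A *v x + \<delta> *\<^sub>R f x \<mu> z"

text \<open>Comparison with the reference point \<open>0\<close> and \<open>return borel 0\<close>,
  at distance at most \<open>norm x + m\<close>. The bound is kept as a combination of the values
  \<open>norm x\<close>, \<open>m\<close> and \<open>1\<close> with random weights, the factor 1
  included, so that Jensen's inequality applies to it verbatim.\<close>

lemma upd_dominated:
  assumes \<mu>: "\<mu> \<in> P1" and m: "(\<integral>\<^sup>+ x. ennreal (norm x) \<partial>\<mu>) \<le> ennreal m" "0 \<le> m"
  obtains g :: "real^'m \<Rightarrow> real" where "g \<in> borel_measurable borel" "\<And>z. 0 \<le> g z"
    "\<And>z. norm (upd \<mu> x z) \<le> (c + \<delta> * g z) * norm x + \<delta> * g z * m + \<delta> * D1const f z * 1"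
    "(\<integral>\<^sup>+ z. ennreal (g z) \<partial>\<theta>) \<le> ennreal \<sigma>"
    "(\<integral>\<^sup>+ z. ennreal (g z powr (1 + \<alpha>)) \<partial>\<theta>) \<le> ennreal \<sigma>1"
proof -
  obtain g :: "real^'m \<Rightarrow> real" where g: "g \<in> borel_measurable borel" "\<And>z. 0 \<le> g z"
    "\<And>z. norm (f x \<mu> z - f 0 (return borel 0) z) = g z * (norm (x - 0) + W1 \<mu> (return borel 0))"
    "(\<integral>\<^sup>+ z. ennreal (g z) \<partial>\<theta>) \<le> ennreal \<sigma>"
    "(\<integral>\<^sup>+ z. ennreal (g z powr (1 + \<alpha>)) \<partial>\<theta>) \<le> ennreal \<sigma>1"
    by (rule slope[OF \<mu> return_in_P1, of x 0 0]) (rule that; assumption)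
  show ?thesis
  proof (rule that[OF g(1,2) _ g(4,5)])
    fix z
    have "norm (f x \<mu> z) \<le> g z * (norm x + W1 \<mu> (return borel 0)) + D1const f z"
      using norm_triangle_ineq[of "f x \<mu> z - f 0 (return borel 0) z" "f 0 (return borel 0) z"] g(3)[of z]
      by (simp add: D1const_def)
    also have "\<dots> \<le> g z * (norm x + m) + D1const f z"
      using W1_return_le[OF \<mu> m] g(2)[of z] by (intro add_right_mono mult_left_mono add_left_mono) auto
    finally have "\<delta> * norm (f x \<mu> z) \<le> \<delta> * (g z * (norm x + m) + D1const f z)"
      using delta by (intro mult_left_mono) auto
    moreover have "norm (upd \<mu> x z) \<le> c * norm x + \<delta> * norm (f x \<mu> z)"
      unfolding upd_def using norm_triangle_ineq[of "A *v x" "\<delta> *\<^sub>R f x \<mu> z"] norm_A[of x] delta by simp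
    ultimately show "norm (upd \<mu> x z) \<le> (c + \<delta> * g z) * norm x + \<delta> * g z * m + \<delta> * D1const f z * 1"
      by (simp add: algebra_simps)
  qed
qed

lemma upd_first_moment:
  assumes \<mu>: "\<mu> \<in> P1" and m: "(\<integral>\<^sup>+ x. ennreal (norm x) \<partial>\<mu>) \<le> ennreal m" "0 \<le> m"
  shows "(\<integral>\<^sup>+ z. ennreal (norm (upd \<mu> x z)) \<partial>\<theta>)
     \<le> ennreal (c + \<delta> * \<sigma>) * ennreal (norm x) + ennreal (\<delta> * \<sigma> * m + \<delta> * (1 + c1))"
proof -
  obtain g :: "real^'m \<Rightarrow> real" where g: "g \<in> borel_measurable borel" "\<And>z. 0 \<le> g z"
    "\<And>z. norm (upd \<mu> x z) \<le> (c + \<delta> * g z) * norm x + \<delta> * g z * m + \<delta> * D1const f z * 1"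
    "(\<integral>\<^sup>+ z. ennreal (g z) \<partial>\<theta>) \<le> ennreal \<sigma>"
    "(\<integral>\<^sup>+ z. ennreal (g z powr (1 + \<alpha>)) \<partial>\<theta>) \<le> ennreal \<sigma>1"
    by (rule upd_dominated[OF assms, of x]) (rule that; assumption)
  note [measurable] = g(1) D1_meas
  have D1: "0 \<le> D1const f z" for z by (simp add: D1const_def)
  have "(\<integral>\<^sup>+ z. ennreal (norm (upd \<mu> x z)) \<partial>\<theta>)
    \<le> (\<integral>\<^sup>+ z. ennreal (c * norm x) + ennreal (\<delta> * (norm x + m)) * ennreal (g z) + ennreal \<delta> * ennreal (D1const f z) \<partial>\<theta>)"
  proof (intro nn_integral_mono)
    fix z
    have "ennreal (norm (upd \<mu> x z)) \<le> ennreal (c * norm x + \<delta> * (norm x + m) * g z + \<delta> * D1const f z)"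
      using g(3)[of z] by (intro ennreal_leI) (simp add: algebra_simps)
    also have "\<dots> = ennreal (c * norm x) + ennreal (\<delta> * (norm x + m)) * ennreal (g z) + ennreal \<delta> * ennreal (D1const f z)"
      using c_pos delta m D1 g(2) by (simp add: ennreal_plus ennreal_mult)
    finally show "ennreal (norm (upd \<mu> x z)) \<le> \<dots>" .
  qed
  also have "\<dots> = ennreal (c * norm x) + ennreal (\<delta> * (norm x + m)) * (\<integral>\<^sup>+ z. ennreal (g z) \<partial>\<theta>) + ennreal \<delta> * (\<integral>\<^sup>+ z. ennreal (D1const f z) \<partial>\<theta>)"
    by (simp add: nn_integral_add nn_integral_cmult theta.emeasure_space_1[simplified])
  also have "\<dots> \<le> ennreal (c * norm x) + ennreal (\<delta> * (norm x + m)) * ennreal \<sigma> + ennreal \<delta> * ennreal (1 + c1)"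
    by (intro add_mono mult_left_mono order_refl g int_D1) simp_all
  also have "\<dots> = ennreal ((c + \<delta> * \<sigma>) * norm x + (\<delta> * \<sigma> * m + \<delta> * (1 + c1)))"
    using c_pos delta m by (simp add: ennreal_plus[symmetric] ennreal_mult[symmetric] algebra_simps del: ennreal_plus)
  also have "\<dots> = ennreal (c + \<delta> * \<sigma>) * ennreal (norm x) + ennreal (\<delta> * \<sigma> * m + \<delta> * (1 + c1))"
    using c_pos delta m by (subst ennreal_plus) (auto simp: ennreal_mult)
  finally show ?thesis .
qed

text \<open>Interpolating \<open>W powr (s * \<alpha>) \<le> 1 + s * W powr \<alpha>\<close> keeps the contraction rate of the first
  moment, up to \<open>O(s)\<close>, for the moment of order \<open>1 + s * \<alpha>\<close>.\<close>

lemma upd_moment: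
  assumes \<mu>: "\<mu> \<in> P1" and m: "(\<integral>\<^sup>+ x. ennreal (norm x) \<partial>\<mu>) \<le> ennreal m" "0 \<le> m"
    and s: "0 < s" "s \<le> 1"
  shows "(\<integral>\<^sup>+ z. ennreal (norm (upd \<mu> x z) powr (1 + s * \<alpha>)) \<partial>\<theta>)
     \<le> ennreal ((c + \<delta> * \<sigma> + s * Cw) * norm x powr (1 + s * \<alpha>) + (\<delta> * \<sigma> + s * Cw) * m powr (1 + s * \<alpha>)
        + (\<delta> * (1 + c1) + s * Cw))"
proof -
  obtain g :: "real^'m \<Rightarrow> real" where g: "g \<in> borel_measurable borel" "\<And>z. 0 \<le> g z"
    "\<And>z. norm (upd \<mu> x z) \<le> (c + \<delta> * g z) * norm x + \<delta> * g z * m + \<delta> * D1const f z * 1"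
    "(\<integral>\<^sup>+ z. ennreal (g z) \<partial>\<theta>) \<le> ennreal \<sigma>"
    "(\<integral>\<^sup>+ z. ennreal (g z powr (1 + \<alpha>)) \<partial>\<theta>) \<le> ennreal \<sigma>1"
    by (rule upd_dominated[OF \<mu> m, of x]) (rule that; assumption)
  note [measurable] = g(1) D1_meas
  have D1: "0 \<le> D1const f z" for z by (simp add: D1const_def)
  define p where "p = 1 + s * \<alpha>"
  have p: "1 < p" using s alpha by (simp add: p_def)
  define a where "a = norm x powr p"
  define b where "b = m powr p"
  have ab: "0 \<le> a" "0 \<le> b" by (simp_all add: a_def b_def)
  define G where "G z = g z powr (1 + \<alpha>)" for z
  define H where "H z = D1const f z powr (1 + \<alpha>)" for z
  have GH: "0 \<le> G z" "0 \<le> H z" for z by (simp_all add: G_def H_def)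
  have [measurable]: "G \<in> borel_measurable borel" "H \<in> borel_measurable borel"
    unfolding G_def H_def by measurable
  define k where "k = s * (a + b + 1) * 3 powr \<alpha>"
  have k: "0 \<le> k" using s ab by (simp add: k_def)
  define c' where "c' = c powr (1 + \<alpha>)"
  define d' where "d' = (2 * \<delta>) powr (1 + \<alpha>)"
  define e' where "e' = \<delta> powr (1 + \<alpha>)"
  have cde: "0 \<le> c'" "0 \<le> d'" "0 \<le> e'" by (simp_all add: c'_def d'_def e'_def)
  have pw: "norm (upd \<mu> x z) powr p \<le> (c * a + k * c') + \<delta> * (a + b) * g z + \<delta> * D1const f z + k * d' * G z + k * e' * H z" for z
  proof -
    define w1 where "w1 = c + \<delta> * g z"
    define w2 where "w2 = \<delta> * g z"
    define w3 where "w3 = \<delta> * D1const f z"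
    have w: "0 < w1" "0 \<le> w2" "0 \<le> w3"
      using c_pos delta D1 g(2) by (simp_all add: w1_def w2_def w3_def add_pos_nonneg)
    define W where "W = w1 + w2 + w3"
    have W: "0 < W" "w1 \<le> W" "w2 \<le> W" "w3 \<le> W" using w by (simp_all add: W_def)
    have "norm (upd \<mu> x z) powr p \<le> (w1 * norm x + w2 * m + w3 * 1) powr p"
      using p g(3)[of z] unfolding w1_def w2_def w3_def by (intro powr_mono2) auto
    also have "\<dots> \<le> W powr (p - 1) * (w1 * norm x powr p + w2 * m powr p + w3 * 1 powr p)"
      unfolding W_def using w m p by (intro powr_weighted_sum3_le) auto
    also have "\<dots> = W powr (s * \<alpha>) * (w1 * a + w2 * b + w3)" by (simp add: p_def a_def b_def)
    also have "W powr (s * \<alpha>) = (W powr \<alpha>) powr s" by (simp add: powr_powr mult.commute)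
    also have "(W powr \<alpha>) powr s * (w1 * a + w2 * b + w3) \<le> (1 + s * W powr \<alpha>) * (w1 * a + w2 * b + w3)"
      using w ab s by (intro mult_right_mono powr_le_one_plus) auto
    also have "\<dots> = (w1 * a + w2 * b + w3) + s * W powr \<alpha> * (w1 * a + w2 * b + w3)" by (simp add: algebra_simps)
    \<comment> \<open>Only this term carries the small factor \<open>s\<close>, so here each weight
      may be replaced by the total \<open>W\<close>. The other term keeps the exact weights, which
      yield the contraction rate.\<close>
    also have "s * W powr \<alpha> * (w1 * a + w2 * b + w3) \<le> s * W powr \<alpha> * (W * (a + b + 1))"
    proof (intro mult_left_mono)
      have "w1 * a \<le> W * a" "w2 * b \<le> W * b" using W ab by (auto intro: mult_right_mono)
      then show "w1 * a + w2 * b + w3 \<le> W * (a + b + 1)" using W by (simp add: algebra_simps)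
    qed (use s in simp)
    also have "s * W powr \<alpha> * (W * (a + b + 1)) = s * (a + b + 1) * W powr (1 + \<alpha>)"
      using W powr_mult_base[of W \<alpha>] by (simp add: mult_ac)
    also have "s * (a + b + 1) * W powr (1 + \<alpha>) \<le> s * (a + b + 1) * (3 powr \<alpha> * (c' + d' * G z + e' * H z))"
    proof (intro mult_left_mono)
      \<comment> \<open>The two copies of \<open>\<delta> * g z\<close> in \<open>W\<close> are
        merged into one summand, whence the \<open>2 * \<delta>\<close> in
        \<open>Cw\<close>.\<close>
      have "W powr (1 + \<alpha>) = (1 * c + 1 * (2 * \<delta> * g z) + 1 * (\<delta> * D1const f z)) powr (1 + \<alpha>)"
        by (simp add: W_def w1_def w2_def w3_def algebra_simps)
      also have "\<dots> \<le> (1 + 1 + 1) powr (1 + \<alpha> - 1) * (1 * c powr (1 + \<alpha>) + 1 * (2 * \<delta> * g z) powr (1 + \<alpha>) + 1 * (\<delta> * D1const f z) powr (1 + \<alpha>))"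
        using c_pos delta g(2)[of z] D1[of z] alpha by (intro powr_weighted_sum3_le) auto
      also have "\<dots> = 3 powr \<alpha> * (c' + d' * G z + e' * H z)"
        using delta g(2)[of z] D1[of z] by (simp add: powr_mult c'_def d'_def e'_def G_def H_def)
      finally show "W powr (1 + \<alpha>) \<le> 3 powr \<alpha> * (c' + d' * G z + e' * H z)" .
    qed (use s ab in simp)
    also have "\<dots> = k * c' + k * d' * G z + k * e' * H z" by (simp add: k_def algebra_simps)
    finally show ?thesis by (simp add: w1_def w2_def w3_def algebra_simps)
  qed
  have "(\<integral>\<^sup>+ z. ennreal (norm (upd \<mu> x z) powr p) \<partial>\<theta>) \<le>
     (\<integral>\<^sup>+ z. ennreal (c * a + k * c') + ennreal (\<delta> * (a + b)) * ennreal (g z) + ennreal \<delta> * ennreal (D1const f z)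
        + ennreal (k * d') * ennreal (G z) + ennreal (k * e') * ennreal (H z) \<partial>\<theta>)"
  proof (intro nn_integral_mono)
    fix z
    have "ennreal (norm (upd \<mu> x z) powr p) \<le> ennreal ((c * a + k * c') + \<delta> * (a + b) * g z + \<delta> * D1const f z + k * d' * G z + k * e' * H z)"
      by (intro ennreal_leI pw)
    also have "\<dots> = ennreal (c * a + k * c') + ennreal (\<delta> * (a + b)) * ennreal (g z) + ennreal \<delta> * ennreal (D1const f z)
        + ennreal (k * d') * ennreal (G z) + ennreal (k * e') * ennreal (H z)"
      using c_pos delta D1[of z] g(2)[of z] GH[of z] ab k cde by (simp add: ennreal_plus ennreal_mult)
    finally show "ennreal (norm (upd \<mu> x z) powr p) \<le> \<dots>" .
  qed
  also have "\<dots> = ennreal (c * a + k * c') + ennreal (\<delta> * (a + b)) * (\<integral>\<^sup>+ z. ennreal (g z) \<partial>\<theta>) + ennreal \<delta> * (\<integral>\<^sup>+ z. ennreal (D1const f z) \<partial>\<theta>)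
        + ennreal (k * d') * (\<integral>\<^sup>+ z. ennreal (G z) \<partial>\<theta>) + ennreal (k * e') * (\<integral>\<^sup>+ z. ennreal (H z) \<partial>\<theta>)"
    by (simp add: nn_integral_add nn_integral_cmult theta.emeasure_space_1[simplified])
  also have "\<dots> \<le> ennreal (c * a + k * c') + ennreal (\<delta> * (a + b)) * ennreal \<sigma> + ennreal \<delta> * ennreal (1 + c1)
        + ennreal (k * d') * ennreal \<sigma>1 + ennreal (k * e') * ennreal c1"
    using g(4,5) int_D1 int_D1_powr unfolding G_def H_def by (intro add_mono mult_left_mono order_refl) simp_all
  also have "\<dots> = ennreal ((c * a + k * c') + \<delta> * (a + b) * \<sigma> + \<delta> * (1 + c1) + k * d' * \<sigma>1 + k * e' * c1)"
    using c_pos delta ab k cde by (simp add: ennreal_plus[symmetric] ennreal_mult[symmetric] del: ennreal_plus)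
  also have "(c * a + k * c') + \<delta> * (a + b) * \<sigma> + \<delta> * (1 + c1) + k * d' * \<sigma>1 + k * e' * c1
    = (c + \<delta> * \<sigma> + s * Cw) * a + (\<delta> * \<sigma> + s * Cw) * b + (\<delta> * (1 + c1) + s * Cw)"
    by (simp add: k_def Cw_def c'_def d'_def e'_def algebra_simps)
  finally show ?thesis by (simp add: a_def b_def p_def)
qed

end

section \<open>Contraction of the nonlinear evolution and empirical measures\<close>

lemma nn_integral_empirical:
  assumes N: "1 \<le> N" and [measurable]: "g \<in> borel_measurable borel"
  shows "(\<integral>\<^sup>+ y. g y \<partial>empirical N x) = ennreal (1 / real N) * (\<Sum>i=1..N. g (x i))"
proof -
  have "(\<integral>\<^sup>+ y. g y \<partial>empirical N x) = (\<integral>\<^sup>+ i. g (x i) \<partial>uniform_count_measure {1..N})"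
    unfolding empirical_def by (rule nn_integral_distr) simp_all
  also have "\<dots> = (\<Sum>i=1..N. ennreal (1 / real N) * g (x i))"
    unfolding uniform_count_measure_def by (subst nn_integral_point_measure_finite) simp_all
  finally show ?thesis by (simp add: sum_distrib_left)
qed

lemma sets_empirical [simp, measurable_cong]: "sets (empirical N x) = sets borel"
  by (simp add: empirical_def)

lemma space_empirical [simp]: "space (empirical N x) = UNIV"
  by (simp add: empirical_def)

lemma emeasure_empirical:
  assumes "1 \<le> N" "B \<in> sets borel"
  shows "emeasure (empirical N x) B = ennreal ((1 / real N) * (\<Sum>i=1..N. indicator B (x i)))"
proof -
  have "emeasure (empirical N x) B = (\<integral>\<^sup>+ y. indicator B y \<partial>empirical N x)" using assms by simp
  also have "\<dots> = ennreal (1 / real N) * (\<Sum>i=1..N. ennreal (indicator B (x i)))"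
    using assms by (subst nn_integral_empirical) (simp_all add: ennreal_indicator)
  also have "\<dots> = ennreal ((1 / real N) * (\<Sum>i=1..N. indicator B (x i)))"
    by (subst ennreal_mult) (auto simp: sum_nonneg)
  finally show ?thesis .
qed

lemma prob_space_empirical: "1 \<le> N \<Longrightarrow> prob_space (empirical N x)"
  by (rule prob_spaceI) (simp add: emeasure_empirical)

lemma nn_integral_empirical_real:
  assumes N: "1 \<le> N" and [measurable]: "g \<in> borel_measurable borel" and "\<And>y. 0 \<le> g y"
  shows "(\<integral>\<^sup>+ y. ennreal (g y) \<partial>empirical N x) = ennreal ((1 / real N) * (\<Sum>i=1..N. g (x i)))"
  using assms by (subst nn_integral_empirical) (simp_all add: ennreal_mult[symmetric] sum_nonneg)

lemma empirical_in_P1: "1 \<le> N \<Longrightarrow> empirical N x \<in> P1"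
  by (simp add: P1_iff prob_space_empirical nn_integral_empirical_real)

lemma measurable_empirical:
  assumes "1 \<le> N"
  shows "(empirical N :: (nat \<Rightarrow> 'a::euclidean_space) \<Rightarrow> _) \<in> measurable (Pi\<^sub>M {1..N} (\<lambda>_. borel)) (restrict_space (subprob_algebra borel) P1)"
proof (rule measurable_restrict_space2)
  have "(\<lambda>x. emeasure (empirical N x) B) \<in> borel_measurable (Pi\<^sub>M {1..N} (\<lambda>_. borel))"
    if [measurable]: "B \<in> sets borel" for B :: "'a set"
    using assms by (simp add: emeasure_empirical)
  then show "empirical N \<in> measurable (Pi\<^sub>M {1..N} (\<lambda>_. borel)) (subprob_algebra (borel :: 'a measure))"
    by (intro measurable_subprob_algebra)
      (auto intro!: prob_space_imp_subprob_space prob_space_empirical assms)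
qed (use assms empirical_in_P1 in auto)

text \<open>The centred summands are independent and bounded by 1, so the cross terms vanish and the
  second moment of the sum is at most the number of summands.\<close>

lemma (in prob_space) product_average_deviation:
  fixes h :: "'i \<Rightarrow> 'a \<Rightarrow> real"
  assumes I: "finite I" "I \<noteq> {}" and h[measurable]: "\<And>i. i \<in> I \<Longrightarrow> h i \<in> borel_measurable M"
    and h01: "\<And>i z. i \<in> I \<Longrightarrow> 0 \<le> h i z" "\<And>i z. i \<in> I \<Longrightarrow> h i z \<le> 1"
  shows "(\<integral>\<^sup>+ z. ennreal \<bar>\<Sum>i\<in>I. h i (z i) - expectation (h i)\<bar> \<partial>Pi\<^sub>M I (\<lambda>_. M)) \<le> ennreal (sqrt (card I))"
proof -
  interpret P: finite_product_prob_space "\<lambda>_. M" I by standard (rule I)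
  define u where "u i z = h i z - expectation (h i)" for i z
  have inth: "integrable M (h i)" if "i \<in> I" for i
    using h01[OF that] h[OF that] by (intro integrable_const_bound[of _ 1]) auto
  have e01: "0 \<le> expectation (h i)" "expectation (h i) \<le> 1" if "i \<in> I" for i
    using h01[OF that] inth[OF that] by (auto intro!: integral_nonneg_AE integral_le_const)
  have u1: "\<bar>u i z\<bar> \<le> 1" if "i \<in> I" for i z
    using h01[OF that, of z] e01[OF that] by (auto simp: u_def abs_le_iff)
  have um[measurable]: "u i \<in> borel_measurable M" if "i \<in> I" for i
    using h[OF that] unfolding u_def by measurable
  have intu: "integrable M (u i)" if "i \<in> I" for i
    using u1[OF that] um[OF that] by (intro integrable_const_bound[of _ 1]) auto
  have u0: "expectation (u i) = 0" if "i \<in> I" for i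
    unfolding u_def using inth[OF that] by (simp add: prob_space)
  define S where "S z = (\<Sum>i\<in>I. u i (z i))" for z
  define n where "n = real (card I)"
  have n: "n > 0" using I by (simp add: n_def card_gt_0_iff)
  have umP[measurable]: "(\<lambda>z. u i (z i)) \<in> borel_measurable (Pi\<^sub>M I (\<lambda>_. M))" if "i \<in> I" for i
    using measurable_compose[OF measurable_component_singleton[OF that] um[OF that]] .
  have Sm[measurable]: "S \<in> borel_measurable (Pi\<^sub>M I (\<lambda>_. M))"
    unfolding S_def by measurable
  have intuu: "integrable (Pi\<^sub>M I (\<lambda>_. M)) (\<lambda>z. u i (z i) * u j (z j))" if "i \<in> I" "j \<in> I" for i j
  proof (rule P.integrable_const_bound[of _ 1])
    show "AE z in Pi\<^sub>M I (\<lambda>_. M). norm (u i (z i) * u j (z j)) \<le> 1"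
      using mult_mono[OF u1[OF that(1)] u1[OF that(2)]] by (intro AE_I2) (simp add: abs_mult)
  qed (use that in measurable)
  have off: "(\<integral>z. u i (z i) * u j (z j) \<partial>Pi\<^sub>M I (\<lambda>_. M)) = 0" if ij: "i \<in> I" "j \<in> I" "i \<noteq> j" for i j
  proof -
    \<comment> \<open>Inserting factors 1 at the other indices turns the cross term into a product
      over all of \<open>I\<close>, to which the product formula for integrals applies; the factor
      at \<open>i\<close> has mean 0.\<close>
    define F where "F k z = (if k = i then u i z else 1) * (if k = j then u j z else 1)" for k z
    have "(\<integral>z. u i (z i) * u j (z j) \<partial>Pi\<^sub>M I (\<lambda>_. M)) = (\<integral>z. (\<Prod>k\<in>I. F k (z k)) \<partial>Pi\<^sub>M I (\<lambda>_. M))"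
      using I ij by (intro Bochner_Integration.integral_cong refl)
        (simp add: F_def prod.distrib prod.delta cong: if_cong)
    also have "\<dots> = (\<Prod>k\<in>I. expectation (F k))"
    proof (intro P.product_integral_prod I)
      show "integrable M (F k)" if "k \<in> I" for k
        using ij intu by (cases "k = i"; cases "k = j") (simp_all add: F_def[abs_def])
    qed
    also have "\<dots> = 0"
      using I ij u0[of i] by (intro prod_zero bexI[of _ i]) (simp_all add: F_def[abs_def])
    finally show ?thesis .
  qed
  have diag: "(\<integral>z. u i (z i) * u i (z i) \<partial>Pi\<^sub>M I (\<lambda>_. M)) \<le> 1" if "i \<in> I" for i
  proof (rule P.integral_le_const[OF intuu[OF that that]])
    show "AE z in Pi\<^sub>M I (\<lambda>_. M). u i (z i) * u i (z i) \<le> 1"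
      using u1[OF that] by (intro AE_I2) (simp add: abs_square_le_1 flip: power2_eq_square)
  qed
  have S2: "(S z)\<^sup>2 = (\<Sum>i\<in>I. \<Sum>j\<in>I. u i (z i) * u j (z j))" for z
    by (simp add: S_def power2_eq_square sum_product)
  have intS2: "integrable (Pi\<^sub>M I (\<lambda>_. M)) (\<lambda>z. (S z)\<^sup>2)"
    unfolding S2 by (intro Bochner_Integration.integrable_sum intuu)
  have "(\<integral>z. (S z)\<^sup>2 \<partial>Pi\<^sub>M I (\<lambda>_. M)) = (\<Sum>i\<in>I. \<Sum>j\<in>I. (\<integral>z. u i (z i) * u j (z j) \<partial>Pi\<^sub>M I (\<lambda>_. M)))"
    unfolding S2 by (simp add: Bochner_Integration.integral_sum Bochner_Integration.integrable_sum intuu)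
  also have "\<dots> \<le> (\<Sum>i\<in>I. \<Sum>j\<in>I. if i = j then 1 else 0)"
    using off diag by (intro sum_mono) auto
  also have "\<dots> = n" using I by (simp add: n_def)
  finally have ES: "(\<integral>z. (S z)\<^sup>2 \<partial>Pi\<^sub>M I (\<lambda>_. M)) \<le> n" .
  \<comment> \<open>The arithmetic-geometric mean inequality balanced at \<open>sqrt n\<close> plays
    the part of Cauchy-Schwarz: with a second moment at most \<open>n\<close> its right-hand side
    integrates to at most \<open>sqrt n\<close>.\<close>
  have amgm: "\<bar>S z\<bar> \<le> ((S z)\<^sup>2 / sqrt n + sqrt n) / 2" for z
  proof -
    have "0 \<le> (\<bar>S z\<bar> - sqrt n)\<^sup>2" by simp
    then have "2 * \<bar>S z\<bar> * sqrt n \<le> (S z)\<^sup>2 + n" using n by (simp add: power2_diff)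
    then show ?thesis using n by (simp add: field_simps)
  qed
  have "(\<integral>\<^sup>+ z. ennreal \<bar>S z\<bar> \<partial>Pi\<^sub>M I (\<lambda>_. M)) \<le> (\<integral>\<^sup>+ z. ennreal (((S z)\<^sup>2 / sqrt n + sqrt n) / 2) \<partial>Pi\<^sub>M I (\<lambda>_. M))"
    by (intro nn_integral_mono ennreal_leI amgm)
  also have "\<dots> = ennreal (\<integral>z. ((S z)\<^sup>2 / sqrt n + sqrt n) / 2 \<partial>Pi\<^sub>M I (\<lambda>_. M))"
    using n intS2 by (intro nn_integral_eq_integral) auto
  also have "(\<integral>z. ((S z)\<^sup>2 / sqrt n + sqrt n) / 2 \<partial>Pi\<^sub>M I (\<lambda>_. M)) = ((\<integral>z. (S z)\<^sup>2 \<partial>Pi\<^sub>M I (\<lambda>_. M)) / sqrt n + sqrt n) / 2"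
    using intS2 prob_space.prob_space[OF prob_space_PiM[of I "\<lambda>_. M", OF prob_space_axioms]] by simp
  also have "\<dots> \<le> (n / sqrt n + sqrt n) / 2" using ES n by (intro divide_right_mono add_right_mono) auto
  also have "\<dots> = sqrt n" using n by (simp add: real_div_sqrt)
  finally show ?thesis by (simp add: S_def u_def n_def ennreal_leI)
qed

section \<open>The map \<open>\<Psi>\<close> on measures with finite first moment\<close>

context mean_field begin

lemma measurable_A [measurable]: "(\<lambda>x. A *v x) \<in> borel_measurable borel"
  by (intro borel_measurable_continuous_onI linear_continuous_on matrix_vector_mul_bounded_linear)

lemma upd_meas: "\<mu> \<in> P1 \<Longrightarrow> (\<lambda>p. upd \<mu> (fst p) (snd p)) \<in> borel_measurable (borel \<Otimes>\<^sub>M borel)"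
  using f_meas_pair unfolding upd_def case_prod_beta' by measurable

lemma upd_meas_section: "\<mu> \<in> P1 \<Longrightarrow> upd \<mu> x \<in> borel_measurable borel"
  using f_meas_section unfolding upd_def by measurable

abbreviation "\<Psi> \<equiv> Psi A \<delta> f \<theta>"

lemma Psi_eq: "\<Psi> \<mu> = distr (\<mu> \<Otimes>\<^sub>M \<theta>) borel (\<lambda>p. upd \<mu> (fst p) (snd p))"
  by (simp add: Psi_def upd_def case_prod_beta')

lemma sets_Psi [simp, measurable_cong]: "sets (\<Psi> \<mu>) = sets borel"
  by (simp add: Psi_def)

lemma space_Psi [simp]: "space (\<Psi> \<mu>) = UNIV"
  by (simp add: Psi_def)

lemma P1_sets: "\<mu> \<in> P1 \<Longrightarrow> sets \<mu> = sets borel" and P1_prob: "\<mu> \<in> P1 \<Longrightarrow> prob_space \<mu>"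
  by (simp_all add: P1_iff)

lemma nn_integral_Psi:
  assumes \<mu>: "\<mu> \<in> P1" and g[measurable]: "g \<in> borel_measurable borel"
  shows "(\<integral>\<^sup>+ y. g y \<partial>\<Psi> \<mu>) = (\<integral>\<^sup>+ x. \<integral>\<^sup>+ z. g (upd \<mu> x z) \<partial>\<theta> \<partial>\<mu>)"
proof -
  note [measurable_cong] = P1_sets[OF \<mu>] and [measurable] = upd_meas[OF \<mu>]
  have "(\<integral>\<^sup>+ y. g y \<partial>\<Psi> \<mu>) = (\<integral>\<^sup>+ p. g (upd \<mu> (fst p) (snd p)) \<partial>(\<mu> \<Otimes>\<^sub>M \<theta>))"
    unfolding Psi_eq by (rule nn_integral_distr) measurable
  also have "\<dots> = (\<integral>\<^sup>+ x. \<integral>\<^sup>+ z. g (upd \<mu> x z) \<partial>\<theta> \<partial>\<mu>)"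
  proof -
    have "(\<lambda>p. upd \<mu> (fst p) (snd p)) \<in> borel_measurable (\<mu> \<Otimes>\<^sub>M \<theta>)" by measurable
    from measurable_compose[OF this g] show ?thesis
      by (subst theta.nn_integral_fst[symmetric]) simp_all
  qed
  finally show ?thesis .
qed

lemma prob_space_Psi:
  assumes \<mu>: "\<mu> \<in> P1"
  shows "prob_space (\<Psi> \<mu>)"
proof -
  interpret prob_space \<mu> using \<mu> by (rule P1_prob)
  have "(\<integral>\<^sup>+ y. 1 \<partial>\<Psi> \<mu>) = 1"
    using emeasure_space_1 theta.emeasure_space_1 by (subst nn_integral_Psi[OF \<mu>]) auto
  then show ?thesis by (intro prob_spaceI) simp
qed

lemma Psi_in_P1:
  assumes \<mu>: "\<mu> \<in> P1"
  shows "\<Psi> \<mu> \<in> P1"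
proof -
  interpret prob_space \<mu> using \<mu> by (rule P1_prob)
  note [measurable_cong] = P1_sets[OF \<mu>]
  define m where "m = enn2real (\<integral>\<^sup>+ x. ennreal (norm x) \<partial>\<mu>)"
  have m: "(\<integral>\<^sup>+ x. ennreal (norm x) \<partial>\<mu>) = ennreal m" using \<mu> by (simp add: m_def P1_iff less_top)
  have m0: "0 \<le> m" by (simp add: m_def)
  have "(\<integral>\<^sup>+ y. ennreal (norm y) \<partial>\<Psi> \<mu>) = (\<integral>\<^sup>+ x. \<integral>\<^sup>+ z. ennreal (norm (upd \<mu> x z)) \<partial>\<theta> \<partial>\<mu>)"
    by (rule nn_integral_Psi[OF \<mu>]) simp
  also have "\<dots> \<le> (\<integral>\<^sup>+ x. ennreal (c + \<delta> * \<sigma>) * ennreal (norm x) + ennreal (\<delta> * \<sigma> * m + \<delta> * (1 + c1)) \<partial>\<mu>)"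
    by (intro nn_integral_mono upd_first_moment[OF \<mu>]) (simp_all add: m m0)
  also have "\<dots> = ennreal (c + \<delta> * \<sigma>) * ennreal m + ennreal (\<delta> * \<sigma> * m + \<delta> * (1 + c1))"
    by (simp add: nn_integral_add nn_integral_cmult m emeasure_space_1)
  also have "\<dots> < \<infinity>" by (simp add: ennreal_mult_less_top)
  finally show ?thesis using prob_space_Psi[OF \<mu>] by (simp add: P1_iff)
qed

text \<open>Synchronous coupling: the positions are drawn from a near-optimal coupling and both
  updates use the same innovation. The position difference contributes the factor
  \<open>c + \<delta> * \<sigma>\<close>, and the distance of the measures inside \<open>f\<close>
  contributes another \<open>\<delta> * \<sigma>\<close>.\<close>

lemma Psi_contraction:
  assumes \<mu>: "\<mu> \<in> P1" and \<nu>: "\<nu> \<in> P1"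
  shows "wass (\<Psi> \<mu>) (\<Psi> \<nu>) \<le> ennreal \<gamma> * wass \<mu> \<nu>"
proof (rule ennreal_le_epsilon)
  fix e :: real assume e: "0 < e"
  note [measurable] = upd_meas[OF \<mu>] upd_meas[OF \<nu>]
  define w where "w = W1 \<mu> \<nu>"
  have w: "wass \<mu> \<nu> = ennreal w" "0 \<le> w" by (simp_all add: w_def ennreal_W1[OF \<mu> \<nu>])
  define k where "k = c + \<delta> * \<sigma>"
  \<comment> \<open>The bound by 1 keeps the slack \<open>e\<close> of the near-optimal coupling
    from being enlarged by the update.\<close>
  have k: "0 \<le> k" "k \<le> 1"
  proof -
    have "0 \<le> \<delta> * \<sigma>" using delta by simp
    then show "0 \<le> k" "k \<le> 1"
      using gamma_bounds(2) c_pos unfolding k_def \<gamma>_def mult.assoc by linarith+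
  qed
  have "wass \<mu> \<nu> < ennreal (w + e)" using w e by (simp add: ennreal_less_iff)
  then obtain \<pi> where \<pi>: "\<pi> \<in> couplings \<mu> \<nu>" "(\<integral>\<^sup>+ p. ennreal (dist (fst p) (snd p)) \<partial>\<pi>) < ennreal (w + e)"
    by (rule wass_less)
  have [measurable_cong]: "sets \<pi> = sets (borel \<Otimes>\<^sub>M borel)" and p: "prob_space \<pi>"
    and d: "distr \<pi> borel fst = \<mu>" "distr \<pi> borel snd = \<nu>" using \<pi> by (auto simp: couplings_def)
  interpret \<pi>: prob_space \<pi> by fact
  interpret P: pair_prob_space \<pi> \<theta> ..
  have um [measurable]: "(\<lambda>q. upd \<mu> (fst (fst q)) (snd q)) \<in> borel_measurable (\<pi> \<Otimes>\<^sub>M \<theta>)"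
    "(\<lambda>q. upd \<nu> (snd (fst q)) (snd q)) \<in> borel_measurable (\<pi> \<Otimes>\<^sub>M \<theta>)"
    using measurable_compose[OF _ upd_meas[OF \<mu>], of "\<lambda>q. (fst (fst q), snd q)" "\<pi> \<Otimes>\<^sub>M \<theta>"]
      measurable_compose[OF _ upd_meas[OF \<nu>], of "\<lambda>q. (snd (fst q), snd q)" "\<pi> \<Otimes>\<^sub>M \<theta>"]
    by simp_all
  define R where "R = distr (\<pi> \<Otimes>\<^sub>M \<theta>) (borel \<Otimes>\<^sub>M borel) (\<lambda>q. (upd \<mu> (fst (fst q)) (snd q), upd \<nu> (snd (fst q)) (snd q)))"
  have "distr R borel fst = \<Psi> \<mu>"
  proof (rule measure_eqI)
    fix B assume "B \<in> sets (distr R borel fst)"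
    then have [measurable]: "B \<in> sets borel" by simp
    have "distr R borel fst = distr (\<pi> \<Otimes>\<^sub>M \<theta>) borel (\<lambda>q. upd \<mu> (fst (fst q)) (snd q))"
      unfolding R_def by (subst distr_distr) (simp_all add: comp_def)
    then have "emeasure (distr R borel fst) B = (\<integral>\<^sup>+ y. indicator B y \<partial>distr (\<pi> \<Otimes>\<^sub>M \<theta>) borel (\<lambda>q. upd \<mu> (fst (fst q)) (snd q)))"
      by simp
    also have "\<dots> = (\<integral>\<^sup>+ q. indicator B (upd \<mu> (fst (fst q)) (snd q)) \<partial>(\<pi> \<Otimes>\<^sub>M \<theta>))"
      by (rule nn_integral_distr) measurable
    also have "\<dots> = (\<integral>\<^sup>+ p. \<integral>\<^sup>+ z. indicator B (upd \<mu> (fst p) z) \<partial>\<theta> \<partial>\<pi>)"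
      by (subst theta.nn_integral_fst[symmetric]) simp_all
    also have "\<dots> = (\<integral>\<^sup>+ x. \<integral>\<^sup>+ z. indicator B (upd \<mu> x z) \<partial>\<theta> \<partial>distr \<pi> borel fst)"
      by (subst nn_integral_distr) measurable
    also have "\<dots> = emeasure (\<Psi> \<mu>) B"
      unfolding d by (subst nn_integral_Psi[symmetric, OF \<mu>]) simp_all
    finally show "emeasure (distr R borel fst) B = emeasure (\<Psi> \<mu>) B" .
  qed simp
  moreover have "distr R borel snd = \<Psi> \<nu>"
  proof (rule measure_eqI)
    fix B assume "B \<in> sets (distr R borel snd)"
    then have [measurable]: "B \<in> sets borel" by simp
    have "distr R borel snd = distr (\<pi> \<Otimes>\<^sub>M \<theta>) borel (\<lambda>q. upd \<nu> (snd (fst q)) (snd q))"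
      unfolding R_def by (subst distr_distr) (simp_all add: comp_def)
    then have "emeasure (distr R borel snd) B = (\<integral>\<^sup>+ y. indicator B y \<partial>distr (\<pi> \<Otimes>\<^sub>M \<theta>) borel (\<lambda>q. upd \<nu> (snd (fst q)) (snd q)))"
      by simp
    also have "\<dots> = (\<integral>\<^sup>+ q. indicator B (upd \<nu> (snd (fst q)) (snd q)) \<partial>(\<pi> \<Otimes>\<^sub>M \<theta>))"
      by (rule nn_integral_distr) measurable
    also have "\<dots> = (\<integral>\<^sup>+ p. \<integral>\<^sup>+ z. indicator B (upd \<nu> (snd p) z) \<partial>\<theta> \<partial>\<pi>)"
      by (subst theta.nn_integral_fst[symmetric]) simp_all
    also have "\<dots> = (\<integral>\<^sup>+ x. \<integral>\<^sup>+ z. indicator B (upd \<nu> x z) \<partial>\<theta> \<partial>distr \<pi> borel snd)"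
      by (subst nn_integral_distr) measurable
    also have "\<dots> = emeasure (\<Psi> \<nu>) B"
      unfolding d by (subst nn_integral_Psi[symmetric, OF \<nu>]) simp_all
    finally show "emeasure (distr R borel snd) B = emeasure (\<Psi> \<nu>) B" .
  qed simp
  moreover have "prob_space R" unfolding R_def by (rule P.prob_space_distr) measurable
  ultimately have "R \<in> couplings (\<Psi> \<mu>) (\<Psi> \<nu>)" by (simp add: couplings_def R_def)
  then have "wass (\<Psi> \<mu>) (\<Psi> \<nu>) \<le> (\<integral>\<^sup>+ p. ennreal (dist (fst p) (snd p)) \<partial>R)" by (rule wass_le)
  also have "\<dots> = (\<integral>\<^sup>+ q. ennreal (dist (upd \<mu> (fst (fst q)) (snd q)) (upd \<nu> (snd (fst q)) (snd q))) \<partial>(\<pi> \<Otimes>\<^sub>M \<theta>))"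
    unfolding R_def by (subst nn_integral_distr) simp_all
  also have "\<dots> = (\<integral>\<^sup>+ p. \<integral>\<^sup>+ z. ennreal (dist (upd \<mu> (fst p) z) (upd \<nu> (snd p) z)) \<partial>\<theta> \<partial>\<pi>)"
    by (subst theta.nn_integral_fst[symmetric]) simp_all
  also have "\<dots> \<le> (\<integral>\<^sup>+ p. ennreal k * ennreal (dist (fst p) (snd p)) + ennreal (\<delta> * \<sigma> * w) \<partial>\<pi>)"
  proof (intro nn_integral_mono)
    fix p :: "(real^'d) \<times> (real^'d)"
    define x y where "x = fst p" and "y = snd p"
    note [measurable] = f_meas_section[OF \<mu>, of x] f_meas_section[OF \<nu>, of y]
    have "(\<integral>\<^sup>+ z. ennreal (dist (upd \<mu> x z) (upd \<nu> y z)) \<partial>\<theta>)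
       \<le> (\<integral>\<^sup>+ z. ennreal (c * norm (x - y)) + ennreal \<delta> * ennreal (norm (f x \<mu> z - f y \<nu> z)) \<partial>\<theta>)"
    proof (intro nn_integral_mono)
      fix z
      have "upd \<mu> x z - upd \<nu> y z = A *v (x - y) + \<delta> *\<^sub>R (f x \<mu> z - f y \<nu> z)"
        by (simp add: upd_def matrix_vector_mult_diff_distrib scaleR_diff_right)
      then have "dist (upd \<mu> x z) (upd \<nu> y z) \<le> norm (A *v (x - y)) + norm (\<delta> *\<^sub>R (f x \<mu> z - f y \<nu> z))"
        unfolding dist_norm by (metis norm_triangle_ineq)
      also have "\<dots> \<le> c * norm (x - y) + \<delta> * norm (f x \<mu> z - f y \<nu> z)"
        using norm_A[of "x - y"] delta by simp
      finally show "ennreal (dist (upd \<mu> x z) (upd \<nu> y z)) \<le> ennreal (c * norm (x - y)) + ennreal \<delta> * ennreal (norm (f x \<mu> z - f y \<nu> z))"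
        using c_pos delta by (simp add: ennreal_plus[symmetric] ennreal_mult[symmetric] del: ennreal_plus)
    qed
    also have "\<dots> = ennreal (c * norm (x - y)) + ennreal \<delta> * (\<integral>\<^sup>+ z. ennreal (norm (f x \<mu> z - f y \<nu> z)) \<partial>\<theta>)"
      by (simp add: nn_integral_add nn_integral_cmult theta.emeasure_space_1[simplified])
    also have "\<dots> \<le> ennreal (c * norm (x - y)) + ennreal \<delta> * (ennreal \<sigma> * ennreal (norm (x - y) + W1 \<mu> \<nu>))"
      by (intro add_mono mult_left_mono f_lipschitz \<mu> \<nu>) simp_all
    also have "\<dots> = ennreal (k * dist x y + \<delta> * \<sigma> * w)"
      using c_pos delta by (simp add: ennreal_plus[symmetric] ennreal_mult[symmetric] k_def w_def dist_norm algebra_simps del: ennreal_plus)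
    also have "\<dots> = ennreal k * ennreal (dist x y) + ennreal (\<delta> * \<sigma> * w)"
      using k w delta by (simp add: ennreal_plus ennreal_mult)
    finally show "(\<integral>\<^sup>+ z. ennreal (dist (upd \<mu> (fst p) z) (upd \<nu> (snd p) z)) \<partial>\<theta>)
        \<le> ennreal k * ennreal (dist (fst p) (snd p)) + ennreal (\<delta> * \<sigma> * w)" by (simp add: x_def y_def)
  qed
  also have "\<dots> = ennreal k * (\<integral>\<^sup>+ p. ennreal (dist (fst p) (snd p)) \<partial>\<pi>) + ennreal (\<delta> * \<sigma> * w)"
    by (simp add: nn_integral_add nn_integral_cmult \<pi>.emeasure_space_1)
  also have "\<dots> \<le> ennreal k * ennreal (w + e) + ennreal (\<delta> * \<sigma> * w)"
    using \<pi>(2) by (intro add_mono mult_left_mono) auto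
  also have "\<dots> = ennreal (k * (w + e) + \<delta> * \<sigma> * w)"
    using k w e delta by (simp add: ennreal_mult ennreal_plus)
  also have "\<dots> \<le> ennreal (\<gamma> * w + e)"
  proof (rule ennreal_leI)
    have "k * e \<le> 1 * e" using k e by (intro mult_right_mono) auto
    then show "k * (w + e) + \<delta> * \<sigma> * w \<le> \<gamma> * w + e" by (simp add: k_def \<gamma>_def algebra_simps)
  qed
  also have "\<dots> = ennreal \<gamma> * wass \<mu> \<nu> + ennreal e"
    using gamma_bounds w e by (simp add: ennreal_plus ennreal_mult)
  finally show "wass (\<Psi> \<mu>) (\<Psi> \<nu>) \<le> ennreal \<gamma> * wass \<mu> \<nu> + ennreal e" .
qed

end

section \<open>The one-step error\<close>

lemma tail_le_powr:
  assumes "0 < R" "0 < b"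
  shows "tail R y \<le> R powr (- b) * norm y powr (1 + b)"
proof (cases "R < norm y")
  case True
  have "R powr b \<le> norm y powr b" using True assms by (intro powr_mono2) auto
  then have "norm y * R powr b \<le> norm y powr (1 + b)"
    using powr_mult_base[of "norm y" b] by (metis mult_left_mono norm_ge_zero)
  then show ?thesis using True assms by (simp add: tail_def powr_minus field_simps)
qed (simp add: tail_def)

lemma empirical_cong: "(\<And>i. 1 \<le> i \<Longrightarrow> i \<le> N \<Longrightarrow> x i = y i) \<Longrightarrow> empirical N x = empirical N y"
  unfolding empirical_def by (intro distr_cong) (simp_all add: uniform_count_measure_def space_point_measure)

context mean_field begin

abbreviation "pos_space N \<equiv> Pi\<^sub>M {1..N::nat} (\<lambda>_. borel :: (real^'d) measure)"
abbreviation "noise N \<equiv> Pi\<^sub>M {1..N::nat} (\<lambda>_. \<theta>)"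

text \<open>The restriction to \<open>{1..N}\<close> makes the result extensional, as points of a
  product space must be.\<close>

definition step :: "nat \<Rightarrow> (nat \<Rightarrow> real^'d) \<Rightarrow> (nat \<Rightarrow> real^'m) \<Rightarrow> nat \<Rightarrow> real^'d" where
  "step N x z = (\<lambda>i\<in>{1..N}. upd (empirical N x) (x i) (z i))"

lemma prob_space_noise: "prob_space (noise N)"
  by (rule prob_space_PiM) (rule theta)

lemma sets_noise: "sets (noise N) = sets (Pi\<^sub>M {1..N} (\<lambda>_. borel))"
  by (intro sets_PiM_cong) (simp_all add: sets_theta)

lemma pos_component_meas: "i \<in> {1..N} \<Longrightarrow> (\<lambda>x. x i) \<in> measurable (pos_space N) borel"
  by (rule measurable_component_singleton)

lemma noise_component_meas: "i \<in> {1..N} \<Longrightarrow> (\<lambda>z. z i) \<in> measurable (noise N) borel"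
  using measurable_component_singleton[of i "{1..N}" "\<lambda>_. \<theta>"]
  by (simp only: measurable_cong_sets[OF refl sets_theta])

lemma upd_empirical_meas:
  assumes "1 \<le> i" "i \<le> N"
  shows "(\<lambda>p. upd (empirical N (fst p)) (fst p i) (snd p)) \<in> borel_measurable (pos_space N \<Otimes>\<^sub>M borel)"
proof -
  have N: "1 \<le> N" and i: "i \<in> {1..N}" using assms by auto
  note [measurable] = measurable_compose[OF measurable_fst measurable_empirical[OF N]]
    measurable_compose[OF measurable_fst pos_component_meas[OF i]]
  have "(\<lambda>p. ((fst p i, empirical N (fst p)), snd p)) \<in> measurable (pos_space N \<Otimes>\<^sub>M borel)
     ((borel \<Otimes>\<^sub>M restrict_space (subprob_algebra borel) P1) \<Otimes>\<^sub>M borel)"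
    by measurable
  from measurable_compose[OF this f_meas]
  have "(\<lambda>p. f (fst p i) (empirical N (fst p)) (snd p)) \<in> borel_measurable (pos_space N \<Otimes>\<^sub>M borel)"
    by (simp only: case_prod_conv)
  then show ?thesis unfolding upd_def by measurable
qed

lemma step_meas:
  "(\<lambda>p. step N (fst p) (snd p)) \<in> measurable (pos_space N \<Otimes>\<^sub>M noise N) (pos_space N)"
  unfolding step_def
proof (rule measurable_restrict)
  fix i assume i: "i \<in> {1..N}"
  note [measurable] = measurable_compose[OF measurable_snd noise_component_meas[OF i]]
  have "(\<lambda>p. (fst p, snd p i)) \<in> measurable (pos_space N \<Otimes>\<^sub>M noise N) (pos_space N \<Otimes>\<^sub>M borel)"
    by measurable
  from measurable_compose[OF this upd_empirical_meas[of i N]] i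
  show "(\<lambda>p. upd (empirical N (fst p)) (fst p i) (snd p i)) \<in> borel_measurable (pos_space N \<Otimes>\<^sub>M noise N)"
    by (simp only: fst_conv snd_conv atLeastAtMost_iff)
qed

lemma nn_integral_noise_component:
  assumes i: "i \<in> {1..N}" and h: "h \<in> borel_measurable borel"
  shows "(\<integral>\<^sup>+ z. h (z i) \<partial>noise N) = (\<integral>\<^sup>+ z. h z \<partial>\<theta>)"
proof -
  have "(\<integral>\<^sup>+ z. h z \<partial>\<theta>) = (\<integral>\<^sup>+ z. h z \<partial>distr (noise N) \<theta> (\<lambda>z. z i))"
    using distr_PiM_component[of "{1..N}" "\<lambda>_. \<theta>" i] i theta by simp
  also have "\<dots> = (\<integral>\<^sup>+ z. h (z i) \<partial>noise N)"
    using h by (intro nn_integral_distr measurable_component_singleton i) (simp add: measurable_cong_sets[OF sets_theta refl])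
  finally show ?thesis by simp
qed

lemma nn_integral_Psi_empirical:
  assumes N: "1 \<le> N" and g[measurable]: "g \<in> borel_measurable borel"
  shows "(\<integral>\<^sup>+ y. g y \<partial>\<Psi> (empirical N x))
     = ennreal (1 / real N) * (\<Sum>i=1..N. \<integral>\<^sup>+ z. g (upd (empirical N x) (x i) z) \<partial>\<theta>)"
proof -
  note P = empirical_in_P1[OF N, of x]
  have "(\<lambda>p. g (upd (empirical N x) (fst p) (snd p))) \<in> borel_measurable (borel \<Otimes>\<^sub>M \<theta>)"
  proof -
    have "(\<lambda>p. g (upd (empirical N x) (fst p) (snd p))) \<in> borel_measurable (borel \<Otimes>\<^sub>M borel)"
      by (rule measurable_compose[OF upd_meas[OF P] g])
    then show ?thesis
      by (subst measurable_cong_sets[OF sets_pair_measure_cong[OF refl sets_theta] refl])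
  qed
  from theta.borel_measurable_nn_integral_fst[OF this]
  have "(\<lambda>y. \<integral>\<^sup>+ z. g (upd (empirical N x) y z) \<partial>\<theta>) \<in> borel_measurable borel" by simp
  then show ?thesis
    using nn_integral_Psi[OF P g] N by (simp add: nn_integral_empirical)
qed

text \<open>Linearity of the integral together with the fact that each coordinate of the noise has
  law \<open>\<theta>\<close>. It is used to move tails and moments between the new empirical
  measure and \<open>\<Psi>\<close> of the old one.\<close>

lemma nn_integral_step:
  assumes N: "1 \<le> N" and g[measurable]: "g \<in> borel_measurable borel"
  shows "(\<integral>\<^sup>+ z. (\<integral>\<^sup>+ y. g y \<partial>empirical N (step N x z)) \<partial>noise N) = (\<integral>\<^sup>+ y. g y \<partial>\<Psi> (empirical N x))"
proof -
  have m: "(\<lambda>z. g (upd (empirical N x) (x i) z)) \<in> borel_measurable borel" for i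
    by (rule measurable_compose[OF upd_meas_section[OF empirical_in_P1[OF N]] g])
  have m': "(\<lambda>z. g (upd (empirical N x) (x i) (z i))) \<in> borel_measurable (noise N)" if "i \<in> {1..N}" for i
  proof -
    show ?thesis by (rule measurable_compose[OF noise_component_meas[OF that] m])
  qed
  have "(\<integral>\<^sup>+ z. (\<integral>\<^sup>+ y. g y \<partial>empirical N (step N x z)) \<partial>noise N)
     = (\<integral>\<^sup>+ z. ennreal (1 / real N) * (\<Sum>i=1..N. g (upd (empirical N x) (x i) (z i))) \<partial>noise N)"
    using N by (simp add: nn_integral_empirical step_def)
  also have "\<dots> = ennreal (1 / real N) * (\<Sum>i=1..N. \<integral>\<^sup>+ z. g (upd (empirical N x) (x i) (z i)) \<partial>noise N)"
  proof -
    have "(\<integral>\<^sup>+ z. (\<Sum>i=1..N. g (upd (empirical N x) (x i) (z i))) \<partial>noise N)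
       = (\<Sum>i=1..N. \<integral>\<^sup>+ z. g (upd (empirical N x) (x i) (z i)) \<partial>noise N)"
      by (rule nn_integral_sum) (rule m')
    then show ?thesis
      by (subst nn_integral_cmult) (intro borel_measurable_sum m', simp_all only:)
  qed
  also have "\<dots> = (\<integral>\<^sup>+ y. g y \<partial>\<Psi> (empirical N x))"
    unfolding nn_integral_Psi_empirical[OF N g]
    by (intro arg_cong2[where f="(*)"] sum.cong refl nn_integral_noise_component m)
  finally show ?thesis .
qed

lemma measurable_indicator_upd:
  assumes \<mu>: "\<mu> \<in> P1" and B[measurable]: "B \<in> sets borel"
  shows "(\<lambda>z. indicator B (upd \<mu> x z) :: real) \<in> borel_measurable \<theta>"
proof -
  note [measurable] = upd_meas_section[OF \<mu>, of x]
  show ?thesis by measurable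
qed

lemma measure_Psi_empirical:
  assumes N: "1 \<le> N" and B[measurable]: "B \<in> sets borel"
  shows "measure (\<Psi> (empirical N x)) B = (\<Sum>i=1..N. \<integral>z. indicator B (upd (empirical N x) (x i) z) \<partial>\<theta>) / real N"
proof -
  note P = empirical_in_P1[OF N, of x]
  note m = measurable_indicator_upd[OF P B]
  have "emeasure (\<Psi> (empirical N x)) B = (\<integral>\<^sup>+ y. indicator B y \<partial>\<Psi> (empirical N x))" by simp
  also have "\<dots> = ennreal (1 / real N) * (\<Sum>i=1..N. \<integral>\<^sup>+ z. ennreal (indicator B (upd (empirical N x) (x i) z)) \<partial>\<theta>)"
    by (subst nn_integral_Psi_empirical[OF N]) (simp_all add: ennreal_indicator)
  also have "(\<lambda>i. \<integral>\<^sup>+ z. ennreal (indicator B (upd (empirical N x) (x i) z)) \<partial>\<theta>)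
     = (\<lambda>i. ennreal (\<integral>z. indicator B (upd (empirical N x) (x i) z) \<partial>\<theta>))"
    using m by (intro ext nn_integral_eq_integral theta.integrable_const_bound[of _ 1]) auto
  also have "ennreal (1 / real N) * (\<Sum>i=1..N. ennreal (\<integral>z. indicator B (upd (empirical N x) (x i) z) \<partial>\<theta>))
     = ennreal ((\<Sum>i=1..N. \<integral>z. indicator B (upd (empirical N x) (x i) z) \<partial>\<theta>) / real N)"
    by (simp add: ennreal_mult[symmetric] sum_nonneg)
  finally show ?thesis by (simp add: measure_def sum_nonneg)
qed

text \<open>For fixed positions \<open>x\<close> the indicator of particle \<open>i\<close> being in
  \<open>B\<close> depends on coordinate \<open>i\<close> of the noise alone, and the means of these
  indicators average to the mass under \<open>\<Psi>\<close>. The deviation of their sum is of order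
  \<open>sqrt N\<close>, to be divided by \<open>N\<close>.\<close>

lemma step_deviation:
  assumes N: "1 \<le> N" and B[measurable]: "B \<in> sets borel"
  shows "(\<integral>\<^sup>+ z. ennreal \<bar>measure (empirical N (step N x z)) B - measure (\<Psi> (empirical N x)) B\<bar> \<partial>noise N)
     \<le> ennreal (1 / sqrt (real N))"
proof -
  note P = empirical_in_P1[OF N, of x]
  define h where "h i z = (indicator B (upd (empirical N x) (x i) z) :: real)" for i z
  have hm: "h i \<in> borel_measurable \<theta>" for i
    unfolding h_def by (rule measurable_indicator_upd[OF P B])
  have "measure (empirical N (step N x z)) B = (\<Sum>i=1..N. h i (z i)) / real N" for z
    using N emeasure_empirical[OF N B, of "step N x z"]
    by (simp add: measure_def sum_nonneg step_def h_def)
  then have eq: "measure (empirical N (step N x z)) B - measure (\<Psi> (empirical N x)) B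
     = (1 / real N) * (\<Sum>i=1..N. h i (z i) - theta.expectation (h i))" for z
    unfolding measure_Psi_empirical[OF N B] by (simp add: h_def[abs_def] sum_subtractf diff_divide_distrib)
  have [measurable]: "(\<lambda>z. \<Sum>i=1..N. h i (z i) - theta.expectation (h i)) \<in> borel_measurable (noise N)"
  proof -
    have [measurable]: "h i \<in> borel_measurable borel" for i
      using hm[of i] by (simp only: measurable_cong_sets[OF sets_theta refl])
    have "(\<lambda>z. h i (z i)) \<in> borel_measurable (noise N)" if "i \<in> {1..N}" for i
      by (rule measurable_compose[OF noise_component_meas[OF that]]) measurable
    then show ?thesis by (intro borel_measurable_sum borel_measurable_diff borel_measurable_const)
  qed
  have "(\<integral>\<^sup>+ z. ennreal \<bar>measure (empirical N (step N x z)) B - measure (\<Psi> (empirical N x)) B\<bar> \<partial>noise N)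
     = (\<integral>\<^sup>+ z. ennreal (1 / real N) * ennreal \<bar>\<Sum>i=1..N. h i (z i) - theta.expectation (h i)\<bar> \<partial>noise N)"
    unfolding eq by (simp add: abs_mult ennreal_mult[symmetric])
  also have "\<dots> = ennreal (1 / real N) * (\<integral>\<^sup>+ z. ennreal \<bar>\<Sum>i=1..N. h i (z i) - theta.expectation (h i)\<bar> \<partial>noise N)"
    by (rule nn_integral_cmult) measurable
  also have "\<dots> \<le> ennreal (1 / real N) * ennreal (sqrt (card {1..N}))"
    by (intro mult_left_mono theta.product_average_deviation) (use N hm in \<open>auto simp: h_def[abs_def]\<close>)
  also have "\<dots> = ennreal (1 / sqrt (real N))"
    using N by (simp add: ennreal_mult[symmetric] real_div_sqrt field_simps)
  finally show ?thesis .
qed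

lemma measurable_Psi_empirical:
  assumes N: "1 \<le> N"
  shows "(\<lambda>x. \<Psi> (empirical N x)) \<in> measurable (pos_space N) (subprob_algebra borel)"
proof (rule measurable_subprob_algebra)
  fix x :: "nat \<Rightarrow> real^'d"
  show "subprob_space (\<Psi> (empirical N x))"
    by (intro prob_space_imp_subprob_space prob_space_Psi empirical_in_P1 N)
next
  fix B :: "(real^'d) set" assume B: "B \<in> sets borel"
  then have g: "indicator B \<in> borel_measurable borel" by simp
  have "(\<lambda>x. \<integral>\<^sup>+ z. indicator B (upd (empirical N x) (x i) z) \<partial>\<theta>) \<in> borel_measurable (pos_space N)" if "i \<in> {1..N}" for i
  proof -
    have "(\<lambda>p. indicator B (upd (empirical N (fst p)) (fst p i) (snd p)) :: ennreal) \<in> borel_measurable (pos_space N \<Otimes>\<^sub>M borel)"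
      using that by (intro measurable_compose[OF upd_empirical_meas g]) auto
    then have "(\<lambda>p. indicator B (upd (empirical N (fst p)) (fst p i) (snd p)) :: ennreal) \<in> borel_measurable (pos_space N \<Otimes>\<^sub>M \<theta>)"
      by (subst measurable_cong_sets[OF sets_pair_measure_cong[OF refl sets_theta] refl])
    from theta.borel_measurable_nn_integral_fst[OF this] show ?thesis by simp
  qed
  then have "(\<lambda>x. ennreal (1 / real N) * (\<Sum>i=1..N. \<integral>\<^sup>+ z. indicator B (upd (empirical N x) (x i) z) \<partial>\<theta>)) \<in> borel_measurable (pos_space N)"
    by (intro borel_measurable_times_ennreal borel_measurable_sum borel_measurable_const) auto
  then show "(\<lambda>x. emeasure (\<Psi> (empirical N x)) B) \<in> borel_measurable (pos_space N)"
    using nn_integral_Psi_empirical[OF N g] B by simp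
qed simp

text \<open>The bound of \<open>wass_le_partition\<close> for the two measures compared in one step.
  Being a finite combination of masses and integrals, it is jointly measurable in positions and
  noise, so Fubini's theorem applies to it.\<close>

definition err :: "nat \<Rightarrow> (real^'d \<Rightarrow> nat) \<Rightarrow> nat \<Rightarrow> real \<Rightarrow> real \<Rightarrow> (nat \<Rightarrow> real^'d) \<Rightarrow> (nat \<Rightarrow> real^'m) \<Rightarrow> ennreal" where
  "err N q K R \<eta> x z = ennreal \<eta>
     + (2 * (\<integral>\<^sup>+ y. ennreal (tail R y) \<partial>empirical N (step N x z)) + 2 * (\<integral>\<^sup>+ y. ennreal (tail R y) \<partial>\<Psi> (empirical N x)))
     + ennreal (2 * R) * ennreal (\<Sum>k\<le>K. \<bar>measure (empirical N (step N x z)) (q -` {k}) - measure (\<Psi> (empirical N x)) (q -` {k})\<bar>)"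

lemma measurable_empirical_step:
  assumes N: "1 \<le> N"
  shows "(\<lambda>p. empirical N (step N (fst p) (snd p))) \<in> measurable (pos_space N \<Otimes>\<^sub>M noise N) (subprob_algebra borel)"
proof -
  have "empirical N \<in> measurable (pos_space N) (subprob_algebra borel)"
    using measurable_empirical[OF N] unfolding measurable_restrict_space2_iff by (rule conjunct1)
  from measurable_compose[OF step_meas this] show ?thesis .
qed

lemma err_meas:
  assumes N: "1 \<le> N" and q[measurable]: "q \<in> measurable borel (count_space UNIV)"
  shows "(\<lambda>p. err N q K R \<eta> (fst p) (snd p)) \<in> borel_measurable (pos_space N \<Otimes>\<^sub>M noise N)"
proof -
  note [measurable] = measurable_empirical_step[OF N] measurable_compose[OF measurable_fst measurable_Psi_empirical[OF N]]
  have [measurable]: "q -` {k} \<in> sets borel" for k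
    using measurable_sets[OF q, of "{k}"] by simp
  have 1: "(\<lambda>p. \<integral>\<^sup>+ y. ennreal (tail R y) \<partial>empirical N (step N (fst p) (snd p))) \<in> borel_measurable (pos_space N \<Otimes>\<^sub>M noise N)"
    by (rule measurable_compose[OF measurable_empirical_step[OF N] nn_integral_measurable_subprob_algebra]) simp
  have 2: "(\<lambda>p. \<integral>\<^sup>+ y. ennreal (tail R y) \<partial>\<Psi> (empirical N (fst p))) \<in> borel_measurable (pos_space N \<Otimes>\<^sub>M noise N)"
    by (rule measurable_compose[OF measurable_compose[OF measurable_fst measurable_Psi_empirical[OF N]] nn_integral_measurable_subprob_algebra]) simp
  have 3: "(\<lambda>p. measure (empirical N (step N (fst p) (snd p))) (q -` {k})) \<in> borel_measurable (pos_space N \<Otimes>\<^sub>M noise N)" for k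
    unfolding measure_def
    by (rule measurable_compose[OF measurable_compose[OF measurable_empirical_step[OF N] measurable_emeasure_subprob_algebra]]) simp_all
  have 4: "(\<lambda>p. measure (\<Psi> (empirical N (fst p))) (q -` {k})) \<in> borel_measurable (pos_space N \<Otimes>\<^sub>M noise N)" for k
    unfolding measure_def
    by (rule measurable_compose[OF measurable_compose[OF measurable_compose[OF measurable_fst measurable_Psi_empirical[OF N]] measurable_emeasure_subprob_algebra]]) simp_all
  note [measurable] = 1 2 3 4
  show ?thesis unfolding err_def by measurable
qed

lemma wass_step_le_err:
  assumes N: "1 \<le> N" and q: "q \<in> measurable borel (count_space UNIV)" "\<And>x. q x \<le> K"
    "\<And>x y. q x = q y \<Longrightarrow> norm x \<le> R \<Longrightarrow> norm y \<le> R \<Longrightarrow> dist x y \<le> \<eta>" and "0 \<le> \<eta>" "0 \<le> R"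
  shows "wass (empirical N (step N x z)) (\<Psi> (empirical N x)) \<le> err N q K R \<eta> x z"
  unfolding err_def using assms
  by (intro wass_le_partition prob_space_empirical prob_space_Psi empirical_in_P1) simp_all

text \<open>The tail of the new empirical measure has the tail under \<open>\<Psi>\<close> as its
  mean, so the two tail terms merge into one with factor 4; each of the \<open>K + 1\<close> cells
  costs at most \<open>1 / sqrt N\<close>.\<close>

lemma nn_integral_err:
  assumes N: "1 \<le> N" and q[measurable]: "q \<in> measurable borel (count_space UNIV)" and R: "0 < R" and \<eta>: "0 \<le> \<eta>"
    and x: "x \<in> space (pos_space N)"
  shows "(\<integral>\<^sup>+ z. err N q K R \<eta> x z \<partial>noise N)
    \<le> ennreal \<eta> + 4 * (\<integral>\<^sup>+ y. ennreal (tail R y) \<partial>\<Psi> (empirical N x)) + ennreal (2 * R * (K + 1) / sqrt N)"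
proof -
  interpret Z: prob_space "noise N" by (rule prob_space_noise)
  have B: "q -` {k} \<in> sets borel" for k
    using measurable_sets[OF q, of "{k}"] by simp
  have m1[measurable]: "(\<lambda>z. \<integral>\<^sup>+ y. ennreal (tail R y) \<partial>empirical N (step N x z)) \<in> borel_measurable (noise N)"
    using measurable_compose[OF measurable_compose[OF measurable_Pair1'[OF x] measurable_empirical_step[OF N]] nn_integral_measurable_subprob_algebra]
    by simp
  have m2[measurable]: "(\<lambda>z. measure (empirical N (step N x z)) (q -` {k})) \<in> borel_measurable (noise N)" for k
    unfolding measure_def
    using measurable_compose[OF measurable_compose[OF measurable_Pair1'[OF x] measurable_empirical_step[OF N]] measurable_emeasure_subprob_algebra[OF B]]
    by simp
  define T where "T z = (\<integral>\<^sup>+ y. ennreal (tail R y) \<partial>empirical N (step N x z))" for z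
  define \<tau> where "\<tau> = (\<integral>\<^sup>+ y. ennreal (tail R y) \<partial>\<Psi> (empirical N x))"
  define D where "D k z = ennreal \<bar>measure (empirical N (step N x z)) (q -` {k}) - measure (\<Psi> (empirical N x)) (q -` {k})\<bar>" for k z
  have Tm [measurable]: "T \<in> borel_measurable (noise N)" unfolding T_def by (rule m1)
  have Dm [measurable]: "D k \<in> borel_measurable (noise N)" for k
    unfolding D_def using m2[of k] by measurable
  have "err N q K R \<eta> x z = ennreal \<eta> + (2 * T z + 2 * \<tau>) + ennreal (2 * R) * (\<Sum>k\<le>K. D k z)" for z
    by (simp add: err_def T_def \<tau>_def D_def)
  then have "(\<integral>\<^sup>+ z. err N q K R \<eta> x z \<partial>noise N) = ennreal \<eta> + (2 * (\<integral>\<^sup>+ z. T z \<partial>noise N) + 2 * \<tau>)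
     + ennreal (2 * R) * (\<Sum>k\<le>K. \<integral>\<^sup>+ z. D k z \<partial>noise N)"
    by (simp add: nn_integral_add nn_integral_cmult nn_integral_sum Z.emeasure_space_1 del: One_nat_def)
  also have "\<dots> \<le> ennreal \<eta>
     + (2 * (\<integral>\<^sup>+ y. ennreal (tail R y) \<partial>\<Psi> (empirical N x)) + 2 * (\<integral>\<^sup>+ y. ennreal (tail R y) \<partial>\<Psi> (empirical N x)))
     + ennreal (2 * R) * (\<Sum>k\<le>K. ennreal (1 / sqrt (real N)))"
    unfolding T_def \<tau>_def D_def using N
    by (intro add_mono mult_left_mono sum_mono step_deviation B order_refl)
      (simp_all add: nn_integral_step del: One_nat_def)
  also have "ennreal (2 * R) * (\<Sum>k\<le>K. ennreal (1 / sqrt (real N))) = ennreal (2 * R * (K + 1) / sqrt N)"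
  proof -
    have "(\<Sum>k\<le>K. ennreal (1 / sqrt (real N))) = ennreal ((K + 1) * (1 / sqrt N))"
      by (subst sum_ennreal) simp_all
    then show ?thesis using R by (simp only:) (simp add: ennreal_mult[symmetric])
  qed
  finally show ?thesis by (simp add: algebra_simps flip: mult_2 distrib_right) 
qed

text \<open>The update bound is averaged over the particles with \<open>m\<close> the mean norm.
  Jensen's inequality bounds \<open>m powr p\<close> by the empirical moment itself, so the
  coefficients of the position term and the measure term add up to
  \<open>\<gamma> + 2 * s * Cw\<close>.\<close>

lemma Psi_empirical_moment:
  assumes N: "1 \<le> N" and s: "0 < s" "s \<le> 1"
  shows "(\<integral>\<^sup>+ y. ennreal (norm y powr (1 + s * \<alpha>)) \<partial>\<Psi> (empirical N x))
    \<le> ennreal (\<gamma> + 2 * s * Cw) * (\<integral>\<^sup>+ y. ennreal (norm y powr (1 + s * \<alpha>)) \<partial>empirical N x) + ennreal (\<delta> * (1 + c1) + s * Cw)"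
proof -
  define p where "p = 1 + s * \<alpha>"
  have p: "1 < p" using s alpha by (simp add: p_def)
  define m where "m = (1 / real N) * (\<Sum>i=1..N. norm (x i))"
  have m: "(\<integral>\<^sup>+ y. ennreal (norm y) \<partial>empirical N x) \<le> ennreal m" "0 \<le> m"
    using N by (simp_all add: m_def nn_integral_empirical_real sum_nonneg)
  define a where "a = (1 / real N) * (\<Sum>i=1..N. norm (x i) powr p)"
  have a: "0 \<le> a" by (simp add: a_def sum_nonneg)
  have a': "(\<integral>\<^sup>+ y. ennreal (norm y powr p) \<partial>empirical N x) = ennreal a"
    using N unfolding a_def by (intro nn_integral_empirical_real) simp_all
  have ma: "m powr p \<le> a"
    using powr_weighted_sum_le[of "{1..N}" "\<lambda>_. 1 / real N" "\<lambda>i. norm (x i)" p] p N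
    by (simp add: m_def a_def sum_divide_distrib)
  define k1 where "k1 = c + \<delta> * \<sigma> + s * Cw"
  define k2 where "k2 = \<delta> * \<sigma> + s * Cw"
  define k3 where "k3 = \<delta> * (1 + c1) + s * Cw"
  have k: "0 \<le> k1" "0 \<le> k2" "0 \<le> k3"
    using c_pos delta s Cw_nonneg by (simp_all add: k1_def k2_def k3_def)
  have "(\<integral>\<^sup>+ y. ennreal (norm y powr p) \<partial>\<Psi> (empirical N x))
    = ennreal (1 / real N) * (\<Sum>i=1..N. \<integral>\<^sup>+ z. ennreal (norm (upd (empirical N x) (x i) z) powr p) \<partial>\<theta>)"
    by (rule nn_integral_Psi_empirical[OF N]) simp
  also have "\<dots> \<le> ennreal (1 / real N) * (\<Sum>i=1..N. ennreal (k1 * norm (x i) powr p + k2 * m powr p + k3))"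
    unfolding p_def k1_def k2_def k3_def
    by (intro mult_left_mono sum_mono upd_moment empirical_in_P1 N m s) simp
  also have "\<dots> = ennreal ((1 / real N) * (\<Sum>i=1..N. k1 * norm (x i) powr p + k2 * m powr p + k3))"
    using k by (subst sum_ennreal, simp, subst ennreal_mult[symmetric]) (simp_all add: sum_nonneg)
  also have "(1 / real N) * (\<Sum>i=1..N. k1 * norm (x i) powr p + k2 * m powr p + k3) = k1 * a + k2 * m powr p + k3"
    using N by (simp add: a_def sum.distrib sum_distrib_left[symmetric] field_simps)
  also have "ennreal (k1 * a + k2 * m powr p + k3) \<le> ennreal ((k1 + k2) * a + k3)"
    using mult_left_mono[OF ma k(2)] by (intro ennreal_leI) (simp add: algebra_simps)
  also have "\<dots> = ennreal (k1 + k2) * ennreal a + ennreal k3"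
    using k a by (simp add: ennreal_mult)
  also have "k1 + k2 = \<gamma> + 2 * s * Cw" by (simp add: k1_def k2_def \<gamma>_def)
  finally show ?thesis by (simp add: a' p_def[symmetric] k3_def)
qed

end

section \<open>Independence of positions and innovations\<close>

lemma (in prob_space) distr_pair_compose:
  assumes X: "X \<in> measurable M S" and Y: "Y \<in> measurable M T"
    and law: "distr M (S \<Otimes>\<^sub>M T) (\<lambda>w. (X w, Y w)) = distr M S X \<Otimes>\<^sub>M distr M T Y"
    and \<phi>: "\<phi> \<in> measurable S S'" and \<psi>: "\<psi> \<in> measurable T T'"
  shows "distr M (S' \<Otimes>\<^sub>M T') (\<lambda>w. (\<phi> (X w), \<psi> (Y w)))
    = distr M S' (\<lambda>w. \<phi> (X w)) \<Otimes>\<^sub>M distr M T' (\<lambda>w. \<psi> (Y w))"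
proof -
  have [measurable]: "\<phi> \<in> measurable (distr M S X) S'" "\<psi> \<in> measurable (distr M T Y) T'"
    using \<phi> \<psi> by simp_all
  interpret T': prob_space "distr (distr M T Y) T' \<psi>"
    by (intro prob_space.prob_space_distr[OF prob_space_distr] Y) measurable
  have "distr M S' (\<lambda>w. \<phi> (X w)) = distr (distr M S X) S' \<phi>" "distr M T' (\<lambda>w. \<psi> (Y w)) = distr (distr M T Y) T' \<psi>"
    using X Y \<phi> \<psi> by (simp_all add: distr_distr comp_def)
  then have "distr M S' (\<lambda>w. \<phi> (X w)) \<Otimes>\<^sub>M distr M T' (\<lambda>w. \<psi> (Y w))
     = distr (distr M S X \<Otimes>\<^sub>M distr M T Y) (S' \<Otimes>\<^sub>M T') (\<lambda>(x, y). (\<phi> x, \<psi> y))"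
    using pair_measure_distr[of \<phi> "distr M S X" S' \<psi> "distr M T Y" T'] T'.sigma_finite_measure_axioms
    by simp
  also have "\<dots> = distr M (S' \<Otimes>\<^sub>M T') ((\<lambda>(x, y). (\<phi> x, \<psi> y)) \<circ> (\<lambda>w. (X w, Y w)))"
    unfolding law[symmetric] using X Y \<phi> \<psi> by (intro distr_distr) measurable
  finally show ?thesis by (simp add: comp_def)
qed

lemma (in prob_space) distr_pair_of_indep_set:
  assumes X[measurable]: "X \<in> measurable M S" and Y[measurable]: "Y \<in> measurable M T"
    and ind: "indep_set {X -` A \<inter> space M | A. A \<in> sets S} {Y -` B \<inter> space M | B. B \<in> sets T}"
  shows "distr M (S \<Otimes>\<^sub>M T) (\<lambda>w. (X w, Y w)) = distr M S X \<Otimes>\<^sub>M distr M T Y"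
proof (rule pair_measure_eqI[symmetric])
  show "sigma_finite_measure (distr M S X)" "sigma_finite_measure (distr M T Y)"
    using prob_space_distr[OF X] prob_space_distr[OF Y] by (simp_all add: prob_space_imp_sigma_finite)
  fix A B assume "A \<in> sets (distr M S X)" "B \<in> sets (distr M T Y)"
  then have [measurable]: "A \<in> sets S" "B \<in> sets T" by simp_all
  have "prob ((X -` A \<inter> space M) \<inter> (Y -` B \<inter> space M)) = prob (X -` A \<inter> space M) * prob (Y -` B \<inter> space M)"
    by (rule indep_setD[OF ind]) auto
  moreover have "(\<lambda>w. (X w, Y w)) -` (A \<times> B) \<inter> space M = (X -` A \<inter> space M) \<inter> (Y -` B \<inter> space M)" by auto
  ultimately show "emeasure (distr M S X) A * emeasure (distr M T Y) B
     = emeasure (distr M (S \<Otimes>\<^sub>M T) (\<lambda>w. (X w, Y w))) (A \<times> B)"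
    by (simp add: emeasure_distr emeasure_eq_measure ennreal_mult)
qed simp

text \<open>For a non-measurable \<open>W\<close> the integral is a lower integral, which is in general only superadditive.\<close>

lemma nn_integral_add_le:
  assumes S[measurable]: "S \<in> borel_measurable M"
  shows "(\<integral>\<^sup>+ w. S w + W w \<partial>M) \<le> (\<integral>\<^sup>+ w. S w \<partial>M) + (\<integral>\<^sup>+ w. W w \<partial>M)"
  unfolding nn_integral_def[of M "\<lambda>w. S w + W w"]
proof (rule SUP_least)
  fix g assume "g \<in> {g. simple_function M g \<and> g \<le> (\<lambda>w. S w + W w)}"
  then have g: "simple_function M g" "\<And>w. g w \<le> S w + W w" by (auto simp: le_fun_def)
  have [measurable]: "g \<in> borel_measurable M" by (rule borel_measurable_simple_function) fact
  have e1: "integral\<^sup>S M g = (\<integral>\<^sup>+ w. g w \<partial>M)" by (rule nn_integral_eq_simple_integral[symmetric]) fact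
  \<comment> \<open>For a simple \<open>g\<close> below the sum, \<open>g - S\<close> is a
    measurable function below \<open>W\<close>, so its integral is at most the lower integral of
    \<open>W\<close>. Where \<open>S\<close> is infinite the value 0 is imposed, since
    \<open>\<top> - \<top>\<close> is \<open>\<top>\<close> in \<open>ennreal\<close>.\<close>
  define h where "h w = (if S w = \<top> then 0 else g w - S w)" for w
  have [measurable]: "h \<in> borel_measurable M" unfolding h_def by measurable
  have "g w \<le> S w + h w" for w
    by (cases "S w \<le> g w") (simp_all add: h_def add_diff_inverse_ennreal add_increasing2)
  then have "(\<integral>\<^sup>+ w. g w \<partial>M) \<le> (\<integral>\<^sup>+ w. S w + h w \<partial>M)" by (intro nn_integral_mono)
  also have "\<dots> = (\<integral>\<^sup>+ w. S w \<partial>M) + (\<integral>\<^sup>+ w. h w \<partial>M)" by (rule nn_integral_add) measurable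
  also have "\<dots> \<le> (\<integral>\<^sup>+ w. S w \<partial>M) + (\<integral>\<^sup>+ w. W w \<partial>M)"
    by (intro add_left_mono nn_integral_mono) (simp add: h_def g ennreal_minus_le_iff)
  finally show "integral\<^sup>S M g \<le> (\<integral>\<^sup>+ w. S w \<partial>M) + (\<integral>\<^sup>+ w. W w \<partial>M)" unfolding e1 .
qed

locale particle_system = mean_field A \<omega> \<delta> \<alpha> \<theta> f + prob_space M
  for A :: "real^'d^'d" and \<omega> \<delta> \<alpha> :: real
    and \<theta> :: "(real^'m) measure"
    and f :: "real^'d \<Rightarrow> (real^'d) measure \<Rightarrow> real^'m \<Rightarrow> real^'d"
    and M :: "'w measure" +
  fixes \<mu>0 :: "(real^'d) measure"
    and X0 :: "nat \<Rightarrow> nat \<Rightarrow> 'w \<Rightarrow> real^'d"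
    and eps :: "nat \<Rightarrow> nat \<Rightarrow> 'w \<Rightarrow> real^'m"
  assumes mu0: "\<mu>0 \<in> P1"
    and X0_rv: "\<And>N i. 1 \<le> i \<Longrightarrow> i \<le> N \<Longrightarrow> X0 N i \<in> borel_measurable M"
    and X0_law: "\<And>N i. 1 \<le> i \<Longrightarrow> i \<le> N \<Longrightarrow> distr M borel (X0 N i) = \<mu>0"
    and eps_rv: "\<And>i n. 1 \<le> i \<Longrightarrow> 1 \<le> n \<Longrightarrow> eps i n \<in> borel_measurable M"
    and eps_law: "\<And>i n. 1 \<le> i \<Longrightarrow> 1 \<le> n \<Longrightarrow> distr M borel (eps i n) = \<theta>"
    and eps_indep: "indep_vars (\<lambda>_. borel) (\<lambda>(i,n). eps i n) {(i,n). 1 \<le> i \<and> 1 \<le> n}"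
    and eps_X0_indep: "indep_set
        {(\<lambda>w. \<lambda>(N,i)\<in>{(N,i). 1 \<le> i \<and> i \<le> N}. X0 N i w) -` B \<inter> space M | B.
            B \<in> sets (Pi\<^sub>M {(N,i). 1 \<le> i \<and> i \<le> N} (\<lambda>_. borel))}
        {(\<lambda>w. \<lambda>(i,n)\<in>{(i,n). 1 \<le> i \<and> 1 \<le> n}. eps i n w) -` B \<inter> space M | B.
            B \<in> sets (Pi\<^sub>M {(i,n). 1 \<le> i \<and> 1 \<le> n} (\<lambda>_. borel))}"
    and mu0_moment: "(\<integral>\<^sup>+ x. ennreal (norm x powr (1 + \<alpha>)) \<partial>\<mu>0) < \<infinity>"
begin

abbreviation "X \<equiv> particles A \<delta> f X0 eps"

definition pos :: "nat \<Rightarrow> nat \<Rightarrow> 'w \<Rightarrow> nat \<Rightarrow> real^'d" where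
  "pos N n w = (\<lambda>i\<in>{1..N}. X N n i w)"

definition innov :: "nat \<Rightarrow> nat \<Rightarrow> 'w \<Rightarrow> nat \<Rightarrow> real^'m" where
  "innov N n w = (\<lambda>i\<in>{1..N}. eps i n w)"

text \<open>All innovations used by the first \<open>N\<close> particles up to time
  \<open>n\<close>; its index set is disjoint from that of the innovations at time
  \<open>Suc n\<close>.\<close>

definition hist :: "nat \<Rightarrow> nat \<Rightarrow> 'w \<Rightarrow> nat \<times> nat \<Rightarrow> real^'m" where
  "hist N n w = (\<lambda>j\<in>{1..N} \<times> {1..n}. eps (fst j) (snd j) w)"

abbreviation "hist_space N n \<equiv> Pi\<^sub>M ({1..N::nat} \<times> {1..n::nat}) (\<lambda>_. borel :: (real^'m) measure)"
abbreviation "noise_space N \<equiv> Pi\<^sub>M {1..N::nat} (\<lambda>_. borel :: (real^'m) measure)"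

lemma emp_meas_eq: "emp_meas A \<delta> f X0 eps N n w = empirical N (pos N n w)"
  unfolding emp_meas_def by (rule empirical_cong) (simp add: pos_def)

lemma pos_Suc: "pos N (Suc n) w = step N (pos N n w) (innov N (Suc n) w)"
proof -
  have e: "empirical N (\<lambda>j. X N n j w) = empirical N (pos N n w)"
    by (rule empirical_cong) (simp add: pos_def)
  have "X N (Suc n) i w = upd (empirical N (pos N n w)) (pos N n w i) (innov N (Suc n) w i)" if "i \<in> {1..N}" for i
  proof -
    have "pos N n w i = X N n i w" "innov N (Suc n) w i = eps i (Suc n) w"
      using that by (simp_all only: pos_def innov_def restrict_apply')
    then show ?thesis by (simp only: upd_def particles.simps e)
  qed
  then show ?thesis
    unfolding pos_def[of N "Suc n"] step_def by (intro restrict_ext)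
qed

lemma pos_0_meas [measurable]: "pos N 0 \<in> measurable M (pos_space N)"
  unfolding pos_def by (rule measurable_restrict) (simp add: X0_rv)

lemma innov_meas [measurable]: "1 \<le> n \<Longrightarrow> innov N n \<in> measurable M (noise_space N)"
  unfolding innov_def by (rule measurable_restrict) (simp add: eps_rv)

lemma innov_meas' [measurable]: "1 \<le> n \<Longrightarrow> innov N n \<in> measurable M (noise N)"
  using innov_meas by (simp only: measurable_cong_sets[OF refl sets_noise])

text \<open>The positions are non-anticipating. Together with the product form of the joint law
  below, this gives their independence of the next innovations.\<close>

lemma pos_eq_function_of_history:
  "\<exists>\<xi> \<in> measurable (pos_space N \<Otimes>\<^sub>M hist_space N n) (pos_space N). \<forall>w. pos N n w = \<xi> (pos N 0 w, hist N n w)"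
proof -
  \<comment> \<open>The induction runs over \<open>k\<close> with the horizon \<open>n\<close>
    fixed, so that all the maps \<open>\<xi>\<close> have the same history space as domain.\<close>
  have "\<exists>\<xi> \<in> measurable (pos_space N \<Otimes>\<^sub>M hist_space N n) (pos_space N). \<forall>w. pos N k w = \<xi> (pos N 0 w, hist N n w)"
    if "k \<le> n" for k
    using that
  proof (induction k)
    case 0
    show ?case by (rule bexI[OF _ measurable_fst]) simp
  next
    case (Suc k)
    have "k \<le> n" using Suc.prems by simp
    from Suc.IH[OF this] obtain \<xi> where \<xi>: "\<xi> \<in> measurable (pos_space N \<Otimes>\<^sub>M hist_space N n) (pos_space N)"
      "\<And>w. pos N k w = \<xi> (pos N 0 w, hist N n w)" by blast
    define \<zeta> where "\<zeta> p = step N (\<xi> p) (\<lambda>i\<in>{1..N}. snd p (i, Suc k))" for p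
    have "(\<lambda>p. \<lambda>i\<in>{1..N}. snd p (i, Suc k)) \<in> measurable (pos_space N \<Otimes>\<^sub>M hist_space N n) (noise_space N)"
    proof (rule measurable_restrict)
      fix i assume "i \<in> {1..N}"
      then have "(i, Suc k) \<in> {1..N} \<times> {1..n}" using Suc.prems by simp
      from measurable_compose[OF measurable_snd measurable_component_singleton[OF this]]
      show "(\<lambda>p. snd p (i, Suc k)) \<in> borel_measurable (pos_space N \<Otimes>\<^sub>M hist_space N n)" .
    qed
    then have "(\<lambda>p. \<lambda>i\<in>{1..N}. snd p (i, Suc k)) \<in> measurable (pos_space N \<Otimes>\<^sub>M hist_space N n) (noise N)"
      by (simp only: measurable_cong_sets[OF refl sets_noise])
    from measurable_compose[OF measurable_Pair[OF \<xi>(1) this] step_meas]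
    have "\<zeta> \<in> measurable (pos_space N \<Otimes>\<^sub>M hist_space N n) (pos_space N)"
      unfolding \<zeta>_def by simp
    moreover have "pos N (Suc k) w = \<zeta> (pos N 0 w, hist N n w)" for w
    proof -
      have "innov N (Suc k) w = (\<lambda>i\<in>{1..N}. hist N n w (i, Suc k))"
        using Suc.prems by (auto simp: innov_def hist_def intro!: restrict_ext)
      then show ?thesis by (simp add: pos_Suc \<zeta>_def \<xi>(2))
    qed
    ultimately show ?case by blast
  qed
  then show ?thesis by blast
qed

lemma pos_meas [measurable]: "pos N n \<in> measurable M (pos_space N)"
proof (induction n)
  case (Suc n)
  from measurable_compose[OF measurable_Pair[OF Suc innov_meas'] step_meas] 
  show ?case unfolding pos_Suc by simp
qed (rule pos_0_meas)

abbreviation "eps_index \<equiv> {(i::nat, n::nat). 1 \<le> i \<and> 1 \<le> n}"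
abbreviation "X0_index \<equiv> {(N::nat, i::nat). 1 \<le> i \<and> i \<le> N}"

definition "eps_all w = (\<lambda>(i,n)\<in>eps_index. eps i n w)"
definition "X0_all w = (\<lambda>(N,i)\<in>X0_index. X0 N i w)"

lemma distr_innov: "distr M (noise_space N) (innov N (Suc n)) = noise N"
proof -
  have rv: "(case j of (i, n) \<Rightarrow> eps i n) \<in> borel_measurable M" if "j \<in> eps_index" for j
    using that eps_rv by auto
  have "distr M (Pi\<^sub>M eps_index (\<lambda>_. borel)) (\<lambda>w. \<lambda>j\<in>eps_index. (case j of (i, n) \<Rightarrow> eps i n) w)
      = (\<Pi>\<^sub>M j\<in>eps_index. distr M borel (case j of (i, n) \<Rightarrow> eps i n))"
    using eps_indep rv by (subst (asm) indep_vars_iff_distr_eq_PiM') auto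
  also have "\<dots> = Pi\<^sub>M eps_index (\<lambda>_. \<theta>)"
    by (intro PiM_cong refl) (auto simp: eps_law)
  also have "(\<lambda>w. \<lambda>j\<in>eps_index. (case j of (i, n) \<Rightarrow> eps i n) w) = eps_all"
    by (auto simp: eps_all_def fun_eq_iff split: prod.split)
  finally have law: "distr M (Pi\<^sub>M eps_index (\<lambda>_. borel)) eps_all = Pi\<^sub>M eps_index (\<lambda>_. \<theta>)" .
  have m1: "eps_all \<in> measurable M (Pi\<^sub>M eps_index (\<lambda>_. borel))"
    unfolding eps_all_def by (rule measurable_restrict) (use eps_rv in auto)
  have m2: "(\<lambda>h. \<lambda>i\<in>{1..N}. h (i, Suc n)) \<in> measurable (Pi\<^sub>M eps_index (\<lambda>_. borel)) (noise_space N)"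
    by (rule measurable_restrict) (rule measurable_component_singleton, simp)
  have "innov N (Suc n) = (\<lambda>h. \<lambda>i\<in>{1..N}. h (i, Suc n)) \<circ> eps_all"
    by (auto simp: fun_eq_iff innov_def eps_all_def)
  then have "distr M (noise_space N) (innov N (Suc n)) = distr (distr M (Pi\<^sub>M eps_index (\<lambda>_. borel)) eps_all) (noise_space N) (\<lambda>h. \<lambda>i\<in>{1..N}. h (i, Suc n))"
    using m1 m2 by (subst distr_distr) simp_all
  also have "\<dots> = distr (Pi\<^sub>M eps_index (\<lambda>_. \<theta>)) (noise N) (\<lambda>h. \<lambda>i\<in>{1..N}. h (i, Suc n))"
    unfolding law by (rule distr_cong) (simp_all add: sets_noise[symmetric] del: One_nat_def)
  also have "\<dots> = noise N"
    by (rule distr_PiM_reindex[where M = "\<lambda>_. \<theta>" and f = "\<lambda>i. (i, Suc n)"])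
       (auto simp: inj_on_def theta)
  finally show ?thesis .
qed

lemma hist_meas [measurable]: "hist N n \<in> measurable M (hist_space N n)"
  unfolding hist_def by (rule measurable_restrict) (use eps_rv in auto)

text \<open>Past and next innovations are restrictions of one independent family to disjoint index
  blocks.\<close>

lemma distr_hist_innov:
  "distr M (hist_space N n \<Otimes>\<^sub>M noise_space N) (\<lambda>w. (hist N n w, innov N (Suc n) w))
    = distr M (hist_space N n) (hist N n) \<Otimes>\<^sub>M noise N"
proof -
  let ?A = "{1..N} \<times> {1..n}" and ?B = "{1..N} \<times> {Suc n}"
  define V where "V w = restrict (\<lambda>j. (case j of (i, n) \<Rightarrow> eps i n) w) ?B" for w
  have hist: "(\<lambda>w. restrict (\<lambda>j. (case j of (i, n) \<Rightarrow> eps i n) w) ?A) = hist N n"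
    by (auto simp: fun_eq_iff hist_def split: prod.split)
  have "indep_var (Pi\<^sub>M ?A (\<lambda>_. borel)) (hist N n) (Pi\<^sub>M ?B (\<lambda>_. borel)) V"
    unfolding hist[symmetric] V_def[abs_def] by (rule indep_var_restrict[OF eps_indep]) auto
  then have V: "V \<in> measurable M (Pi\<^sub>M ?B (\<lambda>_. borel))"
    and law: "distr M (Pi\<^sub>M ?A (\<lambda>_. borel) \<Otimes>\<^sub>M Pi\<^sub>M ?B (\<lambda>_. borel)) (\<lambda>w. (hist N n w, V w))
      = distr M (Pi\<^sub>M ?A (\<lambda>_. borel)) (hist N n) \<Otimes>\<^sub>M distr M (Pi\<^sub>M ?B (\<lambda>_. borel)) V"
    unfolding indep_var_distribution_eq by simp_all
  have m: "(\<lambda>h. \<lambda>i\<in>{1..N}. h (i, Suc n)) \<in> measurable (Pi\<^sub>M ?B (\<lambda>_. borel)) (noise_space N)"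
    by (rule measurable_restrict) (rule measurable_component_singleton, simp)
  have innov: "(\<lambda>i\<in>{1..N}. V w (i, Suc n)) = innov N (Suc n) w" for w
    by (auto simp: fun_eq_iff innov_def V_def)
  show ?thesis
    using distr_pair_compose[OF hist_meas V law measurable_ident_sets[OF refl] m]
    unfolding innov distr_innov .
qed

text \<open>The pair of history and next innovations is a function of all innovations, hence
  independent of the initial positions; inside the pair the law factorises by the preceding block
  argument.\<close>

lemma distr_pos0_hist_innov:
  "distr M (pos_space N \<Otimes>\<^sub>M (hist_space N n \<Otimes>\<^sub>M noise_space N)) (\<lambda>w. (pos N 0 w, (hist N n w, innov N (Suc n) w)))
    = distr M (pos_space N) (pos N 0) \<Otimes>\<^sub>M (distr M (hist_space N n) (hist N n) \<Otimes>\<^sub>M noise N)"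
proof -
  let ?E = "Pi\<^sub>M eps_index (\<lambda>_. borel :: (real^'m) measure)"
  have 1: "(\<lambda>x. \<lambda>i\<in>{1..N}. x (N, i)) \<in> measurable (Pi\<^sub>M X0_index (\<lambda>_. borel)) (pos_space N)"
    by (rule measurable_restrict) (rule measurable_component_singleton, simp)
  have 2: "(\<lambda>h. \<lambda>j\<in>{1..N} \<times> {1..n}. h j) \<in> measurable ?E (hist_space N n)"
    by (rule measurable_restrict) (rule measurable_component_singleton, auto)
  have 3: "(\<lambda>h. \<lambda>i\<in>{1..N}. h (i, Suc n)) \<in> measurable ?E (noise_space N)"
    by (rule measurable_restrict) (rule measurable_component_singleton, simp)
  have X: "X0_all \<in> measurable M (Pi\<^sub>M X0_index (\<lambda>_. borel))"
    unfolding X0_all_def by (rule measurable_restrict) (use X0_rv in auto)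
  have E: "eps_all \<in> measurable M ?E"
    unfolding eps_all_def by (rule measurable_restrict) (use eps_rv in auto)
  have pos0: "(\<lambda>i\<in>{1..N}. X0_all w (N, i)) = pos N 0 w" for w
    by (auto simp: fun_eq_iff pos_def X0_all_def)
  have hist: "(\<lambda>j\<in>{1..N} \<times> {1..n}. eps_all w j) = hist N n w" for w
    by (auto simp: fun_eq_iff hist_def eps_all_def)
  have innov: "(\<lambda>i\<in>{1..N}. eps_all w (i, Suc n)) = innov N (Suc n) w" for w
    by (auto simp: fun_eq_iff innov_def eps_all_def)
  have "distr M (Pi\<^sub>M X0_index (\<lambda>_. borel) \<Otimes>\<^sub>M ?E) (\<lambda>w. (X0_all w, eps_all w))
      = distr M (Pi\<^sub>M X0_index (\<lambda>_. borel)) X0_all \<Otimes>\<^sub>M distr M ?E eps_all"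
    using eps_X0_indep unfolding X0_all_def[abs_def, symmetric] eps_all_def[abs_def, symmetric]
    by (rule distr_pair_of_indep_set[OF X E])
  from distr_pair_compose[OF X E this 1 measurable_Pair[OF 2 3]]
  show ?thesis unfolding pos0 hist innov distr_hist_innov .
qed

text \<open>Conditioning on the positions at time \<open>n\<close>, carried out as Fubini's theorem
  on the product law of initial positions, history and next innovations.\<close>

lemma nn_integral_pos_innov:
  assumes G: "(\<lambda>p. G (fst p) (snd p)) \<in> borel_measurable (pos_space N \<Otimes>\<^sub>M noise N)"
  shows "(\<integral>\<^sup>+ w. G (pos N n w) (innov N (Suc n) w) \<partial>M) = (\<integral>\<^sup>+ w. \<integral>\<^sup>+ z. G (pos N n w) z \<partial>noise N \<partial>M)"
proof -
  interpret Z: prob_space "noise N" by (rule prob_space_noise)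
  define L where "L = distr M (pos_space N) (pos N 0)"
  define H where "H = distr M (hist_space N n) (hist N n)"
  interpret L: prob_space L unfolding L_def by (rule prob_space_distr) (rule pos_0_meas)
  interpret H: prob_space H unfolding H_def by (rule prob_space_distr) (rule hist_meas)
  interpret HZ: pair_prob_space H "noise N" ..
  have sL: "sets L = sets (pos_space N)" and sH: "sets H = sets (hist_space N n)" by (simp_all add: L_def H_def)
  note law = distr_pos0_hist_innov[of N n, folded L_def H_def]
  obtain \<xi> where \<xi>: "\<xi> \<in> measurable (pos_space N \<Otimes>\<^sub>M hist_space N n) (pos_space N)"
    "\<And>w. pos N n w = \<xi> (pos N 0 w, hist N n w)"
    using pos_eq_function_of_history[of N n] by blast
  have \<xi>': "(\<lambda>q. \<xi> (fst q, fst (snd q))) \<in> measurable (pos_space N \<Otimes>\<^sub>M (hist_space N n \<Otimes>\<^sub>M noise_space N)) (pos_space N)"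
    by (rule measurable_compose[OF _ \<xi>(1)]) measurable
  have sets_tr: "sets (pos_space N \<Otimes>\<^sub>M (hist_space N n \<Otimes>\<^sub>M noise_space N)) = sets (L \<Otimes>\<^sub>M (H \<Otimes>\<^sub>M noise N))"
    by (intro sets_pair_measure_cong sets_noise[symmetric] sL[symmetric] sH[symmetric])
  have eq: "(\<integral>\<^sup>+ w. F (pos N n w) (innov N (Suc n) w) \<partial>M) = (\<integral>\<^sup>+ x. \<integral>\<^sup>+ h. \<integral>\<^sup>+ z. F (\<xi> (x, h)) z \<partial>noise N \<partial>H \<partial>L)"
    if F: "(\<lambda>p. F (fst p) (snd p)) \<in> borel_measurable (pos_space N \<Otimes>\<^sub>M noise N)" for F :: "_ \<Rightarrow> _ \<Rightarrow> ennreal"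
  proof -
    have "(\<lambda>q. (\<xi> (fst q, fst (snd q)), snd (snd q))) \<in> measurable (pos_space N \<Otimes>\<^sub>M (hist_space N n \<Otimes>\<^sub>M noise_space N)) (pos_space N \<Otimes>\<^sub>M noise N)"
      by (rule measurable_Pair[OF \<xi>']) (subst measurable_cong_sets[OF refl sets_noise], measurable)
    from measurable_compose[OF this F]
    have Fm: "(\<lambda>q. F (\<xi> (fst q, fst (snd q))) (snd (snd q))) \<in> borel_measurable (pos_space N \<Otimes>\<^sub>M (hist_space N n \<Otimes>\<^sub>M noise_space N))"
      by (simp only: fst_conv snd_conv)
    then have Fm': "(\<lambda>q. F (\<xi> (fst q, fst (snd q))) (snd (snd q))) \<in> borel_measurable (L \<Otimes>\<^sub>M (H \<Otimes>\<^sub>M noise N))"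
      by (simp only: measurable_cong_sets[OF sets_tr refl])
    have mw: "(\<lambda>w. (pos N 0 w, (hist N n w, innov N (Suc n) w))) \<in> measurable M (pos_space N \<Otimes>\<^sub>M (hist_space N n \<Otimes>\<^sub>M noise_space N))"
      by (intro measurable_Pair pos_0_meas hist_meas innov_meas) simp
    have "(\<integral>\<^sup>+ w. F (pos N n w) (innov N (Suc n) w) \<partial>M) = (\<integral>\<^sup>+ q. F (\<xi> (fst q, fst (snd q))) (snd (snd q))
       \<partial>distr M (pos_space N \<Otimes>\<^sub>M (hist_space N n \<Otimes>\<^sub>M noise_space N)) (\<lambda>w. (pos N 0 w, (hist N n w, innov N (Suc n) w))))"
      using Fm by (subst nn_integral_distr[OF mw]) (simp_all add: \<xi>(2))
    also have "\<dots> = (\<integral>\<^sup>+ x. \<integral>\<^sup>+ r. F (\<xi> (x, fst r)) (snd r) \<partial>(H \<Otimes>\<^sub>M noise N) \<partial>L)"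
      unfolding law using HZ.nn_integral_fst[OF Fm'] by simp
    also have "\<dots> = (\<integral>\<^sup>+ x. \<integral>\<^sup>+ h. \<integral>\<^sup>+ z. F (\<xi> (x, h)) z \<partial>noise N \<partial>H \<partial>L)"
    proof (intro nn_integral_cong)
      fix x assume x: "x \<in> space L"
      have "(\<lambda>r. F (\<xi> (x, fst r)) (snd r)) \<in> borel_measurable (H \<Otimes>\<^sub>M noise N)"
        using measurable_compose[OF measurable_Pair1'[OF x] Fm'] by (simp only: fst_conv snd_conv)
      from Z.nn_integral_fst[OF this]
      show "(\<integral>\<^sup>+ r. F (\<xi> (x, fst r)) (snd r) \<partial>(H \<Otimes>\<^sub>M noise N)) = (\<integral>\<^sup>+ h. \<integral>\<^sup>+ z. F (\<xi> (x, h)) z \<partial>noise N \<partial>H)"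
        by simp
    qed
    finally show ?thesis .
  qed
  have "(\<lambda>x. \<integral>\<^sup>+ z. G x z \<partial>noise N) \<in> borel_measurable (pos_space N)"
    using Z.borel_measurable_nn_integral_fst[OF G] by (simp only: fst_conv snd_conv)
  from measurable_compose[OF measurable_fst this]
  have "(\<lambda>p. \<integral>\<^sup>+ z. G (fst p) z \<partial>noise N) \<in> borel_measurable (pos_space N \<Otimes>\<^sub>M noise N)" .
  \<comment> \<open>The formula \<open>eq\<close> is used a second time, for an integrand constant
    in the noise, to bring the right-hand side to the same iterated integral.\<close>
  from eq[of "\<lambda>x _. \<integral>\<^sup>+ z. G x z \<partial>noise N", OF this]
  have "(\<integral>\<^sup>+ w. \<integral>\<^sup>+ z. G (pos N n w) z \<partial>noise N \<partial>M)
     = (\<integral>\<^sup>+ x. \<integral>\<^sup>+ h. \<integral>\<^sup>+ z. G (\<xi> (x, h)) z \<partial>noise N \<partial>H \<partial>L)"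
    by (simp add: Z.emeasure_space_1 del: One_nat_def)
  with eq[OF G] show ?thesis by simp
qed

end

section \<open>Iteration of the one-step error\<close>

context particle_system begin

lemma pos_space: "w \<in> space M \<Longrightarrow> pos N n w \<in> space (pos_space N)"
  using pos_meas by (rule measurable_space)

lemma measurable_nn_integral_empirical:
  assumes N: "1 \<le> N" and g: "g \<in> borel_measurable borel"
  shows "(\<lambda>w. \<integral>\<^sup>+ y. g y \<partial>empirical N (pos N n w)) \<in> borel_measurable M"
proof -
  have "empirical N \<in> measurable (pos_space N) (subprob_algebra borel)"
    using measurable_empirical[OF N] unfolding measurable_restrict_space2_iff by (rule conjunct1)
  from measurable_compose[OF measurable_compose[OF pos_meas this] nn_integral_measurable_subprob_algebra[OF g]]
  show ?thesis .
qed

lemma mean_empirical_0: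
  assumes N: "1 \<le> N" and g[measurable]: "g \<in> borel_measurable borel"
  shows "(\<integral>\<^sup>+ w. \<integral>\<^sup>+ y. g y \<partial>empirical N (pos N 0 w) \<partial>M) = (\<integral>\<^sup>+ y. g y \<partial>\<mu>0)"
proof -
  have m: "(\<lambda>w. g (X0 N i w)) \<in> borel_measurable M" if "i \<in> {1..N}" for i
    using that by (intro measurable_compose[OF X0_rv g]) auto
  have "(\<integral>\<^sup>+ w. \<integral>\<^sup>+ y. g y \<partial>empirical N (pos N 0 w) \<partial>M) = (\<integral>\<^sup>+ w. ennreal (1 / real N) * (\<Sum>i=1..N. g (X0 N i w)) \<partial>M)"
    by (simp add: nn_integral_empirical[OF N g] pos_def)
  also have "\<dots> = ennreal (1 / real N) * (\<integral>\<^sup>+ w. (\<Sum>i=1..N. g (X0 N i w)) \<partial>M)"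
    by (rule nn_integral_cmult) (intro borel_measurable_sum m)
  also have "(\<integral>\<^sup>+ w. (\<Sum>i=1..N. g (X0 N i w)) \<partial>M) = (\<Sum>i=1..N. \<integral>\<^sup>+ w. g (X0 N i w) \<partial>M)"
    by (rule nn_integral_sum) (rule m)
  also have "\<dots> = (\<Sum>i=1..N. \<integral>\<^sup>+ y. g y \<partial>\<mu>0)"
  proof (intro sum.cong refl)
    fix i assume "i \<in> {1..N}"
    then have i: "1 \<le> i" "i \<le> N" by auto
    have "(\<integral>\<^sup>+ y. g y \<partial>distr M borel (X0 N i)) = (\<integral>\<^sup>+ w. g (X0 N i w) \<partial>M)"
      using X0_rv[OF i] by (rule nn_integral_distr) simp
    then show "(\<integral>\<^sup>+ w. g (X0 N i w) \<partial>M) = (\<integral>\<^sup>+ y. g y \<partial>\<mu>0)" unfolding X0_law[OF i] by simp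
  qed
  also have "ennreal (1 / real N) * \<dots> = (ennreal (1 / real N) * ennreal (real N)) * (\<integral>\<^sup>+ y. g y \<partial>\<mu>0)"
    by (simp add: ennreal_of_nat_eq_real_of_nat mult.assoc)
  also have "ennreal (1 / real N) * ennreal (real N) = 1"
    using N by (simp add: ennreal_mult[symmetric])
  finally show ?thesis by simp
qed

lemma mean_empirical_Suc:
  assumes N: "1 \<le> N" and g: "g \<in> borel_measurable borel"
  shows "(\<integral>\<^sup>+ w. \<integral>\<^sup>+ y. g y \<partial>empirical N (pos N (Suc n) w) \<partial>M) = (\<integral>\<^sup>+ w. \<integral>\<^sup>+ y. g y \<partial>\<Psi> (empirical N (pos N n w)) \<partial>M)"
proof -
  have "(\<lambda>p. \<integral>\<^sup>+ y. g y \<partial>empirical N (step N (fst p) (snd p))) \<in> borel_measurable (pos_space N \<Otimes>\<^sub>M noise N)"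
    by (rule measurable_compose[OF measurable_empirical_step[OF N] nn_integral_measurable_subprob_algebra[OF g]])
  from nn_integral_pos_innov[of "\<lambda>x z. \<integral>\<^sup>+ y. g y \<partial>empirical N (step N x z)", OF this, of n]
  show ?thesis unfolding pos_Suc nn_integral_step[OF N g] .
qed

text \<open>The mean moment satisfies an affine recursion with factor \<open>k < 1\<close>, so it
  stays below a constant depending on neither \<open>N\<close> nor \<open>n\<close>.\<close>

lemma uniform_moment:
  obtains b C where "0 < b" "0 \<le> C"
    "\<And>N n. 1 \<le> N \<Longrightarrow> (\<integral>\<^sup>+ w. \<integral>\<^sup>+ y. ennreal (norm y powr (1 + b)) \<partial>empirical N (pos N n w) \<partial>M) \<le> ennreal C"
proof -
  \<comment> \<open>Small enough that \<open>2 * s * Cw\<close> uses up at most half of the gap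
    \<open>1 - \<gamma>\<close>; the \<open>+ 1\<close> keeps the denominator positive, and
    \<open>s \<le> 1\<close> keeps the order of the moment below \<open>1 + \<alpha>\<close> or
    equal to it.\<close>
  define s where "s = min 1 ((1 - \<gamma>) / (4 * (Cw + 1)))"
  have s: "0 < s" "s \<le> 1" using gamma_bounds Cw_nonneg by (simp_all add: s_def)
  define k where "k = \<gamma> + 2 * s * Cw"
  have "s \<le> (1 - \<gamma>) / (4 * (Cw + 1))" by (simp add: s_def)
  then have "s * (4 * (Cw + 1)) \<le> 1 - \<gamma>"
    by (rule iffD1[OF pos_le_divide_eq, rotated]) (use Cw_nonneg in simp)
  then have k: "0 < k" "k < 1"
    using s gamma_bounds Cw_nonneg by (simp_all add: k_def add_pos_nonneg algebra_simps)
  define p where "p = 1 + s * \<alpha>"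
  have p: "1 \<le> p" "p \<le> 1 + \<alpha>" using s alpha by (simp_all add: p_def mult_left_le_one_le)
  define C3 where "C3 = \<delta> * (1 + c1) + s * Cw"
  have C3: "0 \<le> C3" using delta s Cw_nonneg by (simp add: C3_def)
  interpret mu0: prob_space \<mu>0 using mu0 by (rule P1_prob)
  note [measurable_cong] = P1_sets[OF mu0]
  have "(\<integral>\<^sup>+ y. ennreal (norm y powr p) \<partial>\<mu>0) \<le> (\<integral>\<^sup>+ y. 1 + ennreal (norm y powr (1 + \<alpha>)) \<partial>\<mu>0)"
  proof (intro nn_integral_mono)
    fix y :: "real^'d"
    have "norm y powr p \<le> 1 + norm y powr (1 + \<alpha>)"
    proof (cases "norm y \<le> 1")
      case True
      then have "norm y powr p \<le> 1" using p by (intro powr_le1) auto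
      then show ?thesis by (simp add: add_increasing2)
    next
      case False
      then have "norm y powr p \<le> norm y powr (1 + \<alpha>)" using p by (intro powr_mono) auto
      then show ?thesis by simp
    qed
    then have "ennreal (norm y powr p) \<le> ennreal (1 + norm y powr (1 + \<alpha>))" by (rule ennreal_leI)
    then show "ennreal (norm y powr p) \<le> 1 + ennreal (norm y powr (1 + \<alpha>))" by (simp add: ennreal_plus)
  qed
  also have "\<dots> = 1 + (\<integral>\<^sup>+ y. ennreal (norm y powr (1 + \<alpha>)) \<partial>\<mu>0)"
    by (simp add: nn_integral_add mu0.emeasure_space_1)
  also have "\<dots> < \<top>" using mu0_moment by simp
  finally have fin: "(\<integral>\<^sup>+ y. ennreal (norm y powr p) \<partial>\<mu>0) < \<top>" .
  define a0 where "a0 = enn2real (\<integral>\<^sup>+ y. ennreal (norm y powr p) \<partial>\<mu>0)"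
  have a0: "(\<integral>\<^sup>+ y. ennreal (norm y powr p) \<partial>\<mu>0) = ennreal a0" "0 \<le> a0" using fin by (simp_all add: a0_def)
  \<comment> \<open>The fixed point \<open>C3 / (1 - k)\<close> of the recursion raised by the
    initial moment: large enough at time 0 and preserved by each step.\<close>
  define C where "C = a0 + C3 / (1 - k)"
  have C: "0 \<le> C" "a0 \<le> C" "k * C + C3 \<le> C"
  proof -
    show "0 \<le> C" "a0 \<le> C" using a0 C3 k by (simp_all add: C_def)
    have "k * (C3 / (1 - k)) + C3 = C3 / (1 - k)" using k by (simp add: field_simps)
    moreover have "k * a0 \<le> a0" using k a0 by (simp add: mult_left_le_one_le)
    ultimately show "k * C + C3 \<le> C" by (simp add: C_def distrib_left)
  qed
  have gm: "(\<lambda>y::real^'d. ennreal (norm y powr p)) \<in> borel_measurable borel" by measurable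
  have "(\<integral>\<^sup>+ w. \<integral>\<^sup>+ y. ennreal (norm y powr p) \<partial>empirical N (pos N n w) \<partial>M) \<le> ennreal C" if N: "1 \<le> N" for N n
  proof (induction n)
    case 0
    show ?case unfolding mean_empirical_0[OF N gm] a0 using C by (intro ennreal_leI)
  next
    case (Suc n)
    note [measurable] = measurable_nn_integral_empirical[OF N gm]
    have "(\<integral>\<^sup>+ w. \<integral>\<^sup>+ y. ennreal (norm y powr p) \<partial>empirical N (pos N (Suc n) w) \<partial>M)
       = (\<integral>\<^sup>+ w. \<integral>\<^sup>+ y. ennreal (norm y powr p) \<partial>\<Psi> (empirical N (pos N n w)) \<partial>M)"
      by (rule mean_empirical_Suc[OF N gm])
    also have "\<dots> \<le> (\<integral>\<^sup>+ w. ennreal k * (\<integral>\<^sup>+ y. ennreal (norm y powr p) \<partial>empirical N (pos N n w)) + ennreal C3 \<partial>M)"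
      unfolding p_def k_def C3_def by (intro nn_integral_mono Psi_empirical_moment N s)
    also have "\<dots> = ennreal k * (\<integral>\<^sup>+ w. \<integral>\<^sup>+ y. ennreal (norm y powr p) \<partial>empirical N (pos N n w) \<partial>M) + ennreal C3"
      by (simp add: nn_integral_add nn_integral_cmult emeasure_space_1)
    also have "\<dots> \<le> ennreal k * ennreal C + ennreal C3"
      by (intro add_mono mult_left_mono Suc) simp_all
    also have "\<dots> = ennreal (k * C + C3)" using k C C3 by (simp add: ennreal_mult)
    also have "\<dots> \<le> ennreal C" by (intro ennreal_leI C)
    finally show ?case .
  qed
  then show ?thesis using that[of "s * \<alpha>" C] s alpha C by (simp add: p_def)
qed

abbreviation "\<mu> n \<equiv> nonlin A \<delta> f \<theta> \<mu>0 n"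

lemma nonlin_0: "\<mu> 0 = \<mu>0" and nonlin_Suc: "\<mu> (Suc n) = \<Psi> (\<mu> n)"
  by (simp_all add: nonlin_def)

lemma nonlin_in_P1: "\<mu> n \<in> P1"
  by (induction n) (simp_all only: nonlin_0 nonlin_Suc mu0 Psi_in_P1)

text \<open>The mean tail under \<open>\<Psi>\<close> at time \<open>n\<close> is the mean tail of
  the empirical measure at time \<open>Suc n\<close>, which is why the moment bound is required at
  the later time. Beyond radius \<open>R\<close> the norm is at most \<open>R powr (- b)\<close>
  times its \<open>1 + b\<close>-th power.\<close>

lemma uniform_error:
  assumes b: "0 < b" and N: "1 \<le> N" and R: "0 < R" and \<eta>: "0 \<le> \<eta>"
    and q: "q \<in> measurable borel (count_space UNIV)"
    and mom: "(\<integral>\<^sup>+ w. \<integral>\<^sup>+ y. ennreal (norm y powr (1 + b)) \<partial>empirical N (pos N (Suc n) w) \<partial>M) \<le> ennreal C" and C: "0 \<le> C"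
  shows "(\<integral>\<^sup>+ w. err N q K R \<eta> (pos N n w) (innov N (Suc n) w) \<partial>M)
    \<le> ennreal (\<eta> + 4 * (R powr (- b) * C) + 2 * R * (K + 1) / sqrt N)"
proof -
  have tm: "(\<lambda>y::real^'d. ennreal (tail R y)) \<in> borel_measurable borel" by measurable
  have gm: "(\<lambda>y::real^'d. ennreal (norm y powr (1 + b))) \<in> borel_measurable borel" by measurable
  have [measurable]: "(\<lambda>w. \<integral>\<^sup>+ y. ennreal (tail R y) \<partial>\<Psi> (empirical N (pos N n w))) \<in> borel_measurable M"
    by (rule measurable_compose[OF measurable_compose[OF pos_meas measurable_Psi_empirical[OF N]] nn_integral_measurable_subprob_algebra[OF tm]])
  have "(\<integral>\<^sup>+ w. err N q K R \<eta> (pos N n w) (innov N (Suc n) w) \<partial>M)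
     = (\<integral>\<^sup>+ w. \<integral>\<^sup>+ z. err N q K R \<eta> (pos N n w) z \<partial>noise N \<partial>M)"
    by (rule nn_integral_pos_innov[OF err_meas[OF N q]])
  also have "\<dots> \<le> (\<integral>\<^sup>+ w. ennreal \<eta> + 4 * (\<integral>\<^sup>+ y. ennreal (tail R y) \<partial>\<Psi> (empirical N (pos N n w))) + ennreal (2 * R * (K + 1) / sqrt N) \<partial>M)"
    by (intro nn_integral_mono nn_integral_err N q R \<eta> pos_space)
  also have "\<dots> = ennreal \<eta> + 4 * (\<integral>\<^sup>+ w. \<integral>\<^sup>+ y. ennreal (tail R y) \<partial>\<Psi> (empirical N (pos N n w)) \<partial>M) + ennreal (2 * R * (K + 1) / sqrt N)"
    by (simp add: nn_integral_add nn_integral_cmult emeasure_space_1)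
  also have "(\<integral>\<^sup>+ w. \<integral>\<^sup>+ y. ennreal (tail R y) \<partial>\<Psi> (empirical N (pos N n w)) \<partial>M)
     = (\<integral>\<^sup>+ w. \<integral>\<^sup>+ y. ennreal (tail R y) \<partial>empirical N (pos N (Suc n) w) \<partial>M)"
    by (rule mean_empirical_Suc[OF N tm, symmetric])
  also have "\<dots> \<le> (\<integral>\<^sup>+ w. ennreal (R powr (- b)) * (\<integral>\<^sup>+ y. ennreal (norm y powr (1 + b)) \<partial>empirical N (pos N (Suc n) w)) \<partial>M)"
  proof (intro nn_integral_mono)
    fix w
    have "(\<integral>\<^sup>+ y. ennreal (tail R y) \<partial>empirical N (pos N (Suc n) w))
       \<le> (\<integral>\<^sup>+ y. ennreal (R powr (- b)) * ennreal (norm y powr (1 + b)) \<partial>empirical N (pos N (Suc n) w))"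
      using tail_le_powr[OF R b] by (intro nn_integral_mono) (simp add: ennreal_mult[symmetric] ennreal_leI)
    also have "\<dots> = ennreal (R powr (- b)) * (\<integral>\<^sup>+ y. ennreal (norm y powr (1 + b)) \<partial>empirical N (pos N (Suc n) w))"
      by (rule nn_integral_cmult) measurable
    finally show "(\<integral>\<^sup>+ y. ennreal (tail R y) \<partial>empirical N (pos N (Suc n) w)) \<le> \<dots>" .
  qed
  also have "\<dots> = ennreal (R powr (- b)) * (\<integral>\<^sup>+ w. \<integral>\<^sup>+ y. ennreal (norm y powr (1 + b)) \<partial>empirical N (pos N (Suc n) w) \<partial>M)"
    by (rule nn_integral_cmult) (rule measurable_nn_integral_empirical[OF N gm])
  also have "\<dots> \<le> ennreal (R powr (- b)) * ennreal C" by (intro mult_left_mono mom) simp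
  also have "\<dots> = ennreal (R powr (- b) * C)" using C by (simp add: ennreal_mult)
  also have "ennreal \<eta> + 4 * ennreal (R powr (- b) * C) + ennreal (2 * R * (K + 1) / sqrt N)
     = ennreal (\<eta> + 4 * (R powr (- b) * C) + 2 * R * (K + 1) / sqrt N)"
    using \<eta> C R by (simp add: ennreal_plus ennreal_mult)
  finally show ?thesis by (simp add: add_left_mono add_right_mono mult_left_mono)
qed

text \<open>The accumulated error is a measurable \<open>S\<close> that bounds the distance at every
  sample point, so that only \<open>S\<close> has to be integrated. The one-step bound
  \<open>(1 - \<gamma>) * B\<close> is chosen so that the geometric sum is at most \<open>B\<close>
  at all times.\<close>

lemma wass_iterate:
  assumes N: "1 \<le> N" and q: "q \<in> measurable borel (count_space UNIV)" "\<And>x. q x \<le> K"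
    "\<And>x y. q x = q y \<Longrightarrow> norm x \<le> R \<Longrightarrow> norm y \<le> R \<Longrightarrow> dist x y \<le> \<eta>" and "0 \<le> \<eta>" "0 \<le> R"
    and B: "0 \<le> B" "\<And>n. (\<integral>\<^sup>+ w. err N q K R \<eta> (pos N n w) (innov N (Suc n) w) \<partial>M) \<le> ennreal ((1 - \<gamma>) * B)"
  shows "\<exists>S\<in>borel_measurable M. (\<integral>\<^sup>+ w. S w \<partial>M) \<le> ennreal B \<and>
    (\<forall>w. wass (empirical N (pos N n w)) (\<mu> n) \<le> S w + ennreal (\<gamma> ^ n) * wass (empirical N (pos N 0 w)) \<mu>0)"
proof (induction n)
  case 0
  then show ?case using B by (intro bexI[of _ "\<lambda>_. 0"]) (simp_all add: nonlin_0)
next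
  case (Suc n)
  then obtain S where S[measurable]: "S \<in> borel_measurable M" and SB: "(\<integral>\<^sup>+ w. S w \<partial>M) \<le> ennreal B"
    and le: "\<And>w. wass (empirical N (pos N n w)) (\<mu> n) \<le> S w + ennreal (\<gamma> ^ n) * wass (empirical N (pos N 0 w)) \<mu>0"
    by blast
  define E where "E w = err N q K R \<eta> (pos N n w) (innov N (Suc n) w)" for w
  have [measurable]: "E \<in> borel_measurable M"
  proof -
    have "(\<lambda>w. (pos N n w, innov N (Suc n) w)) \<in> measurable M (pos_space N \<Otimes>\<^sub>M noise N)"
      by (intro measurable_Pair pos_meas innov_meas') simp
    from measurable_compose[OF this err_meas[OF N q(1)]] show ?thesis
      unfolding E_def by (simp only: fst_conv snd_conv)
  qed
  \<comment> \<open>The new error is added to the old one contracted by \<open>\<gamma>\<close>; the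
    level \<open>B\<close> is preserved because
    \<open>(1 - \<gamma>) * B + \<gamma> * B = B\<close>.\<close>
  show ?case
  proof (intro bexI[of _ "\<lambda>w. E w + ennreal \<gamma> * S w"] conjI allI)
    have "(\<integral>\<^sup>+ w. E w + ennreal \<gamma> * S w \<partial>M) = (\<integral>\<^sup>+ w. E w \<partial>M) + ennreal \<gamma> * (\<integral>\<^sup>+ w. S w \<partial>M)"
      by (simp add: nn_integral_add nn_integral_cmult)
    also have "\<dots> \<le> ennreal ((1 - \<gamma>) * B) + ennreal \<gamma> * ennreal B"
      using B(2)[of n] SB by (intro add_mono mult_left_mono) (simp_all add: E_def)
    also have "\<dots> = ennreal ((1 - \<gamma>) * B + \<gamma> * B)"
      using gamma_bounds B by (simp add: ennreal_mult)
    also have "(1 - \<gamma>) * B + \<gamma> * B = B" by (simp add: algebra_simps)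
    finally show "(\<integral>\<^sup>+ w. E w + ennreal \<gamma> * S w \<partial>M) \<le> ennreal B" .
  next
    fix w
    let ?W = "wass (empirical N (pos N 0 w)) \<mu>0"
    have "wass (empirical N (pos N (Suc n) w)) (\<mu> (Suc n))
       \<le> wass (empirical N (pos N (Suc n) w)) (\<Psi> (empirical N (pos N n w))) + wass (\<Psi> (empirical N (pos N n w))) (\<Psi> (\<mu> n))"
      unfolding nonlin_Suc by (rule wass_triangle)
    also have "\<dots> \<le> E w + ennreal \<gamma> * wass (empirical N (pos N n w)) (\<mu> n)"
      unfolding pos_Suc E_def using assms
      by (intro add_mono wass_step_le_err Psi_contraction empirical_in_P1 nonlin_in_P1)
    also have "\<dots> \<le> E w + ennreal \<gamma> * (S w + ennreal (\<gamma> ^ n) * ?W)"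
      by (intro add_mono mult_left_mono le) simp_all
    also have "\<dots> = E w + ennreal \<gamma> * S w + ennreal (\<gamma> ^ Suc n) * ?W"
      using gamma_bounds by (simp add: distrib_left ennreal_mult mult.assoc add.assoc)
    finally show "wass (empirical N (pos N (Suc n) w)) (\<mu> (Suc n)) \<le> E w + ennreal \<gamma> * S w + ennreal (\<gamma> ^ Suc n) * ?W" .
  qed measurable
qed

text \<open>The parameters are fixed in the order radius, partition, number of particles. The moment
  bound is uniform in time, so \<open>N0\<close> does not depend on \<open>n\<close>.\<close>

lemma uniform_wass_bound:
  assumes "0 < B"
  obtains N0 where "\<And>N n. 1 \<le> N \<Longrightarrow> N0 \<le> N \<Longrightarrow>
    \<exists>S\<in>borel_measurable M. (\<integral>\<^sup>+ w. S w \<partial>M) \<le> ennreal B \<and>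
      (\<forall>w. wass (empirical N (pos N n w)) (\<mu> n) \<le> S w + ennreal (\<gamma> ^ n) * wass (empirical N (pos N 0 w)) \<mu>0)"
proof -
  obtain b C where b: "0 < b" and C: "0 \<le> C"
    and mom: "\<And>N n. 1 \<le> N \<Longrightarrow> (\<integral>\<^sup>+ w. \<integral>\<^sup>+ y. ennreal (norm y powr (1 + b)) \<partial>empirical N (pos N n w) \<partial>M) \<le> ennreal C"
    by (rule uniform_moment) (rule that; assumption)
  \<comment> \<open>The admissible one-step error in three equal shares: mesh, tails and fluctuation
    of the cell masses.\<close>
  define t where "t = (1 - \<gamma>) * B / 3"
  have t: "0 < t" using assms gamma_bounds by (simp add: t_def)
  \<comment> \<open>Solves \<open>4 * (C + 1) * R powr (- b) = t\<close>; with \<open>C + 1\<close>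
    in place of \<open>C\<close> the equation makes sense for \<open>C = 0\<close> too.\<close>
  define R where "R = (t / (4 * (C + 1))) powr (- (1 / b))"
  have R: "0 < R" using t C by (simp add: R_def)
  have "R powr (- b) = t / (4 * (C + 1))"
    using t C b unfolding R_def powr_powr by simp
  then have "4 * (R powr (- b) * C) = t * (C / (C + 1))" using C by (simp add: field_simps)
  also have "\<dots> \<le> t * 1" using t C by (intro mult_left_mono) (simp_all add: field_simps)
  finally have tailb: "4 * (R powr (- b) * C) \<le> t" by simp
  obtain q :: "real^'d \<Rightarrow> nat" and K where q: "q \<in> measurable borel (count_space UNIV)" "\<And>x. q x \<le> K"
    "\<And>x y. q x = q y \<Longrightarrow> norm x \<le> R \<Longrightarrow> norm y \<le> R \<Longrightarrow> dist x y \<le> t"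
    by (rule finite_fine_partition[OF t, of R]) (rule that; assumption)
  \<comment> \<open>The least number of particles with
    \<open>2 * R * (K + 1) / sqrt N \<le> t\<close>, which is possible because \<open>K\<close> was
    fixed before.\<close>
  define N0 where "N0 = nat \<lceil>(2 * R * (K + 1) / t)\<^sup>2\<rceil>"
  show ?thesis
  proof (rule that[of N0])
    fix N n :: nat assume N: "1 \<le> N" "N0 \<le> N"
    have "(2 * R * (K + 1) / t)\<^sup>2 \<le> real N" using N(2) by (simp add: N0_def)
    then have "2 * R * (K + 1) / t \<le> sqrt (real N)" by (rule real_le_rsqrt)
    then have fl: "2 * R * (K + 1) / sqrt N \<le> t" using t N by (simp add: field_simps)
    show "\<exists>S\<in>borel_measurable M. (\<integral>\<^sup>+ w. S w \<partial>M) \<le> ennreal B \<and>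
      (\<forall>w. wass (empirical N (pos N n w)) (\<mu> n) \<le> S w + ennreal (\<gamma> ^ n) * wass (empirical N (pos N 0 w)) \<mu>0)"
    proof (rule wass_iterate[OF N(1) q])
      show "0 \<le> t" "0 \<le> R" "0 \<le> B" using t R assms by simp_all
      show "(\<integral>\<^sup>+ w. err N q K R t (pos N n w) (innov N (Suc n) w) \<partial>M) \<le> ennreal ((1 - \<gamma>) * B)" for n
      proof -
        have "(\<integral>\<^sup>+ w. err N q K R t (pos N n w) (innov N (Suc n) w) \<partial>M)
          \<le> ennreal (t + 4 * (R powr (- b) * C) + 2 * R * (K + 1) / sqrt N)"
          using t by (intro uniform_error b N R q mom C) simp_all
        also have "\<dots> \<le> ennreal ((1 - \<gamma>) * B)"
          using tailb fl by (intro ennreal_leI) (simp add: t_def)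
        finally show ?thesis .
      qed
    qed
  qed
qed

section \<open>The two convergence statements\<close>

lemma ennreal_W1_emp_meas:
  "1 \<le> N \<Longrightarrow> ennreal (W1 (emp_meas A \<delta> f X0 eps N n w) (\<mu> n)) = wass (empirical N (pos N n w)) (\<mu> n)"
  unfolding emp_meas_eq by (rule ennreal_W1[OF empirical_in_P1 nonlin_in_P1])

text \<open>The initial distance need not be small: its mean is at most twice the first moment of
  \<open>\<mu>0\<close>, and the factor \<open>\<gamma> ^ n\<close> removes it for late times. Two
  shares of \<open>\<epsilon>/4\<close> leave room for the strict inequality.\<close>

lemma W1_eventually_small:
  assumes \<epsilon>: "0 < \<epsilon>"
  shows "\<exists>N0 n0. \<forall>n N. n \<ge> n0 \<longrightarrow> N \<ge> N0 \<longrightarrow> N \<ge> 1 \<longrightarrow>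
    (\<integral>\<^sup>+ w. ennreal (W1 (emp_meas A \<delta> f X0 eps N n w) (\<mu> n)) \<partial>M) < ennreal \<epsilon>"
proof -
  obtain N0 where N0: "\<And>N n. 1 \<le> N \<Longrightarrow> N0 \<le> N \<Longrightarrow>
    \<exists>S\<in>borel_measurable M. (\<integral>\<^sup>+ w. S w \<partial>M) \<le> ennreal (\<epsilon>/4) \<and>
      (\<forall>w. wass (empirical N (pos N n w)) (\<mu> n) \<le> S w + ennreal (\<gamma> ^ n) * wass (empirical N (pos N 0 w)) \<mu>0)"
    using uniform_wass_bound[of "\<epsilon>/4"] \<epsilon> by (metis divide_pos_pos zero_less_numeral)
  define m where "m = enn2real (\<integral>\<^sup>+ y. ennreal (norm y) \<partial>\<mu>0)"
  have m: "(\<integral>\<^sup>+ y. ennreal (norm y) \<partial>\<mu>0) = ennreal m" "0 \<le> m" using mu0 by (simp_all add: m_def P1_iff)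
  have "(\<lambda>n. \<gamma> ^ n * (2 * m)) \<longlonglongrightarrow> 0 * (2 * m)"
    using gamma_bounds by (intro tendsto_mult LIMSEQ_power_zero tendsto_const) simp
  then have "eventually (\<lambda>n. \<gamma> ^ n * (2 * m) < \<epsilon>/4) sequentially"
    by (rule order_tendstoD(2)) (use \<epsilon> in simp)
  then obtain n0 where n0: "\<And>n. n \<ge> n0 \<Longrightarrow> \<gamma> ^ n * (2 * m) < \<epsilon>/4" unfolding eventually_sequentially by blast
  have "(\<integral>\<^sup>+ w. ennreal (W1 (emp_meas A \<delta> f X0 eps N n w) (\<mu> n)) \<partial>M) < ennreal \<epsilon>"
    if n: "n \<ge> n0" and N: "N \<ge> N0" "N \<ge> 1" for n N
  proof -
    obtain S where S[measurable]: "S \<in> borel_measurable M" and SB: "(\<integral>\<^sup>+ w. S w \<partial>M) \<le> ennreal (\<epsilon>/4)"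
      and le: "\<And>w. wass (empirical N (pos N n w)) (\<mu> n) \<le> S w + ennreal (\<gamma> ^ n) * wass (empirical N (pos N 0 w)) \<mu>0"
      using N0[OF N(2,1)] by blast
    have gm: "(\<lambda>y::real^'d. ennreal (norm y)) \<in> borel_measurable borel" by measurable
    note [measurable] = measurable_nn_integral_empirical[OF N(2) gm]
    have "(\<integral>\<^sup>+ w. ennreal (W1 (emp_meas A \<delta> f X0 eps N n w) (\<mu> n)) \<partial>M)
       \<le> (\<integral>\<^sup>+ w. S w + ennreal (\<gamma> ^ n) * ((\<integral>\<^sup>+ y. ennreal (norm y) \<partial>empirical N (pos N 0 w)) + ennreal m) \<partial>M)"
    proof (intro nn_integral_mono)
      fix w
      \<comment> \<open>Replacing the initial distance by moments makes the integrand measurable, so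
        the integral is additive.\<close>
      have "wass (empirical N (pos N 0 w)) \<mu>0 \<le> (\<integral>\<^sup>+ y. ennreal (norm y) \<partial>empirical N (pos N 0 w)) + ennreal m"
        unfolding m(1)[symmetric]
        by (intro wass_le_moments prob_space_empirical[OF N(2)] P1_prob[OF mu0] P1_sets[OF mu0] sets_empirical)
      then have "S w + ennreal (\<gamma> ^ n) * wass (empirical N (pos N 0 w)) \<mu>0
         \<le> S w + ennreal (\<gamma> ^ n) * ((\<integral>\<^sup>+ y. ennreal (norm y) \<partial>empirical N (pos N 0 w)) + ennreal m)"
        by (intro add_left_mono mult_left_mono) simp_all
      then show "ennreal (W1 (emp_meas A \<delta> f X0 eps N n w) (\<mu> n)) \<le> \<dots>"
        unfolding ennreal_W1_emp_meas[OF N(2)] by (rule order_trans[OF le])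
    qed
    also have "\<dots> = (\<integral>\<^sup>+ w. S w \<partial>M) + ennreal (\<gamma> ^ n) * ((\<integral>\<^sup>+ w. \<integral>\<^sup>+ y. ennreal (norm y) \<partial>empirical N (pos N 0 w) \<partial>M) + ennreal m)"
      by (simp add: nn_integral_add nn_integral_cmult emeasure_space_1)
    also have "\<dots> \<le> ennreal (\<epsilon>/4) + ennreal (\<gamma> ^ n) * (ennreal m + ennreal m)"
      unfolding mean_empirical_0[OF N(2) gm] m(1) by (intro add_right_mono SB)
    also have "\<dots> = ennreal (\<epsilon>/4 + \<gamma> ^ n * (2 * m))"
      using \<epsilon> m gamma_bounds by (simp add: ennreal_plus[symmetric] ennreal_mult[symmetric] del: ennreal_plus)
    also have "\<dots> < ennreal \<epsilon>"
      using n0[OF n] \<epsilon> m gamma_bounds by (intro ennreal_lessI) auto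
    finally show ?thesis .
  qed
  then show ?thesis by blast
qed

text \<open>Since \<open>\<gamma> ^ n \<le> 1\<close>, the initial distance bounds its own
  contribution at every time, and its mean is small by assumption.\<close>

lemma W1_uniformly_small:
  assumes lim: "(\<lambda>N. \<integral>\<^sup>+ w. ennreal (W1 (emp_meas A \<delta> f X0 eps N 0 w) \<mu>0) \<partial>M) \<longlonglongrightarrow> 0"
  shows "(\<lambda>N. SUP n\<in>{1..}. \<integral>\<^sup>+ w. ennreal (W1 (emp_meas A \<delta> f X0 eps N n w) (\<mu> n)) \<partial>M) \<longlonglongrightarrow> 0"
proof (rule order_tendstoI)
  fix a :: ennreal assume "0 < a"
  \<comment> \<open>The threshold \<open>a\<close> may be infinite, so a finite
    \<open>\<epsilon>\<close> strictly below it is chosen; the supremum is then bounded by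
    \<open>\<epsilon>\<close> and stays strictly below \<open>a\<close>.\<close>
  then obtain a' where a': "0 < a'" "a' < a" using dense by blast
  obtain \<epsilon> where \<epsilon>: "0 < \<epsilon>" "ennreal \<epsilon> < a"
  proof -
    obtain r where "a' = ennreal r" "0 \<le> r" using a' by (cases a') auto
    then show ?thesis using a' that[of r] by auto
  qed
  obtain N0 where N0: "\<And>N n. 1 \<le> N \<Longrightarrow> N0 \<le> N \<Longrightarrow>
    \<exists>S\<in>borel_measurable M. (\<integral>\<^sup>+ w. S w \<partial>M) \<le> ennreal (\<epsilon>/2) \<and>
      (\<forall>w. wass (empirical N (pos N n w)) (\<mu> n) \<le> S w + ennreal (\<gamma> ^ n) * wass (empirical N (pos N 0 w)) \<mu>0)"
    using uniform_wass_bound[of "\<epsilon>/2"] \<epsilon>(1) by (metis divide_pos_pos zero_less_numeral)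
  have "eventually (\<lambda>N. (\<integral>\<^sup>+ w. ennreal (W1 (emp_meas A \<delta> f X0 eps N 0 w) \<mu>0) \<partial>M) < ennreal (\<epsilon>/2)) sequentially"
    using lim by (rule order_tendstoD(2)) (use \<epsilon>(1) in simp)
  then show "eventually (\<lambda>N. (SUP n\<in>{1..}. \<integral>\<^sup>+ w. ennreal (W1 (emp_meas A \<delta> f X0 eps N n w) (\<mu> n)) \<partial>M) < a) sequentially"
    using eventually_ge_at_top[of N0] eventually_ge_at_top[of 1]
  proof eventually_elim
    case (elim N)
    have "(SUP n\<in>{1..}. \<integral>\<^sup>+ w. ennreal (W1 (emp_meas A \<delta> f X0 eps N n w) (\<mu> n)) \<partial>M) \<le> ennreal \<epsilon>"
    proof (rule SUP_least)
      fix n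
      obtain S where S[measurable]: "S \<in> borel_measurable M" and SB: "(\<integral>\<^sup>+ w. S w \<partial>M) \<le> ennreal (\<epsilon>/2)"
        and le: "\<And>w. wass (empirical N (pos N n w)) (\<mu> n) \<le> S w + ennreal (\<gamma> ^ n) * wass (empirical N (pos N 0 w)) \<mu>0"
        using N0[OF elim(3,2)] by blast
      have "(\<integral>\<^sup>+ w. ennreal (W1 (emp_meas A \<delta> f X0 eps N n w) (\<mu> n)) \<partial>M)
         \<le> (\<integral>\<^sup>+ w. S w + ennreal (W1 (emp_meas A \<delta> f X0 eps N 0 w) \<mu>0) \<partial>M)"
      proof (intro nn_integral_mono)
        fix w
        have "\<gamma> ^ n \<le> 1" using gamma_bounds by (intro power_le_one) simp_all
        then have "ennreal (\<gamma> ^ n) * wass (empirical N (pos N 0 w)) \<mu>0 \<le> 1 * wass (empirical N (pos N 0 w)) \<mu>0"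
          by (intro mult_right_mono) simp_all
        then have "S w + ennreal (\<gamma> ^ n) * wass (empirical N (pos N 0 w)) \<mu>0 \<le> S w + ennreal (W1 (emp_meas A \<delta> f X0 eps N 0 w) \<mu>0)"
          using ennreal_W1_emp_meas[OF elim(3), of 0 w] unfolding nonlin_0 by (intro add_left_mono) simp
        then show "ennreal (W1 (emp_meas A \<delta> f X0 eps N n w) (\<mu> n)) \<le> \<dots>"
          unfolding ennreal_W1_emp_meas[OF elim(3)] by (rule order_trans[OF le])
      qed
      \<comment> \<open>The limit assumption concerns the possibly lower integral of the initial
        distance itself, so a measurable majorant cannot replace it here; measurability of
        \<open>S\<close> alone gives the needed subadditivity.\<close>
      also have "\<dots> \<le> (\<integral>\<^sup>+ w. S w \<partial>M) + (\<integral>\<^sup>+ w. ennreal (W1 (emp_meas A \<delta> f X0 eps N 0 w) \<mu>0) \<partial>M)"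
        by (rule nn_integral_add_le[OF S])
      also have "\<dots> \<le> ennreal (\<epsilon>/2) + ennreal (\<epsilon>/2)"
        using SB elim(1) by (intro add_mono) auto
      also have "\<dots> = ennreal \<epsilon>" using \<epsilon>(1) by (simp flip: ennreal_plus)
      finally show "(\<integral>\<^sup>+ w. ennreal (W1 (emp_meas A \<delta> f X0 eps N n w) (\<mu> n)) \<partial>M) \<le> ennreal \<epsilon>" .
    qed
    also have "\<dots> < a" by (rule \<epsilon>)
    finally show ?case .
  qed
qed simp

end

theorem theorem3p4:
  fixes M :: "'w measure"
    and A :: "real^'d^'d" and \<omega> \<delta> \<alpha> :: real
    and \<theta> :: "(real^'m) measure" and \<mu>0 :: "(real^'d) measure"
    and f :: "real^'d \<Rightarrow> (real^'d) measure \<Rightarrow> real^'m \<Rightarrow> real^'d"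
    and X0 :: "nat \<Rightarrow> nat \<Rightarrow> 'w \<Rightarrow> real^'d"
    and eps :: "nat \<Rightarrow> nat \<Rightarrow> 'w \<Rightarrow> real^'m"
  assumes M: "prob_space M"
    and theta: "prob_space \<theta>" "sets \<theta> = sets borel"
    and mu0: "\<mu>0 \<in> P1"
    and f_meas: "(\<lambda>((x,\<mu>),z). f x \<mu> z) \<in> borel_measurable
                   ((borel \<Otimes>\<^sub>M restrict_space (subprob_algebra borel) P1) \<Otimes>\<^sub>M borel)"
    and X0_rv: "\<And>N i. 1 \<le> i \<Longrightarrow> i \<le> N \<Longrightarrow> X0 N i \<in> borel_measurable M"
    and X0_law: "\<And>N i. 1 \<le> i \<Longrightarrow> i \<le> N \<Longrightarrow> distr M borel (X0 N i) = \<mu>0"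
    and X0_exch: "\<And>N p. N \<ge> 1 \<Longrightarrow> bij_betw p {1..N} {1..N} \<Longrightarrow>
        distr M (Pi\<^sub>M {1..N} (\<lambda>_. borel)) (\<lambda>w. \<lambda>i\<in>{1..N}. X0 N (p i) w)
      = distr M (Pi\<^sub>M {1..N} (\<lambda>_. borel)) (\<lambda>w. \<lambda>i\<in>{1..N}. X0 N i w)"
    and eps_rv: "\<And>i n. 1 \<le> i \<Longrightarrow> 1 \<le> n \<Longrightarrow> eps i n \<in> borel_measurable M"
    and eps_law: "\<And>i n. 1 \<le> i \<Longrightarrow> 1 \<le> n \<Longrightarrow> distr M borel (eps i n) = \<theta>"
    and eps_indep: "prob_space.indep_vars M (\<lambda>_. borel) (\<lambda>(i,n). eps i n)
                      {(i,n). 1 \<le> i \<and> 1 \<le> n}"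
    and eps_X0_indep: "prob_space.indep_set M
        {(\<lambda>w. \<lambda>(N,i)\<in>{(N,i). 1 \<le> i \<and> i \<le> N}. X0 N i w) -` B \<inter> space M | B.
            B \<in> sets (Pi\<^sub>M {(N,i). 1 \<le> i \<and> i \<le> N} (\<lambda>_. borel))}
        {(\<lambda>w. \<lambda>(i,n)\<in>{(i,n). 1 \<le> i \<and> 1 \<le> n}. eps i n w) -` B \<inter> space M | B.
            B \<in> sets (Pi\<^sub>M {(i,n). 1 \<le> i \<and> 1 \<le> n} (\<lambda>_. borel))}"
    and A3: "\<omega> > 0" "onorm (\<lambda>x. A *v x) \<le> exp (- \<omega>)"
    and A4: "\<alpha> > 0"
        "(\<integral>\<^sup>+ x. ennreal (norm x powr (1 + \<alpha>)) \<partial>\<mu>0) < \<infinity>"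
        "(\<integral>\<^sup>+ z. epow (Dconst f z) (1 + \<alpha>) \<partial>\<theta>) < \<infinity>"
        "(\<integral>\<^sup>+ z. ennreal (D1const f z powr (1 + \<alpha>)) \<partial>\<theta>) < \<infinity>"
    and delta: "\<delta> > 0"
        "2 * (\<integral>\<^sup>+ z. Dconst f z \<partial>\<theta>) * ennreal \<delta> < ennreal (1 - exp (- \<omega>))"
  shows "(\<forall>\<epsilon>>0. \<exists>N0 n0. \<forall>n N. n \<ge> n0 \<longrightarrow> N \<ge> N0 \<longrightarrow> N \<ge> 1 \<longrightarrow>
            (\<integral>\<^sup>+ w. ennreal (W1 (emp_meas A \<delta> f X0 eps N n w) (nonlin A \<delta> f \<theta> \<mu>0 n)) \<partial>M)
              < ennreal \<epsilon>)
       \<and> (((\<lambda>N. \<integral>\<^sup>+ w. ennreal (W1 (emp_meas A \<delta> f X0 eps N 0 w) \<mu>0) \<partial>M) \<longlonglongrightarrow> 0)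
          \<longrightarrow> ((\<lambda>N. SUP n\<in>{1..}. \<integral>\<^sup>+ w. ennreal (W1 (emp_meas A \<delta> f X0 eps N n w)
                                                        (nonlin A \<delta> f \<theta> \<mu>0 n)) \<partial>M)
                \<longlonglongrightarrow> 0))"
proof -
  have "mean_field A \<omega> \<delta> \<alpha> \<theta> f"
    by (rule mean_field.intro) (fact theta f_meas A3 A4 delta)+
  moreover have "particle_system_axioms \<alpha> \<theta> M \<mu>0 X0 eps"
    by (rule particle_system_axioms.intro)
      (fact mu0 X0_rv X0_law eps_rv eps_law eps_indep eps_X0_indep A4)+
  ultimately interpret particle_system A \<omega> \<delta> \<alpha> \<theta> f M \<mu>0 X0 eps
    by (intro particle_system.intro M)
  show ?thesis using W1_eventually_small W1_uniformly_small by blast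
qed

end
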